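(* Let $M$ be a model of the theory of finite arithmetic $\mathrm{FA}$ in which $0<N$, where $N$ denotes the largest number of $M$. Then there is a model $M^+$ of $\mathrm{FA}$ that is strictly taller than $M$, such that for all $x,y\in M$ the sum $x+y$ and the product $x\cdot y$ are defined in $M^+$, and such that $M$ and $M^+$ are bi-interpretable.
   Context: The theory of finite arithmetic $\mathrm{FA}$ is formulated in the language $\{+,\cdot,0,1,N,<\}$, where $0,1,N$ are constants, $<$ is a binary relation, and $+$ and $\cdot$ are binary partial functions, treated officially in first-order logic as ternary relations (their graphs) that are single-valued. Its axioms are as follows. (1) Order: $<$ is a discrete linear order with least element $0$ and largest element $N$. (Discrete: every element other than $N$ has an immediate successor, and every element other than $0$ has an immediate predecessor.) (2) Successor: for every $n<N$ the sum $n+1$ is defined and is the immediate successor of $n$ with respect to $<$; the sum $N+1$ is undefined. (3) Arithmetic: for all $n$, $n+0=n$ and $n\cdot 0=0$ (both defined); and for all $n$ and all $m<N$, $$n+(m+1)=(n+m)+1,\qquad n\cdot(m+1)=n\cdot m+n,$$ in the sense that the left-hand side is defined if and only if the right-hand side is defined, in which case they are equal. (An expression is defined only if all its subexpressions are defined.) (4) Induction: for every formula $\varphi$ in the language of finite arithmetic (parameters allowed), $$\bigl[\varphi(0)\wedge\forall n<N\,(\varphi(n)\to\varphi(n+1))\bigr]\to\forall n\,\varphi(n).$$ A model $M^+$ of $\mathrm{FA}$ is strictly taller than a model $M$ of $\mathrm{FA}$ if, after identifying $M$ with an isomorphic copy, the domain of $M$ is a proper initial segment of the domain of $M^+$ with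 respect to the order of $M^+$, the constants $0,1$ and the order of $M$ are those of $M^+$, and for all $x,y,z\in M$ one has $x+y=z$ in $M$ if and only if $x+y=z$ in $M^+$, and $x\cdot y=z$ in $M$ if and only if $x\cdot y=z$ in $M^+$. The constant symbol $N$ is interpreted in each model separately as the largest number of that model, so its interpretation in $M^+$ differs from that in $M$. An interpretation of a structure $B$ in a structure $A$ means an isomorphism from $B$ to a structure whose elements are $k$-tuples from $A$ for some fixed finite $k$, modulo a definable equivalence relation, with the domain, the equivalence relation, and all the relations and (partial) functions and constants being first-order definable in $A$; parameters are allowed. Two structures $A$ and $B$ are bi-interpretable if there are an interpretation of $B$ in $A$ and an interpretation of $A$ in $B$ such that the resulting isomorphism of $A$ with the copy of $A$ inside the copy of $B$ inside $A$ is definable in $A$ (with parameters), and likewise the resulting isomorphism of $B$ with the copy of $B$ inside the copy of $A$ inside $B$ is definable in $B$ (with parameters). *)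

theory Defs
  imports Main
begin

text \<open>
  Structures for the language $\{+,\cdot,0,1,N,<\}$.  The partial functions $+$ and $\cdot$ are given
  by their graphs: \<open>Add M x y z\<close> reads \<open>x + y = z\<close>.  Only the behaviour of the relations on
  \<open>Dom M\<close> matters.
\<close>

record 'a fa_struct =
  Dom :: "'a set"
  Zero :: 'a
  One :: 'a
  Top :: 'a
  Less :: "'a \<Rightarrow> 'a \<Rightarrow> bool"
  Add :: "'a \<Rightarrow> 'a \<Rightarrow> 'a \<Rightarrow> bool"
  Mul :: "'a \<Rightarrow> 'a \<Rightarrow> 'a \<Rightarrow> bool"

datatype fa_term = TVar nat | TZero | TOne | TTop

datatype fa_form =
    FEq fa_term fa_term
  | FLess fa_term fa_term
  | FAdd fa_term fa_term fa_term
  | FMul fa_term fa_term fa_term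
  | FNeg fa_form
  | FConj fa_form fa_form
  | FAll nat fa_form

primrec tval :: "'a fa_struct \<Rightarrow> (nat \<Rightarrow> 'a) \<Rightarrow> fa_term \<Rightarrow> 'a" where
  "tval M e (TVar v) = e v"
| "tval M e TZero = Zero M"
| "tval M e TOne = One M"
| "tval M e TTop = Top M"

primrec sat :: "'a fa_struct \<Rightarrow> (nat \<Rightarrow> 'a) \<Rightarrow> fa_form \<Rightarrow> bool" where
  "sat M e (FEq s t) \<longleftrightarrow> tval M e s = tval M e t"
| "sat M e (FLess s t) \<longleftrightarrow> Less M (tval M e s) (tval M e t)"
| "sat M e (FAdd s t u) \<longleftrightarrow> Add M (tval M e s) (tval M e t) (tval M e u)"
| "sat M e (FMul s t u) \<longleftrightarrow> Mul M (tval M e s) (tval M e t) (tval M e u)"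
| "sat M e (FNeg p) \<longleftrightarrow> \<not> sat M e p"
| "sat M e (FConj p q) \<longleftrightarrow> sat M e p \<and> sat M e q"
| "sat M e (FAll v p) \<longleftrightarrow> (\<forall>a\<in>Dom M. sat M (e(v := a)) p)"


definition is_fa_struct :: "'a fa_struct \<Rightarrow> bool" where
  "is_fa_struct M \<longleftrightarrow>
     Zero M \<in> Dom M \<and> One M \<in> Dom M \<and> Top M \<in> Dom M \<and>
     (\<forall>x\<in>Dom M. \<forall>y\<in>Dom M. \<forall>z\<in>Dom M. \<forall>z'\<in>Dom M. Add M x y z \<longrightarrow> Add M x y z' \<longrightarrow> z = z') \<and>
     (\<forall>x\<in>Dom M. \<forall>y\<in>Dom M. \<forall>z\<in>Dom M. \<forall>z'\<in>Dom M. Mul M x y z \<longrightarrow> Mul M x y z' \<longrightarrow> z = z')"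

definition imm_succ :: "'a fa_struct \<Rightarrow> 'a \<Rightarrow> 'a \<Rightarrow> bool" where
  "imm_succ M x y \<longleftrightarrow> Less M x y \<and> \<not> (\<exists>z\<in>Dom M. Less M x z \<and> Less M z y)"

definition fa_order :: "'a fa_struct \<Rightarrow> bool" where
  "fa_order M \<longleftrightarrow>
     (\<forall>x\<in>Dom M. \<not> Less M x x) \<and>
     (\<forall>x\<in>Dom M. \<forall>y\<in>Dom M. \<forall>z\<in>Dom M. Less M x y \<longrightarrow> Less M y z \<longrightarrow> Less M x z) \<and>
     (\<forall>x\<in>Dom M. \<forall>y\<in>Dom M. Less M x y \<or> x = y \<or> Less M y x) \<and>
     (\<forall>x\<in>Dom M. Zero M = x \<or> Less M (Zero M) x) \<and>
     (\<forall>x\<in>Dom M. x = Top M \<or> Less M x (Top M)) \<and>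
     (\<forall>x\<in>Dom M. x \<noteq> Top M \<longrightarrow> (\<exists>y\<in>Dom M. imm_succ M x y)) \<and>
     (\<forall>x\<in>Dom M. x \<noteq> Zero M \<longrightarrow> (\<exists>y\<in>Dom M. imm_succ M y x))"

definition fa_successor :: "'a fa_struct \<Rightarrow> bool" where
  "fa_successor M \<longleftrightarrow>
     (\<forall>n\<in>Dom M. Less M n (Top M) \<longrightarrow> (\<exists>m\<in>Dom M. Add M n (One M) m \<and> imm_succ M n m)) \<and>
     \<not> (\<exists>m\<in>Dom M. Add M (Top M) (One M) m)"

text \<open>
  For single-valued graphs, two partial expressions are either both undefined or both defined and
  equal iff they have the same values \<open>z\<close>; intermediate values must exist in \<open>Dom M\<close>.
\<close>

definition fa_arithmetic :: "'a fa_struct \<Rightarrow> bool" where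
  "fa_arithmetic M \<longleftrightarrow>
     (\<forall>n\<in>Dom M. Add M n (Zero M) n \<and> Mul M n (Zero M) (Zero M)) \<and>
     (\<forall>n\<in>Dom M. \<forall>m\<in>Dom M. Less M m (Top M) \<longrightarrow>
        (\<forall>z\<in>Dom M.
           (\<exists>s\<in>Dom M. Add M m (One M) s \<and> Add M n s z) \<longleftrightarrow>
           (\<exists>t\<in>Dom M. Add M n m t \<and> Add M t (One M) z)) \<and>
        (\<forall>z\<in>Dom M.
           (\<exists>s\<in>Dom M. Add M m (One M) s \<and> Mul M n s z) \<longleftrightarrow>
           (\<exists>t\<in>Dom M. Mul M n m t \<and> Add M t n z)))"

text \<open>The assignment \<open>e\<close> supplies the parameters; the induction is on the variable \<open>v\<close>.\<close>

definition fa_induction :: "'a fa_struct \<Rightarrow> bool" where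
  "fa_induction M \<longleftrightarrow>
     (\<forall>p v e. range e \<subseteq> Dom M \<longrightarrow>
        sat M (e(v := Zero M)) p \<longrightarrow>
        (\<forall>n\<in>Dom M. \<forall>m\<in>Dom M. Less M n (Top M) \<longrightarrow> Add M n (One M) m \<longrightarrow>
           sat M (e(v := n)) p \<longrightarrow> sat M (e(v := m)) p) \<longrightarrow>
        (\<forall>n\<in>Dom M. sat M (e(v := n)) p))"

definition FA_model :: "'a fa_struct \<Rightarrow> bool" where
  "FA_model M \<longleftrightarrow>
     is_fa_struct M \<and> fa_order M \<and> fa_successor M \<and> fa_arithmetic M \<and> fa_induction M"


text \<open>
  \<open>strictly_taller_via f M M'\<close>: the identification of \<open>M\<close> with an isomorphic copy is \<open>f\<close>.
  There is deliberately no condition on \<open>Top\<close>.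
\<close>

definition strictly_taller_via :: "('a \<Rightarrow> 'b) \<Rightarrow> 'a fa_struct \<Rightarrow> 'b fa_struct \<Rightarrow> bool" where
  "strictly_taller_via f M M' \<longleftrightarrow>
     inj_on f (Dom M) \<and>
     f ` Dom M \<subset> Dom M' \<and>
     (\<forall>x\<in>f ` Dom M. \<forall>y\<in>Dom M'. Less M' y x \<longrightarrow> y \<in> f ` Dom M) \<and>
     f (Zero M) = Zero M' \<and>
     f (One M) = One M' \<and>
     (\<forall>x\<in>Dom M. \<forall>y\<in>Dom M. Less M x y \<longleftrightarrow> Less M' (f x) (f y)) \<and>
     (\<forall>x\<in>Dom M. \<forall>y\<in>Dom M. \<forall>z\<in>Dom M. Add M x y z \<longleftrightarrow> Add M' (f x) (f y) (f z)) \<and>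
     (\<forall>x\<in>Dom M. \<forall>y\<in>Dom M. \<forall>z\<in>Dom M. Mul M x y z \<longleftrightarrow> Mul M' (f x) (f y) (f z))"


definition fa_iso :: "('a \<Rightarrow> 'b) \<Rightarrow> 'a fa_struct \<Rightarrow> 'b fa_struct \<Rightarrow> bool" where
  "fa_iso f M M' \<longleftrightarrow>
     bij_betw f (Dom M) (Dom M') \<and>
     f (Zero M) = Zero M' \<and>
     f (One M) = One M' \<and>
     f (Top M) = Top M' \<and>
     (\<forall>x\<in>Dom M. \<forall>y\<in>Dom M. Less M x y \<longleftrightarrow> Less M' (f x) (f y)) \<and>
     (\<forall>x\<in>Dom M. \<forall>y\<in>Dom M. \<forall>z\<in>Dom M. Add M x y z \<longleftrightarrow> Add M' (f x) (f y) (f z)) \<and>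
     (\<forall>x\<in>Dom M. \<forall>y\<in>Dom M. \<forall>z\<in>Dom M. Mul M x y z \<longleftrightarrow> Mul M' (f x) (f y) (f z))"

definition tuples :: "'a fa_struct \<Rightarrow> nat \<Rightarrow> 'a list set" where
  "tuples M k = {xs. length xs = k \<and> set xs \<subseteq> Dom M}"

text \<open>
  Definability with parameters: variables \<open>0, \<dots>, k - 1\<close> stand for the entries of the tuple, the
  remaining ones for parameters.
\<close>

definition definable :: "'a fa_struct \<Rightarrow> nat \<Rightarrow> 'a list set \<Rightarrow> bool" where
  "definable M k X \<longleftrightarrow>
     (\<exists>p e. range e \<subseteq> Dom M \<and>
        X = {xs \<in> tuples M k. sat M (\<lambda>i. if i < k then xs ! i else e i) p})"

text \<open>
  \<open>C\<close> is a structure whose elements are \<open>k\<close>-tuples from \<open>A\<close>, with definable domain \<open>D\<close>, modulo the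
  definable equivalence relation \<open>E\<close>; its constants and relations are definable when pulled back
  to tuples.
\<close>

definition definable_structure ::
    "'a fa_struct \<Rightarrow> nat \<Rightarrow> 'a list set \<Rightarrow> 'a list rel \<Rightarrow> 'a list set fa_struct \<Rightarrow> bool" where
  "definable_structure A k D E C \<longleftrightarrow>
     definable A k D \<and>
     equiv D E \<and>
     definable A (2 * k) {xs @ ys | xs ys. (xs, ys) \<in> E} \<and>
     is_fa_struct C \<and>
     Dom C = D // E \<and>
     definable A k (Zero C) \<and>
     definable A k (One C) \<and>
     definable A k (Top C) \<and>
     definable A (2 * k)
       {xs @ ys | xs ys. xs \<in> D \<and> ys \<in> D \<and> Less C (E `` {xs}) (E `` {ys})} \<and>
     definable A (3 * k)
       {xs @ ys @ zs | xs ys zs. xs \<in> D \<and> ys \<in> D \<and> zs \<in> D \<and>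
          Add C (E `` {xs}) (E `` {ys}) (E `` {zs})} \<and>
     definable A (3 * k)
       {xs @ ys @ zs | xs ys zs. xs \<in> D \<and> ys \<in> D \<and> zs \<in> D \<and>
          Mul C (E `` {xs}) (E `` {ys}) (E `` {zs})}"

definition interpretation_in :: "'a fa_struct \<Rightarrow> 'b fa_struct \<Rightarrow> nat \<Rightarrow> ('b \<Rightarrow> 'a list set) \<Rightarrow> bool"
  where
  "interpretation_in A B k i \<longleftrightarrow> (\<exists>D E C. definable_structure A k D E C \<and> fa_iso i B C)"

text \<open>
  Given interpretations \<open>i\<close> of \<open>B\<close> in \<open>A\<close> (by \<open>k\<close>-tuples) and \<open>j\<close> of \<open>A\<close> in \<open>B\<close> (by \<open>l\<close>-tuples),
  the element of the copy of \<open>A\<close> inside the copy of \<open>B\<close> inside \<open>A\<close> that corresponds to \<open>a\<close> is a class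
  of \<open>l\<close>-tuples of classes of \<open>k\<close>-tuples.  It is represented by the set of all \<open>k * l\<close>-tuples
  obtained by concatenating representatives.
\<close>

definition iterated_copy :: "('b \<Rightarrow> 'a list set) \<Rightarrow> ('a \<Rightarrow> 'b list set) \<Rightarrow> 'a \<Rightarrow> 'a list set" where
  "iterated_copy i j a = {concat ws | ws bs. bs \<in> j a \<and> list_all2 (\<lambda>w b. w \<in> i b) ws bs}"

definition bi_interpretable :: "'a fa_struct \<Rightarrow> 'b fa_struct \<Rightarrow> bool" where
  "bi_interpretable A B \<longleftrightarrow>
     (\<exists>k l i j.
        interpretation_in A B k i \<and>
        interpretation_in B A l j \<and>
        definable A (1 + k * l) {a # w | a w. a \<in> Dom A \<and> w \<in> iterated_copy i j a} \<and>
        definable B (1 + k * l) {b # w | b w. b \<in> Dom B \<and> w \<in> iterated_copy j i b})"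

end

theory Submission
  imports Defs
begin

text \<open>
  Let \<open>N\<close> be the largest number of \<open>M\<close>.  The numbers of the taller model are the pairs \<open>[a, b]\<close> of
  elements of \<open>M\<close>, read as two-digit numbers \<open>a * (N + 1) + b\<close> in base \<open>N + 1\<close> and ordered
  lexicographically; \<open>M\<close> is the initial segment of all \<open>[0, b]\<close>.  The largest pair is
  \<open>N * N + 2 * N\<close>, so that sums and products of elements of \<open>M\<close> exist there.  The difficulty is to
  define the arithmetic of pairs inside \<open>M\<close>, where overflowing sums and products are undefined.

  Addition comes first.  When \<open>x + y\<close> overflows, \<open>y\<close> splits as \<open>(v + 1) + z\<close> with \<open>x + v = N\<close>, and
  \<open>x + y\<close> is \<open>z\<close> with a carry (\<open>wsum\<close>).  The resulting addition of pairs modulo \<open>(N + 1) * (N + 1)\<close>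
  is a definable total operation which obeys the recursion equations; by induction they turn the
  pairs into an abelian group (\<open>add2_assoc\<close>, \<open>add2_inverse\<close>), in which partial sums of \<open>M\<close> become
  equations (\<open>emb_Add\<close>).

  For multiplication it suffices to define all two-digit products \<open>dp a b\<close> of two digits.  Call \<open>a\<close>
  small if \<open>a * a\<close> exists in \<open>M\<close>.  For small \<open>a > 0\<close> write \<open>N = a * c + d\<close> and \<open>b = c * q + r\<close> with
  remainders; then \<open>a * b = q * (N + 1) + a * r - q * (d + 1)\<close>, where \<open>q \<le> a\<close> and all products on
  the right exist in \<open>M\<close> (\<open>mu_graph\<close>, \<open>mu_line\<close>).  If \<open>s\<close> is the largest small number, then
  every \<open>a\<close> is \<open>s * p + r1 + r2\<close> with \<open>p\<close>, \<open>r1\<close>, \<open>r2\<close> at most \<open>s\<close>, because \<open>s * s + s + s\<close> is one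
  less than the square of \<open>s + 1\<close> (\<open>rep_ex\<close>).  So multiplication by \<open>a\<close> is built from
  multiplications by small numbers by composition and addition (\<open>line_extend\<close>, \<open>line_add2\<close>), and
  the choice of the decomposition is harmless, since two definable functions with the same
  recursion equations agree (\<open>line_unique\<close>).

  The partial operations of the taller model demand that the total ones do not wrap around on the
  way, that is, for any smaller second argument (\<open>padd\<close>, \<open>pmul\<close>); in this form the arithmetic axioms
  are immediate.  Induction holds because formulas about pairs translate into formulas about \<open>M\<close>
  (\<open>dfn_sat_tall\<close>) and lexicographic induction reduces to two inductions in \<open>M\<close> (\<open>induct_G\<close>).
  Conversely \<open>M\<close> is interpreted in the taller model as its initial segment.  The round trip from \<open>M\<close>
  sends \<open>a\<close> to \<open>[0, a]\<close>; the round trip from the taller model sends a number to its two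
  digits, which is definable there because \<open>[a, b] = [1, 0] * [0, a] + [0, b]\<close>
  (\<open>bi_interpretable_tall\<close>).
\<close>

section \<open>Definability without syntax\<close>

primrec rename_term :: "(nat \<Rightarrow> nat) \<Rightarrow> fa_term \<Rightarrow> fa_term" where
  "rename_term r (TVar v) = TVar (r v)"
| "rename_term r TZero = TZero"
| "rename_term r TOne = TOne"
| "rename_term r TTop = TTop"

primrec rename_form :: "(nat \<Rightarrow> nat) \<Rightarrow> fa_form \<Rightarrow> fa_form" where
  "rename_form r (FEq s t) = FEq (rename_term r s) (rename_term r t)"
| "rename_form r (FLess s t) = FLess (rename_term r s) (rename_term r t)"
| "rename_form r (FAdd s t u) = FAdd (rename_term r s) (rename_term r t) (rename_term r u)"
| "rename_form r (FMul s t u) = FMul (rename_term r s) (rename_term r t) (rename_term r u)"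
| "rename_form r (FNeg p) = FNeg (rename_form r p)"
| "rename_form r (FConj p q) = FConj (rename_form r p) (rename_form r q)"
| "rename_form r (FAll v p) = FAll (r v) (rename_form r p)"

lemma tval_rename: "tval M e (rename_term r t) = tval M (\<lambda>n. e (r n)) t"
  by (cases t) auto

lemma sat_rename:
  assumes "inj r"
  shows "sat M e (rename_form r p) \<longleftrightarrow> sat M (\<lambda>n. e (r n)) p"
proof (induction p arbitrary: e)
  case (FAll v p)
  have "(\<lambda>n. (e(r v := a)) (r n)) = (\<lambda>n. e (r n))(v := a)" for a
    using assms by (auto simp: fun_eq_iff inj_eq)
  with FAll show ?case by simp
qed (simp_all add: tval_rename)

text \<open>
  Three disjoint stocks of variables: those divisible by 3 hold the arguments \<open>e\<close> of a predicate,
  the next ones its parameters \<open>c\<close>.  The remaining ones hold an irrelevant \<open>j\<close>; they are spare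
  variables which a quantifier can bind, so that only injective renamings are ever needed and
  capture of variables cannot occur.
\<close>

definition mix :: "(nat \<Rightarrow> 'a) \<Rightarrow> (nat \<Rightarrow> 'a) \<Rightarrow> (nat \<Rightarrow> 'a) \<Rightarrow> nat \<Rightarrow> 'a" where
  "mix e c j n = (if n mod 3 = 0 then e (n div 3) else if n mod 3 = 1 then c (n div 3)
     else j (n div 3))"

definition blocks :: "(nat \<Rightarrow> nat) \<Rightarrow> (nat \<Rightarrow> nat) \<Rightarrow> (nat \<Rightarrow> nat) \<Rightarrow> nat \<Rightarrow> nat" where
  "blocks f g h n = (if n mod 3 = 0 then 3 * f (n div 3) else
     if n mod 3 = 1 then 3 * g (n div 3) + 1 else 3 * h (n div 3) + 2)"

lemma nat_mod3_cases:
  obtains k where "n = 3 * k" | k where "n = 3 * k + 1" | k where "n = 3 * k + (2::nat)"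
proof -
  have "n = 3 * (n div 3) + n mod 3" "n mod 3 < 3" by simp_all
  then have "n = 3 * (n div 3) \<or> n = 3 * (n div 3) + 1 \<or> n = 3 * (n div 3) + 2" by linarith
  then show ?thesis using that by metis
qed

lemma mod3_simps [simp]:
  "(3 * k) mod 3 = (0::nat)" "(3 * k) div 3 = (k::nat)"
  "(3 * k + 1) mod 3 = (1::nat)" "(3 * k + 1) div 3 = (k::nat)"
  "Suc (3 * k) mod 3 = (1::nat)" "Suc (3 * k) div 3 = (k::nat)"
  "(3 * k + 2) mod 3 = (2::nat)" "(3 * k + 2) div 3 = (k::nat)"
  "Suc (Suc (3 * k)) mod 3 = (2::nat)" "Suc (Suc (3 * k)) div 3 = (k::nat)"
  by presburger+

lemma mix_simps [simp]:
  "mix e c j (3 * k) = e k" "mix e c j (3 * k + 1) = c k" "mix e c j (Suc (3 * k)) = c k"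
  "mix e c j (3 * k + 2) = j k" "mix e c j (Suc (Suc (3 * k))) = j k"
  by (simp_all add: mix_def)

lemma blocks_simps [simp]:
  "blocks f g h (3 * k) = 3 * f k" "blocks f g h (3 * k + 1) = 3 * g k + 1"
  "blocks f g h (Suc (3 * k)) = 3 * g k + 1"
  "blocks f g h (3 * k + 2) = 3 * h k + 2" "blocks f g h (Suc (Suc (3 * k))) = 3 * h k + 2"
  by (simp_all add: blocks_def)

lemma inj_blocks:
  assumes "inj f" "inj g" "inj h"
  shows "inj (blocks f g h)"
proof (rule injI)
  have d: "3 * k \<noteq> 3 * l + 1" "3 * k \<noteq> 3 * l + 2" "3 * k + 1 \<noteq> 3 * l + (2::nat)" for k l :: nat
    by presburger+
  fix x y assume "blocks f g h x = blocks f g h y"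
  then show "x = y"
    using assms
    by (cases x rule: nat_mod3_cases; cases y rule: nat_mod3_cases)
      (simp_all only: blocks_simps d d[symmetric], simp_all add: inj_eq)
qed

lemma mix_blocks: "(\<lambda>n. mix e c j (blocks f g h n)) = mix (\<lambda>i. e (f i)) (\<lambda>i. c (g i)) (\<lambda>i. j (h i))"
proof
  fix n
  show "mix e c j (blocks f g h n) = mix (\<lambda>i. e (f i)) (\<lambda>i. c (g i)) (\<lambda>i. j (h i)) n"
    by (cases n rule: nat_mod3_cases) auto
qed

text \<open>
  Moves argument 0 to the spare variable 2, where it is quantified, and argument \<open>i + 1\<close> to
  argument \<open>i\<close>.
\<close>

definition bind0 :: "nat \<Rightarrow> nat" where
  "bind0 n = (if n mod 3 = 0 then (if n = 0 then 2 else n - 3) else if n mod 3 = 1 then n else n + 3)"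

lemma inj_bind0: "inj bind0"
proof -
  have *: "bind0 (3 * k) = (if k = 0 then 2 else 3 * (k - 1))" "bind0 (3 * k + 1) = 3 * k + 1"
    "bind0 (3 * k + 2) = 3 * Suc k + 2" for k by (auto simp: bind0_def)
  show ?thesis
  proof (rule injI)
    fix x y assume "bind0 x = bind0 y"
    then show "x = y"
      by (cases x rule: nat_mod3_cases; cases y rule: nat_mod3_cases)
        (simp_all only: * split: if_splits, presburger+)
  qed
qed

lemma mix_bind0:
  "(\<lambda>n. ((mix e c j)(2 := x)) (bind0 n)) = mix (case_nat x e) c (\<lambda>i. j (Suc i))"
proof
  fix n
  show "((mix e c j)(2 := x)) (bind0 n) = mix (case_nat x e) c (\<lambda>i. j (Suc i)) n"
  proof (cases n rule: nat_mod3_cases)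
    case (1 k)
    show ?thesis
    proof (cases k)
      case 0
      then show ?thesis using 1 by (simp add: bind0_def mix_def)
    next
      case (Suc m)
      have "bind0 n = 3 * m" using 1 Suc by (simp add: bind0_def)
      moreover have "3 * m \<noteq> 2" by presburger
      moreover have "mix (case_nat x e) c (\<lambda>i. j (Suc i)) (3 * Suc m) = e m"
        by (subst mix_simps(1)) simp
      ultimately show ?thesis using 1 Suc by simp
    qed
  next
    case (2 k)
    have "bind0 n = 3 * k + 1" using 2 by (simp add: bind0_def)
    moreover have "3 * k + 1 \<noteq> 2" by presburger
    ultimately show ?thesis using 2 by simp
  next
    case (3 k)
    have "bind0 n = 3 * Suc k + 2" using 3 by (simp add: bind0_def)
    then have "((mix e c j)(2 := x)) (bind0 n) = mix e c j (3 * Suc k + 2)" by simp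
    also have "\<dots> = j (Suc k)" by (rule mix_simps)
    finally show ?thesis using 3 by simp
  qed
qed

locale struct =
  fixes M :: "'a fa_struct"
  assumes is_struct: "is_fa_struct M"
begin

abbreviation D where "D \<equiv> Dom M"

lemma consts_in [simp]: "Zero M \<in> D" "One M \<in> D" "Top M \<in> D"
  using is_struct by (auto simp: is_fa_struct_def)

definition env :: "(nat \<Rightarrow> 'a) \<Rightarrow> bool" where "env e \<longleftrightarrow> range e \<subseteq> D"

lemma env_in: "env e \<Longrightarrow> e n \<in> D" by (auto simp: env_def)
lemma env_Suc: "env e \<Longrightarrow> env (\<lambda>i. e (Suc i))" by (auto simp: env_def)
lemma env_comp: "env e \<Longrightarrow> env (\<lambda>i. e (f i))" by (auto simp: env_def)
lemma env_case: "env e \<Longrightarrow> x \<in> D \<Longrightarrow> env (case_nat x e)"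
  by (force simp: env_def split: nat.splits)
lemma env_mix: "env e \<Longrightarrow> env c \<Longrightarrow> env j \<Longrightarrow> env (mix e c j)"
  by (auto simp: env_def mix_def)

text \<open>
  First-order definability with parameters, as a property of semantic predicates on infinitely
  many arguments.  The closure rules below take the place of writing down formulas: \<open>intro\<close>
  with them follows the shape of a HOL formula.  A quantifier shifts the arguments as in de Bruijn
  notation; the premise of its rule is beta-reduced by unification.
\<close>

definition dfn :: "((nat \<Rightarrow> 'a) \<Rightarrow> bool) \<Rightarrow> bool" where
  "dfn P \<longleftrightarrow> (\<exists>p c. env c \<and> (\<forall>e j. env e \<longrightarrow> env j \<longrightarrow> P e = sat M (mix e c j) p))"

text \<open>
  A function with definable graph may be used as a term, although it is not a term of the
  language.
\<close>

definition dtm :: "((nat \<Rightarrow> 'a) \<Rightarrow> 'a) \<Rightarrow> bool" where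
  "dtm t \<longleftrightarrow> (\<forall>e. env e \<longrightarrow> t e \<in> D) \<and> dfn (\<lambda>e. t (\<lambda>i. e (Suc i)) = e 0)"

lemma dfn_cong: "(\<And>e. env e \<Longrightarrow> P e = Q e) \<Longrightarrow> dfn P \<longleftrightarrow> dfn Q"
  unfolding dfn_def by metis

lemma dfn_not: "dfn P \<Longrightarrow> dfn (\<lambda>e. \<not> P e)"
  unfolding dfn_def
proof (elim exE conjE)
  fix p c assume "env c" "\<forall>e j. env e \<longrightarrow> env j \<longrightarrow> P e = sat M (mix e c j) p"
  then show "\<exists>p c. env c \<and> (\<forall>e j. env e \<longrightarrow> env j \<longrightarrow> (\<not> P e) = sat M (mix e c j) p)"
    by (intro exI[of _ "FNeg p"] exI[of _ c]) auto
qed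

text \<open>
  The parameters of the two formulas are interleaved.
\<close>

lemma dfn_conj:
  assumes "dfn P" "dfn Q" shows "dfn (\<lambda>e. P e \<and> Q e)"
proof -
  obtain p c where p: "env c" "\<And>e j. env e \<Longrightarrow> env j \<Longrightarrow> P e = sat M (mix e c j) p"
    using assms(1) unfolding dfn_def by blast
  obtain q d where q: "env d" "\<And>e j. env e \<Longrightarrow> env j \<Longrightarrow> Q e = sat M (mix e d j) q"
    using assms(2) unfolding dfn_def by blast
  define b where "b n = (if even n then c (n div 2) else d (n div 2))" for n
  have b: "env b" "(\<lambda>i. b (2 * i)) = c" "(\<lambda>i. b (Suc (2 * i))) = d"
    using p(1) q(1) by (auto simp: b_def env_def)
  have i: "inj (blocks (\<lambda>n. n) (\<lambda>n. 2 * n) (\<lambda>n. n))" "inj (blocks (\<lambda>n. n) (\<lambda>n. Suc (2 * n)) (\<lambda>n. n))"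
    by (intro inj_blocks; simp add: inj_def)+
  show ?thesis unfolding dfn_def
    using b i p(2) q(2)
    by (intro exI[of _ "FConj (rename_form (blocks (\<lambda>n. n) (\<lambda>n. 2 * n) (\<lambda>n. n)) p)
          (rename_form (blocks (\<lambda>n. n) (\<lambda>n. Suc (2 * n)) (\<lambda>n. n)) q)"] exI[of _ b])
      (simp add: sat_rename mix_blocks)
qed

lemma dfn_all:
  assumes "dfn (\<lambda>e. Q (\<lambda>i. e (Suc i)) (e 0))" shows "dfn (\<lambda>e. \<forall>x\<in>D. Q e x)"
proof -
  obtain p c where p: "env c"
      "\<And>e j. env e \<Longrightarrow> env j \<Longrightarrow> Q (\<lambda>i. e (Suc i)) (e 0) = sat M (mix e c j) p"
    using assms(1) unfolding dfn_def by blast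
  have "(\<forall>x\<in>D. Q e x) = sat M (mix e c j) (FAll 2 (rename_form bind0 p))" if "env e" "env j" for e j
    using p(2)[OF env_case[OF that(1)] env_Suc[OF that(2)]]
    by (simp add: sat_rename[OF inj_bind0] mix_bind0 del: fun_upd_apply)
  then show ?thesis unfolding dfn_def using p(1) by blast
qed

lemma dfn_disj: "dfn P \<Longrightarrow> dfn Q \<Longrightarrow> dfn (\<lambda>e. P e \<or> Q e)"
  using dfn_not[OF dfn_conj[OF dfn_not dfn_not, of P Q]] by simp

lemma dfn_imp: "dfn P \<Longrightarrow> dfn Q \<Longrightarrow> dfn (\<lambda>e. P e \<longrightarrow> Q e)"
  using dfn_not[OF dfn_conj[OF _ dfn_not, of P Q]] by simp

lemma dfn_iff: "dfn P \<Longrightarrow> dfn Q \<Longrightarrow> dfn (\<lambda>e. P e = Q e)"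
  using dfn_conj[OF dfn_imp[of P Q] dfn_imp[of Q P]] by (simp add: iff_conv_conj_imp)

lemma dfn_ex: "dfn (\<lambda>e. Q (\<lambda>i. e (Suc i)) (e 0)) \<Longrightarrow> dfn (\<lambda>e. \<exists>x\<in>D. Q e x)"
  using dfn_not[OF dfn_all[of "\<lambda>e x. \<not> Q e x", OF dfn_not]] by simp

lemma dfn_rename:
  assumes "dfn P" "inj r" shows "dfn (\<lambda>e. P (\<lambda>i. e (r i)))"
proof -
  obtain p c where p: "env c" "\<And>e j. env e \<Longrightarrow> env j \<Longrightarrow> P e = sat M (mix e c j) p"
    using assms(1) unfolding dfn_def by blast
  have "inj (blocks r (\<lambda>n. n) (\<lambda>n. n))" by (intro inj_blocks assms(2); simp add: inj_def)
  then show ?thesis unfolding dfn_def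
    using p env_comp[of _ r]
    by (intro exI[of _ "rename_form (blocks r (\<lambda>n. n) (\<lambda>n. n)) p"] exI[of _ c])
      (simp add: sat_rename mix_blocks)
qed

definition merge :: "(nat \<Rightarrow> 'b) \<Rightarrow> (nat \<Rightarrow> 'b) \<Rightarrow> nat \<Rightarrow> 'b" where
  "merge e c n = (if even n then e (n div 2) else c (n div 2))"

definition split_vars :: "nat \<Rightarrow> nat" where
  "split_vars n = (if n mod 3 = 0 then (if even (n div 3) then 3 * (n div 3 div 2) else 3 * (n div 3 - 1) + 1)
     else if n mod 3 = 1 then 3 * (2 * (n div 3) + 1) + 1 else n)"

text \<open>
  Half of the arguments, infinitely many, become parameters: every other argument variable is
  renamed to a parameter variable, and the old parameters move to make room.  This is what the
  induction scheme of the taller model needs, whose parameters are given by a whole assignment.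
\<close>

lemma dfn_params:
  assumes "dfn P" "env e0" shows "dfn (\<lambda>e. P (merge e e0))"
proof -
  obtain p c where p: "env c" "\<And>e j. env e \<Longrightarrow> env j \<Longrightarrow> P e = sat M (mix e c j) p"
    using assms(1) unfolding dfn_def by blast
  have cases: thesis if "\<And>k. n = 3 * (2 * k) \<Longrightarrow> thesis" "\<And>k. n = 3 * (2 * k + 1) \<Longrightarrow> thesis"
    "\<And>k. n = 3 * k + 1 \<Longrightarrow> thesis" "\<And>k. n = 3 * k + 2 \<Longrightarrow> thesis" for thesis and n :: nat
  proof (cases n rule: nat_mod3_cases)
    case (1 k)
    have "k = 2 * (k div 2) \<or> k = 2 * (k div 2) + 1" by presburger
    then show ?thesis using that(1,2)[of "k div 2"] 1 by metis
  qed (rule that(3,4), assumption)+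
  have s: "split_vars (3 * (2 * k)) = 3 * k" "split_vars (3 * (2 * k + 1)) = 3 * (2 * k) + 1"
    "split_vars (3 * k + 1) = 3 * (2 * k + 1) + 1" "split_vars (3 * k + 2) = 3 * k + 2" for k
    unfolding split_vars_def mod3_simps by simp_all
  have inj: "inj split_vars"
  proof (rule injI)
    fix x y assume eq: "split_vars x = split_vars y"
    have d: "3 * k \<noteq> 3 * l + 1" "3 * k \<noteq> 3 * l + 2" "3 * k + 1 \<noteq> 3 * l + (2::nat)"
      "3 * (2 * k) + 1 \<noteq> 3 * (2 * l + 1) + 1" for k l :: nat
      by presburger+
    show "x = y"
      by (rule cases[of x]; rule cases[of y]; use eq in \<open>simp only: s d d[symmetric]\<close>) simp_all
  qed
  have eq: "(\<lambda>n. mix e (merge e0 c) j (split_vars n)) = mix (merge e e0) c j" for e j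
  proof
    fix n
    show "mix e (merge e0 c) j (split_vars n) = mix (merge e e0) c j n"
      by (cases n rule: cases; simp only: s mix_simps) (simp_all add: merge_def)
  qed
  have m: "env (merge e e0)" if "env e" for e
    using that assms(2) by (auto simp: merge_def env_def)
  have "env (merge e0 c)" using p(1) assms(2) by (auto simp: merge_def env_def)
  then show ?thesis unfolding dfn_def
    using p(2)[OF m]
    by (intro exI[of _ "rename_form split_vars p"] exI[of _ "merge e0 c"])
      (simp add: sat_rename[OF inj] eq)
qed

lemma dtm_in: "dtm t \<Longrightarrow> env e \<Longrightarrow> t e \<in> D" by (simp add: dtm_def)

lemma dtm_shift:
  assumes "dtm t" shows "dtm (\<lambda>e. t (\<lambda>i. e (Suc i)))"
proof -
  have "inj (case_nat 0 (\<lambda>i. Suc (Suc i)))" by (auto intro!: injI split: nat.splits)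
  from dfn_rename[OF _ this, of "\<lambda>e. t (\<lambda>i. e (Suc i)) = e 0"] assms
  show ?thesis by (simp add: dtm_def env_Suc)
qed

text \<open>
  Substitution of a term \<open>t\<close> for \<open>x\<close> is read as \<open>\<exists>x. t = x \<and> Q x\<close>.
\<close>

lemma dfn_subst:
  assumes "dtm t" "dfn (\<lambda>e. Q (\<lambda>i. e (Suc i)) (e 0))" shows "dfn (\<lambda>e. Q e (t e))"
proof -
  have "dfn (\<lambda>e. \<exists>x\<in>D. t e = x \<and> Q e x)"
    using assms by (intro dfn_ex dfn_conj) (auto simp: dtm_def)
  then show ?thesis by (rule dfn_cong[THEN iffD1, rotated]) (use dtm_in[OF assms(1)] in auto)
qed

lemma dfn_FEq: "dfn (\<lambda>e. e m = e n)" 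
  unfolding dfn_def 
  by (intro exI[of _ "FEq (TVar (3*m)) (TVar (3*n))"] exI[of _ "\<lambda>_. Zero M"]) (auto simp: env_def)

lemma dtm_var: "dtm (\<lambda>e. e n)"
  unfolding dtm_def by (auto intro: dfn_FEq env_in)

lemma dtm_const: "a \<in> D \<Longrightarrow> dtm (\<lambda>e. a)"
  unfolding dtm_def dfn_def
  by (auto intro!: exI[of _ "FEq (TVar 1) (TVar 0)"] exI[of _ "\<lambda>_. a"] simp: env_def mix_def)

lemma dfn_app1: "dfn (\<lambda>e. R (e 0)) \<Longrightarrow> dtm s \<Longrightarrow> dfn (\<lambda>e. R (s e))"
  by (rule dfn_subst)

lemma dfn_app2:
  assumes "dfn (\<lambda>e. R (e 0) (e 1))" "dtm s" "dtm t" shows "dfn (\<lambda>e. R (s e) (t e))"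
proof -
  have "inj (\<lambda>n. if n = 0 then 1 else if n = 1 then 0 else n :: nat)"
    by (auto simp: inj_def)
  from dfn_rename[OF assms(1) this] have "dfn (\<lambda>e. R (e 1) (e 0))" by simp
  then have "dfn (\<lambda>e. R (e 0) (t (\<lambda>i. e (Suc i))))"
    by (intro dfn_subst[of "\<lambda>e. t (\<lambda>i. e (Suc i))" "\<lambda>e x. R (e 0) x"] dtm_shift assms(3)) simp
  then show ?thesis by (intro dfn_subst[OF assms(2), of "\<lambda>e x. R x (t e)"])
qed

lemma dfn_app3:
  assumes "dfn (\<lambda>e. R (e 0) (e 1) (e 2))" "dtm s" "dtm t" "dtm u"
  shows "dfn (\<lambda>e. R (s e) (t e) (u e))"
proof -
  have "inj (\<lambda>n. if n = 0 then 1 else if n = 1 then 2 else if n = 2 then 0 else n :: nat)"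
    by (auto simp: inj_def)
  from dfn_rename[OF assms(1) this] have "dfn (\<lambda>e. R (e 1) (e 2) (e 0))" by simp
  then have a: "dfn (\<lambda>e. R (e 0) (e 1) (u (\<lambda>i. e (Suc (Suc i)))))"
    by (intro dfn_subst[of "\<lambda>e. u (\<lambda>i. e (Suc (Suc i)))" "\<lambda>e x. R (e 0) (e 1) x"]
        dtm_shift[of "\<lambda>e. u (\<lambda>i. e (Suc i))"] dtm_shift assms) (simp add: numeral_2_eq_2)
  have "inj (\<lambda>n. if n = 0 then 1 else if n = 1 then 0 else n :: nat)"
    by (auto simp: inj_def)
  from dfn_rename[OF a this] have "dfn (\<lambda>e. R (e 1) (e 0) (u (\<lambda>i. e (Suc (Suc i)))))" by simp
  then have "dfn (\<lambda>e. R (e 0) (t (\<lambda>i. e (Suc i))) (u (\<lambda>i. e (Suc i))))"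
    by (intro dfn_subst[of "\<lambda>e. t (\<lambda>i. e (Suc i))" "\<lambda>e x. R (e 0) x (u (\<lambda>i. e (Suc i)))"]
        dtm_shift assms) simp
  then show ?thesis by (intro dfn_subst[OF assms(2), of "\<lambda>e x. R x (t e) (u e)"])
qed

lemma dfn_app4:
  assumes "dfn (\<lambda>e. R (e 0) (e 1) (e 2) (e 3))" "dtm s" "dtm t" "dtm u" "dtm v"
  shows "dfn (\<lambda>e. R (s e) (t e) (u e) (v e))"
proof -
  define f :: "nat \<Rightarrow> nat"
    where "f n = (if n = 0 then 1 else if n = 1 then 2 else if n = 2 then 3 else if n = 3 then 0 else n)" for n
  have "inj f" by (auto simp: inj_def f_def)
  from dfn_rename[OF assms(1) this] have "dfn (\<lambda>e. R (e 1) (e 2) (e 3) (e 0))"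
    by (simp add: f_def)
  then have *: "dfn (\<lambda>e. R (e 0) (e 1) (e 2) (v (\<lambda>i. e (Suc (Suc (Suc i))))))"
    by (intro dfn_subst[of "\<lambda>e. v (\<lambda>i. e (Suc (Suc (Suc i))))" "\<lambda>e x. R (e 0) (e 1) (e 2) x"]
        dtm_shift[of "\<lambda>e. v (\<lambda>i. e (Suc (Suc i)))"] dtm_shift[of "\<lambda>e. v (\<lambda>i. e (Suc i))"]
        dtm_shift assms) (simp add: eval_nat_numeral)
  define g :: "nat \<Rightarrow> nat"
    where "g n = (if n = 0 then 1 else if n = 1 then 2 else if n = 2 then 0 else n)" for n
  have "inj g" by (auto simp: inj_def g_def)
  from dfn_rename[OF * this]
  have "dfn (\<lambda>e. R (e 1) (e 2) (e 0) (v (\<lambda>i. e (Suc (Suc (Suc i))))))"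
    by (simp add: g_def)
  then have *: "dfn (\<lambda>e. R (e 0) (e 1) (u (\<lambda>i. e (Suc (Suc i)))) (v (\<lambda>i. e (Suc (Suc i)))))"
    by (intro dfn_subst[of "\<lambda>e. u (\<lambda>i. e (Suc (Suc i)))"
          "\<lambda>e x. R (e 0) (e 1) x (v (\<lambda>i. e (Suc (Suc i))))"]
        dtm_shift[of "\<lambda>e. u (\<lambda>i. e (Suc i))"] dtm_shift assms) (simp add: eval_nat_numeral)
  define h :: "nat \<Rightarrow> nat" where "h n = (if n = 0 then 1 else if n = 1 then 0 else n)" for n
  have "inj h" by (auto simp: inj_def h_def)
  from dfn_rename[OF * this]
  have "dfn (\<lambda>e. R (e 1) (e 0) (u (\<lambda>i. e (Suc (Suc i)))) (v (\<lambda>i. e (Suc (Suc i)))))"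
    by (simp add: h_def)
  then have "dfn (\<lambda>e. R (e 0) (t (\<lambda>i. e (Suc i))) (u (\<lambda>i. e (Suc i))) (v (\<lambda>i. e (Suc i))))"
    by (intro dfn_subst[of "\<lambda>e. t (\<lambda>i. e (Suc i))"
          "\<lambda>e x. R (e 0) x (u (\<lambda>i. e (Suc i))) (v (\<lambda>i. e (Suc i)))"] dtm_shift assms) simp
  then show ?thesis by (intro dfn_subst[OF assms(2), of "\<lambda>e x. R x (t e) (u e) (v e)"])
qed

lemma dfn_eq: "dtm s \<Longrightarrow> dtm t \<Longrightarrow> dfn (\<lambda>e. s e = t e)"
  by (rule dfn_app2[of "(=)"]) (auto intro: dfn_FEq)

lemma dfn_less: "dtm s \<Longrightarrow> dtm t \<Longrightarrow> dfn (\<lambda>e. Less M (s e) (t e))"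
proof (rule dfn_app2[of "Less M"])
  show "dfn (\<lambda>e. Less M (e 0) (e 1))" unfolding dfn_def
    by (intro exI[of _ "FLess (TVar 0) (TVar 3)"] exI[of _ "\<lambda>_. Zero M"])
      (auto simp: env_def mix_def)
qed

lemma dfn_Add: "dtm s \<Longrightarrow> dtm t \<Longrightarrow> dtm u \<Longrightarrow> dfn (\<lambda>e. Add M (s e) (t e) (u e))"
proof (rule dfn_app3[of "Add M"])
  show "dfn (\<lambda>e. Add M (e 0) (e 1) (e 2))" unfolding dfn_def
    by (intro exI[of _ "FAdd (TVar 0) (TVar 3) (TVar 6)"] exI[of _ "\<lambda>_. Zero M"])
      (auto simp: env_def mix_def)
qed

lemma dfn_Mul: "dtm s \<Longrightarrow> dtm t \<Longrightarrow> dtm u \<Longrightarrow> dfn (\<lambda>e. Mul M (s e) (t e) (u e))"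
proof (rule dfn_app3[of "Mul M"])
  show "dfn (\<lambda>e. Mul M (e 0) (e 1) (e 2))" unfolding dfn_def
    by (intro exI[of _ "FMul (TVar 0) (TVar 3) (TVar 6)"] exI[of _ "\<lambda>_. Zero M"])
      (auto simp: env_def mix_def)
qed

lemma dfn_True: "dfn (\<lambda>e. True)"
  using dfn_eq[OF dtm_var[of 0] dtm_var[of 0]] by simp

lemma dfn_False: "dfn (\<lambda>e. False)"
  using dfn_not[OF dfn_True] by simp

lemmas dfn_intros = dfn_True dfn_False dfn_not dfn_conj dfn_disj dfn_imp dfn_iff dfn_all dfn_ex
  dfn_eq dfn_less dfn_Add dfn_Mul dtm_var

text \<open>
  A function symbol becomes available as a term as soon as its graph is definable on variables.
\<close>

lemma dtmI:
  assumes "\<And>e. env e \<Longrightarrow> t e \<in> D" "dfn (\<lambda>e. t (\<lambda>i. e (Suc i)) = e 0)" shows "dtm t"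
  using assms by (simp add: dtm_def)

lemma dtm_app1:
  assumes "\<And>x. x \<in> D \<Longrightarrow> F x \<in> D" "dfn (\<lambda>e. F (e 0) = e 1)" "dtm s"
  shows "dtm (\<lambda>e. F (s e))"
  by (rule dtmI) (auto intro!: assms(1) dtm_in[OF assms(3)]
      dfn_app2[of "\<lambda>x y. F x = y", OF assms(2)] dtm_shift[OF assms(3)] dtm_var)

lemma dtm_app2:
  assumes "\<And>x y. x \<in> D \<Longrightarrow> y \<in> D \<Longrightarrow> F x y \<in> D" "dfn (\<lambda>e. F (e 0) (e 1) = e 2)" "dtm s" "dtm t"
  shows "dtm (\<lambda>e. F (s e) (t e))"
  by (rule dtmI) (auto intro!: assms(1) dtm_in[OF assms(3)] dtm_in[OF assms(4)]
      dfn_app3[of "\<lambda>x y z. F x y = z", OF assms(2)] dtm_shift[OF assms(3)] dtm_shift[OF assms(4)]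
      dtm_var)

lemma dtm_if:
  assumes "dfn P" "dtm s" "dtm t" shows "dtm (\<lambda>e. if P e then s e else t e)"
proof (rule dtmI)
  have "dfn (\<lambda>e. P (\<lambda>i. e (Suc i)))" by (rule dfn_rename[OF assms(1)]) simp
  then have "dfn (\<lambda>e. P (\<lambda>i. e (Suc i)) \<and> s (\<lambda>i. e (Suc i)) = e 0
      \<or> \<not> P (\<lambda>i. e (Suc i)) \<and> t (\<lambda>i. e (Suc i)) = e 0)"
    using assms by (intro dfn_disj dfn_conj dfn_not) (auto simp: dtm_def)
  then show "dfn (\<lambda>e. (if P (\<lambda>i. e (Suc i)) then s (\<lambda>i. e (Suc i)) else t (\<lambda>i. e (Suc i))) = e 0)"
    by (rule dfn_cong[THEN iffD1, rotated]) auto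
qed (auto intro: assms dtm_in)

lemma definable_dfn:
  assumes "dfn P"
  shows "definable M k {xs \<in> tuples M k. P (\<lambda>i. if i < k then xs ! i else Zero M)}"
proof -
  obtain p c where p: "env c" "\<And>e j. env e \<Longrightarrow> env j \<Longrightarrow> P e = sat M (mix e c j) p"
    using assms(1) unfolding dfn_def by blast
  define r where "r n = (if n mod 3 = 0 \<and> n div 3 < k then n div 3 else n + k)" for n :: nat
  have "inj r"
  proof (rule injI)
    fix x y assume "r x = r y"
    then have "x = y \<or> x mod 3 = 0 \<and> y mod 3 = 0 \<and> x div 3 = y div 3"
      unfolding r_def by (simp split: if_splits)
    then show "x = y" by (metis div_mult_mod_eq)
  qed
  define e0 where "e0 n = mix (\<lambda>_. Zero M) c (\<lambda>_. Zero M) (n - k)" for n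
  have "env (mix (\<lambda>_. Zero M) c (\<lambda>_. Zero M))" by (intro env_mix p(1)) (auto simp: env_def)
  then have "env e0" unfolding e0_def[abs_def] by (rule env_comp)
  have eq: "P (\<lambda>i. if i < k then xs ! i else Zero M) =
      sat M (\<lambda>i. if i < k then xs ! i else e0 i) (rename_form r p)" if "xs \<in> tuples M k" for xs
  proof -
    have e: "env (\<lambda>i. if i < k then xs ! i else Zero M)"
      using that by (auto simp: env_def tuples_def)
    have "(\<lambda>n. if r n < k then xs ! r n else e0 (r n))
        = mix (\<lambda>i. if i < k then xs ! i else Zero M) c (\<lambda>_. Zero M)"
    proof
      fix n
      show "(if r n < k then xs ! r n else e0 (r n))
          = mix (\<lambda>i. if i < k then xs ! i else Zero M) c (\<lambda>_. Zero M) n"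
        by (cases "n mod 3 = 0 \<and> n div 3 < k") (simp_all add: r_def e0_def mix_def)
    qed
    then show ?thesis
      using p(2)[OF e, of "\<lambda>_. Zero M"] by (simp add: sat_rename[OF \<open>inj r\<close>] env_def)
  qed
  show ?thesis unfolding definable_def
    using \<open>env e0\<close> eq by (intro exI[of _ "rename_form r p"] exI[of _ e0]) (auto simp: env_def)
qed

subsection \<open>Pairs as elements\<close>

abbreviation G where "G \<equiv> tuples M 2"

lemma G_iff: "x \<in> G \<longleftrightarrow> (\<exists>a\<in>D. \<exists>b\<in>D. x = [a, b])"
  by (auto simp: tuples_def length_Suc_conv numeral_2_eq_2)

lemma pair_in_G [simp]: "[a, b] \<in> G \<longleftrightarrow> a \<in> D \<and> b \<in> D"
  by (auto simp: G_iff)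

lemma G_cases: assumes "x \<in> G" obtains a b where "a \<in> D" "b \<in> D" "x = [a, b]"
  using assms by (auto simp: G_iff)

lemma hd_in [simp]: "x \<in> G \<Longrightarrow> hd x \<in> D" and last_in [simp]: "x \<in> G \<Longrightarrow> last x \<in> D"
  by (auto simp: G_iff)

text \<open>
  Terms whose values are pairs.  Pairs are lists of length two with \<open>hd\<close> and \<open>last\<close> as
  projections, since these are the elements of the structures to be interpreted.
\<close>

definition dtm2 :: "((nat \<Rightarrow> 'a) \<Rightarrow> 'a list) \<Rightarrow> bool" where
  "dtm2 t \<longleftrightarrow> (\<forall>e. env e \<longrightarrow> t e \<in> G) \<and> dtm (\<lambda>e. hd (t e)) \<and> dtm (\<lambda>e. last (t e))"

lemma dtm2_in: "dtm2 t \<Longrightarrow> env e \<Longrightarrow> t e \<in> G" by (simp add: dtm2_def)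
lemma dtm_hd: "dtm2 t \<Longrightarrow> dtm (\<lambda>e. hd (t e))" by (simp add: dtm2_def)
lemma dtm_last: "dtm2 t \<Longrightarrow> dtm (\<lambda>e. last (t e))" by (simp add: dtm2_def)

lemma dtm2_pair: "dtm a \<Longrightarrow> dtm b \<Longrightarrow> dtm2 (\<lambda>e. [a e, b e])"
  by (auto simp: dtm2_def dtm_in)

lemma dtm2_const: "x \<in> G \<Longrightarrow> dtm2 (\<lambda>e. x)"
  by (auto simp: dtm2_def intro: dtm_const)

lemma dfn_eq2: assumes "dtm2 s" "dtm2 t" shows "dfn (\<lambda>e. s e = t e)"
proof -
  have "dfn (\<lambda>e. hd (s e) = hd (t e) \<and> last (s e) = last (t e))"
    by (intro dfn_intros dtm_hd dtm_last assms)
  then show ?thesis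
    by (rule dfn_cong[THEN iffD1, rotated])
      (metis G_cases assms dtm2_in last.simps list.sel(1) list.distinct(1))
qed

lemma dtm2_if: "dfn P \<Longrightarrow> dtm2 s \<Longrightarrow> dtm2 t \<Longrightarrow> dtm2 (\<lambda>e. if P e then s e else t e)"
  by (auto simp: dtm2_def if_distrib[of hd] if_distrib[of last] intro: dtm_if)

lemma dfn_all2:
  assumes "dfn (\<lambda>e. Q (\<lambda>i. e (Suc (Suc i))) [e 1, e 0])" shows "dfn (\<lambda>e. \<forall>x\<in>G. Q e x)"
proof -
  have "dfn (\<lambda>e. \<forall>a\<in>D. \<forall>b\<in>D. Q e [a, b])" using assms by (intro dfn_all) simp
  then show ?thesis by (rule dfn_cong[THEN iffD1, rotated]) (auto simp: G_iff)
qed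

lemma dfn_ex2:
  assumes "dfn (\<lambda>e. Q (\<lambda>i. e (Suc (Suc i))) [e 1, e 0])" shows "dfn (\<lambda>e. \<exists>x\<in>G. Q e x)"
proof -
  have "dfn (\<lambda>e. \<exists>a\<in>D. \<exists>b\<in>D. Q e [a, b])" using assms by (intro dfn_ex) simp
  then show ?thesis by (rule dfn_cong[THEN iffD1, rotated]) (metis G_cases pair_in_G)
qed

lemma dtm2_shift: "dtm2 t \<Longrightarrow> dtm2 (\<lambda>e. t (\<lambda>i. e (Suc i)))"
  using dtm_shift[of "\<lambda>e. hd (t e)"] dtm_shift[of "\<lambda>e. last (t e)"]
  by (auto simp: dtm2_def env_Suc)

lemma pair_eta: "x \<in> G \<Longrightarrow> [hd x, last x] = x"
  by (auto simp: G_iff)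

lemma dfn_app_MMG:
  assumes "dfn (\<lambda>e. R (e 0) (e 1) [e 2, e 3])" "dtm r" "dtm s" "dtm2 t"
  shows "dfn (\<lambda>e. R (r e) (s e) (t e))"
proof -
  have "dfn (\<lambda>e. R (r e) (s e) [hd (t e), last (t e)])"
    by (rule dfn_app4[of "\<lambda>x y z w. R x y [z, w]", OF assms(1,2,3)])
      (intro dtm_hd dtm_last assms)+
  then show ?thesis
    by (rule dfn_cong[THEN iffD1, rotated]) (simp add: pair_eta[OF dtm2_in[OF assms(4)]])
qed

lemma dtm2_app1:
  assumes "\<And>x. x \<in> D \<Longrightarrow> F x \<in> G" "\<And>s t. dtm s \<Longrightarrow> dtm2 t \<Longrightarrow> dfn (\<lambda>e. F (s e) = t e)" "dtm s"
  shows "dtm2 (\<lambda>e. F (s e))"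
  unfolding dtm2_def
proof (intro conjI allI impI)
  have "dfn (\<lambda>e. \<exists>b\<in>D. F (e 0) = [e 1, b])" by (intro dfn_ex assms(2) dtm2_pair dtm_var)
  then have "dfn (\<lambda>e. hd (F (e 0)) = e 1)"
    by (rule dfn_cong[THEN iffD1, rotated]) (metis assms(1) G_cases list.sel(1) env_in)
  then show "dtm (\<lambda>e. hd (F (s e)))" by (intro dtm_app1[OF _ _ assms(3)]) (auto intro: hd_in last_in assms(1) simp del: hd_in last_in)
  have "dfn (\<lambda>e. \<exists>b\<in>D. F (e 0) = [b, e 1])" by (intro dfn_ex assms(2) dtm2_pair dtm_var)
  then have "dfn (\<lambda>e. last (F (e 0)) = e 1)"
    by (rule dfn_cong[THEN iffD1, rotated])
      (metis assms(1) G_cases last.simps list.distinct(1) env_in)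
  then show "dtm (\<lambda>e. last (F (s e)))" by (intro dtm_app1[OF _ _ assms(3)]) (auto intro: hd_in last_in assms(1) simp del: hd_in last_in)
qed (use assms dtm_in in auto)

lemma dtm2_app2:
  assumes "\<And>x y. x \<in> D \<Longrightarrow> y \<in> D \<Longrightarrow> F x y \<in> G"
    "\<And>r s t. dtm r \<Longrightarrow> dtm s \<Longrightarrow> dtm2 t \<Longrightarrow> dfn (\<lambda>e. F (r e) (s e) = t e)" "dtm r" "dtm s"
  shows "dtm2 (\<lambda>e. F (r e) (s e))"
  unfolding dtm2_def
proof (intro conjI allI impI)
  have "dfn (\<lambda>e. \<exists>b\<in>D. F (e 0) (e 1) = [e 2, b])" by (intro dfn_ex assms(2) dtm2_pair dtm_var)
  then have "dfn (\<lambda>e. hd (F (e 0) (e 1)) = e 2)"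
    by (rule dfn_cong[THEN iffD1, rotated]) (metis assms(1) G_cases list.sel(1) env_in)
  then show "dtm (\<lambda>e. hd (F (r e) (s e)))"
    by (intro dtm_app2[OF _ _ assms(3,4)]) (auto intro: hd_in last_in assms(1) simp del: hd_in last_in)
  have "dfn (\<lambda>e. \<exists>b\<in>D. F (e 0) (e 1) = [b, e 2])" by (intro dfn_ex assms(2) dtm2_pair dtm_var)
  then have "dfn (\<lambda>e. last (F (e 0) (e 1)) = e 2)"
    by (rule dfn_cong[THEN iffD1, rotated])
      (metis assms(1) G_cases last.simps list.distinct(1) env_in)
  then show "dtm (\<lambda>e. last (F (r e) (s e)))"
    by (intro dtm_app2[OF _ _ assms(3,4)]) (auto intro: hd_in last_in assms(1) simp del: hd_in last_in)
qed (use assms dtm_in in auto)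

lemmas dfn2_intros = dfn_intros dfn_eq2 dtm_hd dtm_last dtm2_pair dfn_all2 dfn_ex2

subsection \<open>Definable sets of tuples and interpretations\<close>

text \<open>
  The environment \<open>e\<close> is arbitrary beyond position \<open>k\<close>, so that \<open>e i\<close> simply rewrites to
  \<open>xs ! i\<close>.
\<close>

lemma definableI:
  assumes "dfn P" "\<And>xs. xs \<in> X \<Longrightarrow> xs \<in> tuples M k"
    "\<And>xs e. xs \<in> tuples M k \<Longrightarrow> (\<And>i. i < k \<Longrightarrow> e i = xs ! i) \<Longrightarrow> xs \<in> X \<longleftrightarrow> P e"
  shows "definable M k X"
proof -
  have "xs \<in> X \<longleftrightarrow> P (\<lambda>i. if i < k then xs ! i else Zero M)" if "xs \<in> tuples M k" for xs
    by (rule assms(3)[OF that]) simp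
  then have "X = {xs \<in> tuples M k. P (\<lambda>i. if i < k then xs ! i else Zero M)}"
    using assms(2) by auto
  then show ?thesis using definable_dfn[OF assms(1)] by simp
qed

lemma tuples_1: "xs \<in> tuples M 1 \<longleftrightarrow> (\<exists>a\<in>D. xs = [a])"
  by (auto simp: tuples_def length_Suc_conv)
lemma tuples_3: "xs \<in> tuples M 3 \<longleftrightarrow> (\<exists>a\<in>D. \<exists>b\<in>D. \<exists>c\<in>D. xs = [a, b, c])"
  by (auto simp: tuples_def length_Suc_conv eval_nat_numeral)
lemma tuples_4: "xs \<in> tuples M 4 \<longleftrightarrow> (\<exists>a\<in>D. \<exists>b\<in>D. \<exists>c\<in>D. \<exists>d\<in>D. xs = [a, b, c, d])"
  by (auto simp: tuples_def length_Suc_conv eval_nat_numeral)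
lemma tuples_6: "xs \<in> tuples M 6 \<longleftrightarrow>
    (\<exists>a\<in>D. \<exists>b\<in>D. \<exists>c\<in>D. \<exists>d\<in>D. \<exists>f\<in>D. \<exists>g\<in>D. xs = [a, b, c, d, f, g])"
  by (auto simp: tuples_def length_Suc_conv eval_nat_numeral)

lemmas tuples_Suc_0 = tuples_1[unfolded One_nat_def]
lemma tuples_Suc_3: "xs \<in> tuples M (Suc (Suc (Suc 0))) \<longleftrightarrow> (\<exists>a\<in>D. \<exists>b\<in>D. \<exists>c\<in>D. xs = [a, b, c])"
  using tuples_3 by (simp add: eval_nat_numeral)

lemma definable_singleton_1: "a \<in> D \<Longrightarrow> definable M 1 {[a]}"
  by (rule definableI[where P = "\<lambda>e. e 0 = a"])
    (auto simp: tuples_Suc_0 intro!: dfn_eq dtm_var dtm_const)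

lemma definable_singleton_2: "a \<in> D \<Longrightarrow> b \<in> D \<Longrightarrow> definable M 2 {[a, b]}"
  by (rule definableI[where P = "\<lambda>e. e 0 = a \<and> e 1 = b"])
    (auto simp: G_iff intro!: dfn_conj dfn_eq dtm_var dtm_const)

end

text \<open>
  An injection with definable image and relations is an interpretation whose equivalence relation
  is the identity.  Classes are singletons, and \<open>eq\<close> says that this identity is definable.
\<close>

lemma interpretation_inI:
  fixes g :: "'b \<Rightarrow> 'a list"
  assumes B: "is_fa_struct B" and inj: "inj_on g (Dom B)"
    and dom: "definable A k (g ` Dom B)"
    and eq: "definable A (2 * k) {g x @ g x | x. x \<in> Dom B}"
    and constants: "definable A k {g (Zero B)}" "definable A k {g (One B)}" "definable A k {g (Top B)}"
    and less: "definable A (2 * k) {g x @ g y | x y. x \<in> Dom B \<and> y \<in> Dom B \<and> Less B x y}"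
    and add: "definable A (3 * k)
      {g x @ g y @ g z | x y z. x \<in> Dom B \<and> y \<in> Dom B \<and> z \<in> Dom B \<and> Add B x y z}"
    and mul: "definable A (3 * k)
      {g x @ g y @ g z | x y z. x \<in> Dom B \<and> y \<in> Dom B \<and> z \<in> Dom B \<and> Mul B x y z}"
  shows "interpretation_in A B k (\<lambda>b. {g b})"
proof -
  define h where "h X = the_inv_into (Dom B) g (the_elem X)" for X
  have h [simp]: "h {g x} = x" if "x \<in> Dom B" for x
    using the_inv_into_f_f[OF inj that] by (simp add: h_def)
  define C where "C = \<lparr>Dom = (\<lambda>b. {g b}) ` Dom B, Zero = {g (Zero B)}, One = {g (One B)},
    Top = {g (Top B)}, Less = (\<lambda>X Y. Less B (h X) (h Y)), Add = (\<lambda>X Y V. Add B (h X) (h Y) (h V)),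
    Mul = (\<lambda>X Y V. Mul B (h X) (h Y) (h V))\<rparr>"
  let ?D = "g ` Dom B" and ?E = "Id_on (g ` Dom B)"
  have cl: "?E `` {g x} = {g x}" if "x \<in> Dom B" for x using that by auto
  have c: "Zero B \<in> Dom B" "One B \<in> Dom B" "Top B \<in> Dom B"
    using B by (simp_all add: is_fa_struct_def)
  have a: "u = v" if "x \<in> Dom B" "y \<in> Dom B" "u \<in> Dom B" "v \<in> Dom B" "Add B x y u" "Add B x y v"
    for x y u v using B that unfolding is_fa_struct_def by blast
  have m: "u = v" if "x \<in> Dom B" "y \<in> Dom B" "u \<in> Dom B" "v \<in> Dom B" "Mul B x y u" "Mul B x y v"
    for x y u v using B that unfolding is_fa_struct_def by blast
  have C: "is_fa_struct C"
    using c by (auto simp: is_fa_struct_def C_def dest: a m)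
  have "equiv ?D ?E" by (auto simp: equiv_def refl_on_def sym_def trans_def)
  moreover have "{xs @ ys |xs ys. (xs, ys) \<in> ?E} = {g x @ g x | x. x \<in> Dom B}" by auto
  moreover have "Dom C = ?D // ?E" by (auto simp: C_def quotient_def)
  moreover have "{xs @ ys | xs ys. xs \<in> ?D \<and> ys \<in> ?D \<and> Less C (?E `` {xs}) (?E `` {ys})}
      = {g x @ g y | x y. x \<in> Dom B \<and> y \<in> Dom B \<and> Less B x y}" (is "?l = ?r")
  proof (intro equalityI subsetI)
    fix v assume "v \<in> ?l"
    then obtain xs ys where v: "v = xs @ ys" "xs \<in> ?D" "ys \<in> ?D" "Less C (?E `` {xs}) (?E `` {ys})"
      by blast
    obtain x y where xy: "x \<in> Dom B" "y \<in> Dom B" "xs = g x" "ys = g y" using v(2,3) by blast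
    then have "Less B x y" using v(4) by (simp add: cl C_def del: Image_Id_on)
    then show "v \<in> ?r"
      by - (rule CollectI, rule exI[of _ x], rule exI[of _ y], use v xy in simp)
  next
    fix v assume "v \<in> ?r"
    then obtain x y where v: "v = g x @ g y" "x \<in> Dom B" "y \<in> Dom B" "Less B x y" by blast
    then have "Less C (?E `` {g x}) (?E `` {g y})" by (simp add: cl C_def del: Image_Id_on)
    then show "v \<in> ?l"
      by - (rule CollectI, rule exI[of _ "g x"], rule exI[of _ "g y"],
          intro conjI v(1) imageI v(2,3))
  qed
  moreover have "{xs @ ys @ zs | xs ys zs. xs \<in> ?D \<and> ys \<in> ?D \<and> zs \<in> ?D \<and>
        R (h (?E `` {xs})) (h (?E `` {ys})) (h (?E `` {zs}))}
      = {g x @ g y @ g z | x y z. x \<in> Dom B \<and> y \<in> Dom B \<and> z \<in> Dom B \<and> R x y z}"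
    (is "?l = ?r") for R
  proof (intro equalityI subsetI)
    fix v assume "v \<in> ?l"
    then obtain xs ys zs where v: "v = xs @ ys @ zs" "xs \<in> ?D" "ys \<in> ?D" "zs \<in> ?D"
      "R (h (?E `` {xs})) (h (?E `` {ys})) (h (?E `` {zs}))" by blast
    obtain x y z where x: "x \<in> Dom B" "y \<in> Dom B" "z \<in> Dom B" "xs = g x" "ys = g y" "zs = g z"
      using v(2-4) by blast
    then have "R x y z" using v(5) by (simp only: cl h)
    then show "v \<in> ?r"
      by - (rule CollectI, rule exI[of _ x], rule exI[of _ y], rule exI[of _ z], use v x in simp)
  next
    fix v assume "v \<in> ?r"
    then obtain x y z where v: "v = g x @ g y @ g z" "x \<in> Dom B" "y \<in> Dom B" "z \<in> Dom B"
      "R x y z" by blast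
    then have "R (h (?E `` {g x})) (h (?E `` {g y})) (h (?E `` {g z}))" by (simp only: cl h)
    then show "v \<in> ?l"
      by - (rule CollectI, rule exI[of _ "g x"], rule exI[of _ "g y"], rule exI[of _ "g z"],
          intro conjI v(1) imageI v(2-4))
  qed
  ultimately have "definable_structure A k ?D ?E C"
    unfolding definable_structure_def using C dom eq constants less add mul by (simp add: C_def)
  moreover have "fa_iso (\<lambda>b. {g b}) B C"
    using B inj by (auto simp: fa_iso_def C_def is_fa_struct_def bij_betw_def inj_on_def)
  ultimately show ?thesis unfolding interpretation_in_def by blast
qed

section \<open>Finite arithmetic\<close>

locale fa = struct +
  assumes FA: "FA_model M" and Z_lt_N: "Less M (Zero M) (Top M)"
begin

abbreviation Z where "Z \<equiv> Zero M"
abbreviation N where "N \<equiv> Top M"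
abbreviation lt where "lt \<equiv> Less M"
abbreviation le where "le x y \<equiv> x = y \<or> Less M x y"

lemma order: "fa_order M" and successor: "fa_successor M" and arith: "fa_arithmetic M"
  and induction: "fa_induction M"
  using FA by (auto simp: FA_model_def)

lemma lt_irrefl: "x \<in> D \<Longrightarrow> \<not> lt x x"
  using order by (simp add: fa_order_def)
lemma lt_trans: "x \<in> D \<Longrightarrow> y \<in> D \<Longrightarrow> z \<in> D \<Longrightarrow> lt x y \<Longrightarrow> lt y z \<Longrightarrow> lt x z"
  using order unfolding fa_order_def by meson
lemma lt_linear: "x \<in> D \<Longrightarrow> y \<in> D \<Longrightarrow> lt x y \<or> x = y \<or> lt y x"
  using order by (simp add: fa_order_def)
lemma Z_le: "x \<in> D \<Longrightarrow> x \<noteq> Z \<Longrightarrow> lt Z x"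
  using order by (auto simp: fa_order_def)
lemma le_N: "x \<in> D \<Longrightarrow> x \<noteq> N \<Longrightarrow> lt x N"
  using order by (auto simp: fa_order_def)
lemma lt_asym: "x \<in> D \<Longrightarrow> y \<in> D \<Longrightarrow> lt x y \<Longrightarrow> \<not> lt y x"
  using lt_trans lt_irrefl by blast
lemma not_lt_Z: "x \<in> D \<Longrightarrow> \<not> lt x Z"
  using Z_le lt_asym lt_irrefl consts_in by blast
lemma not_N_lt: "x \<in> D \<Longrightarrow> \<not> lt N x"
  using le_N lt_asym lt_irrefl consts_in by blast
lemma Z_neq_N [simp]: "Z \<noteq> N" "N \<noteq> Z"
  using Z_lt_N lt_irrefl consts_in by metis+
lemma lt_neq_N: "x \<in> D \<Longrightarrow> y \<in> D \<Longrightarrow> lt x y \<Longrightarrow> x \<noteq> N"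
  using not_N_lt by blast

lemma Add_fun: "Add M x y u \<Longrightarrow> Add M x y v \<Longrightarrow> x \<in> D \<Longrightarrow> y \<in> D \<Longrightarrow> u \<in> D \<Longrightarrow> v \<in> D \<Longrightarrow> u = v"
  using is_struct unfolding is_fa_struct_def by blast
lemma Mul_fun: "Mul M x y u \<Longrightarrow> Mul M x y v \<Longrightarrow> x \<in> D \<Longrightarrow> y \<in> D \<Longrightarrow> u \<in> D \<Longrightarrow> v \<in> D \<Longrightarrow> u = v"
  using is_struct unfolding is_fa_struct_def by blast

text \<open>
  The successor is made total by letting \<open>N\<close> wrap around to \<open>0\<close>.
\<close>

definition sc :: "'a \<Rightarrow> 'a" where
  "sc x = (if x = N then Z else (THE y. y \<in> D \<and> Add M x (One M) y))"

lemma sc_N [simp]: "sc N = Z" by (simp add: sc_def)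

lemma sc_props:
  assumes "x \<in> D" "x \<noteq> N" shows "sc x \<in> D" "Add M x (One M) (sc x)" "imm_succ M x (sc x)"
proof -
  obtain y where y: "y \<in> D" "Add M x (One M) y" "imm_succ M x y"
    using successor le_N[OF assms] assms(1) unfolding fa_successor_def by blast
  have "(THE y. y \<in> D \<and> Add M x (One M) y) = y"
    using y Add_fun assms by (intro the_equality) auto
  then show "sc x \<in> D" "Add M x (One M) (sc x)" "imm_succ M x (sc x)"
    using y assms by (auto simp: sc_def)
qed

lemma sc_in [simp]: "x \<in> D \<Longrightarrow> sc x \<in> D"
  using sc_props by (cases "x = N") auto

lemma Add_One_iff: "x \<in> D \<Longrightarrow> y \<in> D \<Longrightarrow> Add M x (One M) y \<longleftrightarrow> x \<noteq> N \<and> y = sc x"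
proof -
  assume a: "x \<in> D" "y \<in> D"
  have "\<not> Add M N (One M) y" using successor a unfolding fa_successor_def by blast
  then show ?thesis using a sc_props[of x] Add_fun by (metis consts_in(2))
qed

lemma lt_sc_self: "x \<in> D \<Longrightarrow> x \<noteq> N \<Longrightarrow> lt x (sc x)"
  using sc_props(3) by (auto simp: imm_succ_def)

lemma lt_sc_iff: "x \<in> D \<Longrightarrow> y \<in> D \<Longrightarrow> x \<noteq> N \<Longrightarrow> lt y (sc x) \<longleftrightarrow> le y x"
  using sc_props[of x] lt_linear lt_trans lt_sc_self unfolding imm_succ_def by blast

lemma sc_nz: "x \<in> D \<Longrightarrow> x \<noteq> N \<Longrightarrow> sc x \<noteq> Z"
  using lt_sc_self not_lt_Z by metis

lemma sc_inj:
  assumes "x \<in> D" "y \<in> D" "sc x = sc y" shows "x = y"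
proof (cases "x = N \<or> y = N")
  case True
  then show ?thesis using assms sc_nz sc_N by metis
next
  case False
  then have "le x y" "le y x" using assms lt_sc_iff lt_sc_self by metis+
  then show ?thesis using lt_asym assms by blast
qed

lemma sc_eq_iff [simp]: "x \<in> D \<Longrightarrow> y \<in> D \<Longrightarrow> sc x = sc y \<longleftrightarrow> x = y"
  using sc_inj by auto

lemma sc_surj:
  assumes "y \<in> D" "y \<noteq> Z" obtains x where "x \<in> D" "x \<noteq> N" "y = sc x"
proof -
  obtain x where x: "x \<in> D" "imm_succ M x y" using order assms unfolding fa_order_def by metis
  then have n: "x \<noteq> N" using not_N_lt assms unfolding imm_succ_def by blast
  have "y = sc x"
    using lt_linear[of y "sc x"] x assms n sc_props[OF x(1) n] unfolding imm_succ_def by blast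
  then show ?thesis using that x n by blast
qed

lemma sc_lt_iff: "x \<in> D \<Longrightarrow> y \<in> D \<Longrightarrow> x \<noteq> N \<Longrightarrow> y \<noteq> N \<Longrightarrow> lt (sc x) (sc y) \<longleftrightarrow> lt x y"
  using lt_sc_iff[of y "sc x"] lt_sc_iff[of x y] lt_linear lt_asym lt_trans lt_sc_self lt_irrefl sc_in
  by (metis (full_types))

lemma le_sc: "x \<in> D \<Longrightarrow> y \<in> D \<Longrightarrow> lt x y \<Longrightarrow> le (sc x) y"
  using lt_sc_iff[of x y] lt_linear[of y "sc x"] lt_neq_N lt_asym lt_irrefl sc_in by metis

text \<open>
  The induction scheme in semantic form.  Parameters are hidden in the predicate, so that it can
  be applied to statements about fixed elements of \<open>M\<close>.
\<close>

lemma induct_D: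
  assumes P: "dfn (\<lambda>e. P (e 0))" and base: "P Z"
    and step: "\<And>n. n \<in> D \<Longrightarrow> n \<noteq> N \<Longrightarrow> P n \<Longrightarrow> P (sc n)" and x: "x \<in> D"
  shows "P x"
proof -
  obtain p c where p: "env c" "\<And>e j. env e \<Longrightarrow> env j \<Longrightarrow> P (e 0) = sat M (mix e c j) p"
    using P unfolding dfn_def by blast
  let ?e = "mix (\<lambda>_. Z) c (\<lambda>_. Z)"
  have e: "env ?e" using p by (intro env_mix) (auto simp: env_def)
  have eq: "P a = sat M (?e(0 := a)) p" if "a \<in> D" for a
  proof -
    have "(mix ((\<lambda>_. Z)(0 := a)) c (\<lambda>_. Z)) = ?e(0 := a)"
      by (auto simp: mix_def fun_eq_iff elim: nat_mod3_cases)
    then show ?thesis using p(2)[of "(\<lambda>_. Z)(0 := a)" "\<lambda>_. Z"] that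
      by (auto simp: env_def image_subset_iff)
  qed
  show ?thesis
    using induction[unfolded fa_induction_def, rule_format, of ?e 0 p x] e base step x eq
      Add_One_iff not_N_lt
    unfolding env_def by (metis consts_in(1) consts_in(3) sc_in)
qed

lemma Add_Z: "x \<in> D \<Longrightarrow> z \<in> D \<Longrightarrow> Add M x Z z \<longleftrightarrow> z = x"
  using arith Add_fun unfolding fa_arithmetic_def by (metis consts_in(1))

lemma Add_sc': 
  assumes "n \<in> D" "m \<in> D" "z \<in> D" "m \<noteq> N"
  shows "Add M n (sc m) z \<longleftrightarrow> (\<exists>t\<in>D. t \<noteq> N \<and> Add M n m t \<and> z = sc t)"
proof -
  have "(\<exists>s\<in>D. Add M m (One M) s \<and> Add M n s z) \<longleftrightarrow> (\<exists>t\<in>D. Add M n m t \<and> Add M t (One M) z)"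
    using arith assms le_N[of m] unfolding fa_arithmetic_def by blast
  then show ?thesis using assms Add_One_iff by (metis sc_in)
qed

lemma Mul_Z: "x \<in> D \<Longrightarrow> z \<in> D \<Longrightarrow> Mul M x Z z \<longleftrightarrow> z = Z"
  using arith Mul_fun unfolding fa_arithmetic_def by (metis consts_in(1))

lemma Mul_sc: 
  assumes "n \<in> D" "m \<in> D" "z \<in> D" "m \<noteq> N"
  shows "Mul M n (sc m) z \<longleftrightarrow> (\<exists>t\<in>D. Mul M n m t \<and> Add M t n z)"
proof -
  have "(\<exists>s\<in>D. Add M m (One M) s \<and> Mul M n s z) \<longleftrightarrow> (\<exists>t\<in>D. Mul M n m t \<and> Add M t n z)"
    using arith assms le_N[of m] unfolding fa_arithmetic_def by blast
  then show ?thesis using assms Add_One_iff by (metis sc_in)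
qed

lemma Add_sc_Z: "n \<in> D \<Longrightarrow> m \<in> D \<Longrightarrow> m \<noteq> N \<Longrightarrow> \<not> Add M n (sc m) Z"
  using Add_sc' sc_nz by (metis consts_in(1))

lemma Add_sc_sc:
  assumes "n \<in> D" "m \<in> D" "t \<in> D" "m \<noteq> N" "t \<noteq> N"
  shows "Add M n (sc m) (sc t) \<longleftrightarrow> Add M n m t"
  using assms Add_sc'[of n m "sc t"] by auto

lemma dtm_const' : "dtm (\<lambda>e. Z)" "dtm (\<lambda>e. N)" "dtm (\<lambda>e. One M)"
  by (auto intro: dtm_const)

lemma dtm_sc: assumes "dtm s" shows "dtm (\<lambda>e. sc (s e))"
proof (rule dtm_app1[OF _ _ assms])
  have "dfn (\<lambda>e. e 0 = N \<and> e 1 = Z \<or> e 0 \<noteq> N \<and> Add M (e 0) (One M) (e 1))"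
    by (intro dfn_intros dtm_const')
  then show "dfn (\<lambda>e. sc (e 0) = e 1)"
    by (rule dfn_cong[THEN iffD1, rotated]) (use Add_One_iff env_in in \<open>metis sc_N\<close>)
qed simp

lemma Z_Add: "k \<in> D \<Longrightarrow> Add M Z k k"
proof (rule induct_D[of "\<lambda>k. Add M Z k k"])
  show "dfn (\<lambda>e. Add M Z (e 0) (e 0))" by (intro dfn_intros dtm_const')
qed (simp_all add: Add_Z Add_sc_sc)

text \<open>
  The axioms do not identify the constant \<open>1\<close> with the successor of \<open>0\<close> directly.  But
  \<open>1 = k + 1\<close> for some \<open>k\<close>, and \<open>0 + (k + 1) = k + 1\<close> then yields \<open>0 + 1 = k + 1\<close>.
\<close>

lemma One_eq: "One M = sc Z"
proof -
  have "One M \<noteq> Z" using sc_props(2)[of Z] Add_Z[of Z "sc Z"] sc_nz[of Z] by auto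
  then obtain k where k: "k \<in> D" "k \<noteq> N" "One M = sc k" using sc_surj consts_in(2) by metis
  have "Add M Z (sc k) (sc Z)" using sc_props(2)[of Z] k by simp
  then show ?thesis using k Z_Add[of "sc k"] Add_fun by (metis consts_in(1) sc_in)
qed

lemma Add_le:
  assumes "p \<in> D" "x \<in> D" "y \<in> D" "Add M p x y"
  shows "p = Z \<and> x = y \<or> p \<noteq> Z \<and> lt x y"
proof -
  have "\<forall>y\<in>D. Add M p x y \<longrightarrow> p = Z \<and> x = y \<or> p \<noteq> Z \<and> lt x y" 
  proof (rule induct_D[of "\<lambda>x. \<forall>y\<in>D. Add M p x y \<longrightarrow> p = Z \<and> x = y \<or> p \<noteq> Z \<and> lt x y"])
    show "dfn (\<lambda>e. \<forall>y\<in>D. Add M p (e 0) y \<longrightarrow> p = Z \<and> e 0 = y \<or> p \<noteq> Z \<and> lt (e 0) y)"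
      by (intro dfn_intros dtm_const' dtm_const assms)
  next
    show "\<forall>y\<in>D. Add M p Z y \<longrightarrow> p = Z \<and> Z = y \<or> p \<noteq> Z \<and> lt Z y"
      using Add_Z Z_le assms by auto
  next
    fix n assume n: "n \<in> D" "n \<noteq> N" "\<forall>y\<in>D. Add M p n y \<longrightarrow> p = Z \<and> n = y \<or> p \<noteq> Z \<and> lt n y"
    then show "\<forall>y\<in>D. Add M p (sc n) y \<longrightarrow> p = Z \<and> sc n = y \<or> p \<noteq> Z \<and> lt (sc n) y"
      using Add_sc'[OF assms(1) n(1)] sc_lt_iff by blast
  qed (rule assms)
  then show ?thesis using assms by blast
qed

subsection \<open>Total addition modulo N+1\<close>

text \<open>
  If \<open>x + v = N\<close> and \<open>y = (v + 1) + z\<close>, then \<open>x + y = (N + 1) + z\<close>: the sum overflows and \<open>z\<close> is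
  its lower digit.
\<close>

definition wraps :: "'a \<Rightarrow> 'a \<Rightarrow> 'a \<Rightarrow> bool" where
  "wraps x y z \<longleftrightarrow> (\<exists>v\<in>D. v \<noteq> N \<and> Add M x v N \<and> Add M (sc v) z y)"

definition wsum :: "'a \<Rightarrow> 'a \<Rightarrow> 'a \<Rightarrow> bool" where
  "wsum x y z \<longleftrightarrow> Add M x y z \<or> wraps x y z"

lemma wsum_Z: "x \<in> D \<Longrightarrow> z \<in> D \<Longrightarrow> wsum x Z z \<longleftrightarrow> z = x"
  unfolding wsum_def wraps_def using Add_Z Add_le sc_nz not_lt_Z
  by (metis consts_in(1) sc_in)

lemma wraps_sc:
  assumes "x \<in> D" "y \<in> D" "z \<in> D" "y \<noteq> N"
  shows "wraps x (sc y) (sc z) \<longleftrightarrow> wraps x y z \<or> z = N \<and> Add M x y N"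
proof
  assume "wraps x (sc y) (sc z)"
  then obtain v where v: "v \<in> D" "v \<noteq> N" "Add M x v N" "Add M (sc v) (sc z) (sc y)"
    by (auto simp: wraps_def)
  show "wraps x y z \<or> z = N \<and> Add M x y N"
  proof (cases "z = N")
    case True
    then have "sc y = sc v" using v Add_Z[of "sc v" "sc y"] assms by simp
    then show ?thesis using v True assms by simp
  next
    case False
    then show ?thesis using v assms by (auto simp: Add_sc_sc wraps_def)
  qed
next
  assume "wraps x y z \<or> z = N \<and> Add M x y N"
  then show "wraps x (sc y) (sc z)"
  proof
    assume "wraps x y z"
    then obtain v where v: "v \<in> D" "v \<noteq> N" "Add M x v N" "Add M (sc v) z y"
      by (auto simp: wraps_def)
    have "z \<noteq> N" using Add_le[of "sc v" z y] v assms not_N_lt sc_nz by auto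
    then show ?thesis using v assms by (auto simp: Add_sc_sc wraps_def)
  next
    assume "z = N \<and> Add M x y N"
    then show ?thesis unfolding wraps_def using assms Add_Z[of "sc y" "sc y"] by auto
  qed
qed

lemma wsum_sc:
  assumes "x \<in> D" "y \<in> D" "z \<in> D" "y \<noteq> N"
  shows "wsum x (sc y) (sc z) \<longleftrightarrow> wsum x y z"
proof (cases "z = N")
  case True
  then show ?thesis using wraps_sc[OF assms] Add_sc_Z[of x y] assms by (auto simp: wsum_def)
next
  case False
  then show ?thesis using wraps_sc[OF assms] Add_sc_sc assms by (auto simp: wsum_def)
qed

lemma sc_surj': "y \<in> D \<Longrightarrow> \<exists>x\<in>D. y = sc x"
  using sc_surj sc_N consts_in(3) by metis

lemma dfn_wsum:
  assumes "dtm s" "dtm t" "dtm u" shows "dfn (\<lambda>e. wsum (s e) (t e) (u e))"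
  by (rule dfn_app3[of wsum, OF _ assms], unfold wsum_def wraps_def)
    (intro dfn_intros dtm_const' dtm_sc)

lemma wsum_ex1: assumes "x \<in> D" "y \<in> D" shows "\<exists>z\<in>D. \<forall>w\<in>D. wsum x y w = (w = z)"
proof (rule induct_D[of "\<lambda>y. \<exists>z\<in>D. \<forall>w\<in>D. wsum x y w = (w = z)"])
  show "dfn (\<lambda>e. \<exists>z\<in>D. \<forall>w\<in>D. wsum x (e 0) w = (w = z))"
    by (intro dfn_intros dfn_wsum dtm_const assms)
  show "\<exists>z\<in>D. \<forall>w\<in>D. wsum x Z w = (w = z)" using wsum_Z assms by blast
next
  fix n assume n: "n \<in> D" "n \<noteq> N" "\<exists>z\<in>D. \<forall>w\<in>D. wsum x n w = (w = z)"
  then obtain z where z: "z \<in> D" "\<And>w. w \<in> D \<Longrightarrow> wsum x n w = (w = z)" by blast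
  have "wsum x (sc n) w = (w = sc z)" if "w \<in> D" for w
    using sc_surj'[OF that] wsum_sc[OF assms(1) n(1) _ n(2)] z by auto
  then show "\<exists>z\<in>D. \<forall>w\<in>D. wsum x (sc n) w = (w = z)" using z sc_in by blast
qed (rule assms)

definition wadd :: "'a \<Rightarrow> 'a \<Rightarrow> 'a" where
  "wadd x y = (THE z. z \<in> D \<and> wsum x y z)"

lemma wadd_props:
  assumes "x \<in> D" "y \<in> D"
  shows "wadd x y \<in> D" "z \<in> D \<Longrightarrow> wsum x y z \<longleftrightarrow> wadd x y = z"
proof -
  obtain z0 where z: "z0 \<in> D" "\<And>w. w \<in> D \<Longrightarrow> wsum x y w = (w = z0)"
    using wsum_ex1[OF assms] by blast
  then have "wadd x y = z0" unfolding wadd_def by (intro the_equality) auto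
  then show "wadd x y \<in> D" "z \<in> D \<Longrightarrow> wsum x y z \<longleftrightarrow> wadd x y = z" using z by auto
qed

lemma wadd_in [simp]: "x \<in> D \<Longrightarrow> y \<in> D \<Longrightarrow> wadd x y \<in> D" by (rule wadd_props)

lemma wadd_Z [simp]: "x \<in> D \<Longrightarrow> wadd x Z = x"
  using wadd_props(2)[of x Z x] wsum_Z by simp

lemma wadd_sc: "x \<in> D \<Longrightarrow> y \<in> D \<Longrightarrow> y \<noteq> N \<Longrightarrow> wadd x (sc y) = sc (wadd x y)"
  using wadd_props(2)[of x "sc y" "sc (wadd x y)"] wadd_props(2)[of x y "wadd x y"] wsum_sc by simp

lemma dtm_wadd: assumes "dtm s" "dtm t" shows "dtm (\<lambda>e. wadd (s e) (t e))"
proof (rule dtm_app2[OF _ _ assms])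
  have "dfn (\<lambda>e. wsum (e 0) (e 1) (e 2))" by (intro dfn_wsum dtm_var)
  then show "dfn (\<lambda>e. wadd (e 0) (e 1) = e 2)"
    by (rule dfn_cong[THEN iffD1, rotated]) (simp add: wadd_props(2) env_in)
qed simp

text \<open>
  The carry of a digit addition.
\<close>

definition ov :: "'a \<Rightarrow> 'a \<Rightarrow> bool" where "ov x y \<longleftrightarrow> \<not> (\<exists>z\<in>D. Add M x y z)"

lemma dfn_ov:
  assumes "dtm s" "dtm t" shows "dfn (\<lambda>e. ov (s e) (t e))"
  by (rule dfn_app2[of ov, OF _ assms], unfold ov_def) (intro dfn_intros)

lemma Add_iff: "x \<in> D \<Longrightarrow> y \<in> D \<Longrightarrow> z \<in> D \<Longrightarrow> Add M x y z \<longleftrightarrow> wadd x y = z \<and> \<not> ov x y"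
  using wadd_props(2)[of x y] Add_fun unfolding wsum_def ov_def by blast

lemma ov_Z [simp]: "x \<in> D \<Longrightarrow> \<not> ov x Z"
  using Add_Z unfolding ov_def by blast

lemma Z_ov [simp]: "x \<in> D \<Longrightarrow> \<not> ov Z x"
  using Z_Add unfolding ov_def by blast

lemma Z_wadd [simp]: "x \<in> D \<Longrightarrow> wadd Z x = x"
  using Z_Add Add_iff by simp

lemma ov_sc:
  assumes "x \<in> D" "y \<in> D" "y \<noteq> N" shows "ov x (sc y) \<longleftrightarrow> ov x y \<or> wadd x y = N"
  using Add_sc'[OF assms(1,2) _ assms(3)] Add_iff[OF assms(1,2)] wadd_in[OF assms(1,2)] assms sc_in
  unfolding ov_def by (metis (full_types))

text \<open>
  The largest lower digit of an overflowing sum is \<open>N - 1\<close>, which is why a carry never meets a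
  further carry.
\<close>

lemma ov_neq_N:
  assumes "x \<in> D" "y \<in> D" "ov x y" shows "wadd x y \<noteq> N"
proof
  assume N: "wadd x y = N"
  then have "wraps x y N" using wadd_props(2)[of x y N] assms unfolding wsum_def ov_def by auto
  then obtain v where v: "v \<in> D" "v \<noteq> N" "Add M (sc v) N y" by (auto simp: wraps_def)
  then show False using Add_le[of "sc v" N y] assms not_N_lt sc_nz by auto
qed

lemma ov_N: "b \<in> D \<Longrightarrow> ov b N \<longleftrightarrow> b \<noteq> Z"
  using Add_le[of b N] Z_ov not_N_lt consts_in unfolding ov_def by metis

lemma wadd_N: "b \<in> D \<Longrightarrow> sc (wadd b N) = b"
proof (rule induct_D[of "\<lambda>b. sc (wadd b N) = b"])
  show "dfn (\<lambda>e. sc (wadd (e 0) N) = e 0)" by (intro dfn_intros dtm_sc dtm_wadd dtm_const')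
next
  fix n assume n: "n \<in> D" "n \<noteq> N" "sc (wadd n N) = n"
  have "wadd (sc n) y = sc (wadd n y)" if "y \<in> D" for y
  proof (rule induct_D[of "\<lambda>y. wadd (sc n) y = sc (wadd n y)"])
    show "dfn (\<lambda>e. wadd (sc n) (e 0) = sc (wadd n (e 0)))"
      by (intro dfn_intros dtm_sc dtm_wadd dtm_const n)
  qed (use that n in \<open>auto simp: wadd_sc\<close>)
  then show "sc (wadd (sc n) N) = sc n" using n by simp
qed auto

section \<open>Two-digit numbers\<close>

definition sc2 :: "'a list \<Rightarrow> 'a list" where
  "sc2 x = (if last x = N then [sc (hd x), Z] else [hd x, sc (last x)])"

definition add2 :: "'a list \<Rightarrow> 'a list \<Rightarrow> 'a list" (infixl "\<oplus>" 65) where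
  "x \<oplus> y = [if ov (last x) (last y) then sc (wadd (hd x) (hd y)) else wadd (hd x) (hd y),
     wadd (last x) (last y)]"

abbreviation zero2 where "zero2 \<equiv> [Z, Z]"
abbreviation top2 where "top2 \<equiv> [N, N]"
abbreviation one2 where "one2 \<equiv> [Z, sc Z]"
abbreviation emb where "emb a \<equiv> [Z, a]"

lemma dtm2_sc2: "dtm2 t \<Longrightarrow> dtm2 (\<lambda>e. sc2 (t e))"
  unfolding sc2_def by (intro dtm2_if dtm2_pair dfn_eq dtm_hd dtm_last dtm_sc dtm_const')

lemma dtm2_add2: "dtm2 s \<Longrightarrow> dtm2 t \<Longrightarrow> dtm2 (\<lambda>e. s e \<oplus> t e)"
  unfolding add2_def by (intro dtm_if dtm2_pair dfn_ov dtm_hd dtm_last dtm_sc dtm_wadd)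

lemmas G_intros = dfn2_intros dtm2_sc2 dtm2_add2 dtm_sc dtm_wadd dtm_const' dfn_ov

lemma sc2_in [simp]: "x \<in> G \<Longrightarrow> sc2 x \<in> G" by (auto simp: sc2_def)
lemma add2_in [simp]: "x \<in> G \<Longrightarrow> y \<in> G \<Longrightarrow> x \<oplus> y \<in> G" by (auto simp: add2_def)

text \<open>
  Induction on the higher digit, and for each of its values on the lower one.
\<close>

lemma induct_G:
  assumes P: "dfn (\<lambda>e. P [e 0, e 1])" and base: "P zero2"
    and step: "\<And>x. x \<in> G \<Longrightarrow> x \<noteq> top2 \<Longrightarrow> P x \<Longrightarrow> P (sc2 x)" and x: "x \<in> G"
  shows "P x"
proof -
  have inner: "P [a, b]" if "a \<in> D" "P [a, Z]" "b \<in> D" for a b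
  proof (rule induct_D[of "\<lambda>b. P [a, b]"])
    show "dfn (\<lambda>e. P [a, e 0])" 
      by (intro dfn_app2[of "\<lambda>x y. P [x, y]", OF P] dtm_const dtm_var that)
    fix n assume "n \<in> D" "n \<noteq> N" "P [a, n]"
    then show "P [a, sc n]" using step[of "[a, n]"] that by (simp add: sc2_def)
  qed (use that in auto)
  have outer: "\<forall>b\<in>D. P [a, b]" if "a \<in> D" for a
  proof (rule induct_D[of "\<lambda>a. \<forall>b\<in>D. P [a, b]"])
    show "dfn (\<lambda>e. \<forall>b\<in>D. P [e 0, b])" 
      by (intro dfn_all dfn_app2[of "\<lambda>x y. P [x, y]", OF P] dtm_var)
    show "\<forall>b\<in>D. P [Z, b]" using inner base by simp
    fix n assume "n \<in> D" "n \<noteq> N" "\<forall>b\<in>D. P [n, b]"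
    then show "\<forall>b\<in>D. P [sc n, b]"
      using step[of "[n, N]"] by (auto simp: sc2_def intro: inner)
  qed (rule that)
  show ?thesis using outer x by (auto simp: G_iff)
qed

text \<open>
  From this recursion equation alone all laws of an abelian group follow by induction.  The
  case of \<open>y = top2\<close> is missing here and comes back through commutativity in \<open>add2_sc2_right\<close>.
\<close>

lemma add2_sc2_right0: "x \<in> G \<Longrightarrow> y \<in> G \<Longrightarrow> y \<noteq> top2 \<Longrightarrow> x \<oplus> sc2 y = sc2 (x \<oplus> y)"
proof (elim G_cases)
  fix a b c d
  assume h: "a \<in> D" "b \<in> D" "c \<in> D" "d \<in> D" "x = [a, b]" "y = [c, d]" "y \<noteq> top2"
  show "x \<oplus> sc2 y = sc2 (x \<oplus> y)"
  proof (cases "d = N")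
    case False
    then show ?thesis using h ov_sc[of b d] ov_neq_N[of b d]
      by (auto simp: sc2_def add2_def wadd_sc)
  next
    case True
    then have "c \<noteq> N" using h by simp
    then show ?thesis using h True ov_N[of b] wadd_N[of b] ov_neq_N[of b d]
      by (auto simp: sc2_def add2_def wadd_sc)
  qed
qed

lemma zero2_add2 [simp]: "x \<in> G \<Longrightarrow> zero2 \<oplus> x = x" and add2_zero2 [simp]: "x \<in> G \<Longrightarrow> x \<oplus> zero2 = x"
  by (auto elim!: G_cases simp: add2_def)

lemma sc2_top2 [simp]: "sc2 top2 = zero2" by (simp add: sc2_def)

lemma sc2_surj: assumes "y \<in> G" obtains x where "x \<in> G" "y = sc2 x"
proof (rule G_cases[OF assms])
  fix a b assume 1: "a \<in> D" "b \<in> D" "y = [a, b]"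
  show thesis
  proof (cases "b = Z")
    case True
    obtain a' where "a' \<in> D" "a = sc a'" using sc_surj' 1 by blast
    then show ?thesis using that[of "[a', N]"] 1 True by (simp add: sc2_def)
  next
    case False
    obtain b' where "b' \<in> D" "b' \<noteq> N" "b = sc b'" using sc_surj[OF 1(2) False] by blast
    then show ?thesis using that[of "[a, b']"] 1 by (simp add: sc2_def)
  qed
qed

lemma add2_sc2_left: "x \<in> G \<Longrightarrow> y \<in> G \<Longrightarrow> sc2 x \<oplus> y = sc2 (x \<oplus> y)"
proof (rule induct_G[of "\<lambda>y. sc2 x \<oplus> y = sc2 (x \<oplus> y)"])
  assume "x \<in> G"
  then show "dfn (\<lambda>e. sc2 x \<oplus> [e 0, e 1] = sc2 (x \<oplus> [e 0, e 1]))"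
    by (intro G_intros dtm2_const)
qed (simp_all add: add2_sc2_right0)

lemma add2_comm: "x \<in> G \<Longrightarrow> y \<in> G \<Longrightarrow> x \<oplus> y = y \<oplus> x"
proof (rule induct_G[of "\<lambda>y. x \<oplus> y = y \<oplus> x"])
  assume "x \<in> G"
  then show "dfn (\<lambda>e. x \<oplus> [e 0, e 1] = [e 0, e 1] \<oplus> x)" by (intro G_intros dtm2_const)
qed (simp_all add: add2_sc2_right0 add2_sc2_left)

lemma add2_sc2_right: "x \<in> G \<Longrightarrow> y \<in> G \<Longrightarrow> x \<oplus> sc2 y = sc2 (x \<oplus> y)"
  using add2_sc2_left add2_comm by simp

lemma add2_assoc: "x \<in> G \<Longrightarrow> y \<in> G \<Longrightarrow> w \<in> G \<Longrightarrow> x \<oplus> y \<oplus> w = x \<oplus> (y \<oplus> w)"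
proof (rule induct_G[of "\<lambda>w. x \<oplus> y \<oplus> w = x \<oplus> (y \<oplus> w)"])
  assume "x \<in> G" "y \<in> G"
  then show "dfn (\<lambda>e. x \<oplus> y \<oplus> [e 0, e 1] = x \<oplus> (y \<oplus> [e 0, e 1]))"
    by (intro G_intros dtm2_const add2_in)
qed (simp_all add: add2_sc2_right)

lemma add2_left_comm: "x \<in> G \<Longrightarrow> y \<in> G \<Longrightarrow> w \<in> G \<Longrightarrow> x \<oplus> (y \<oplus> w) = y \<oplus> (x \<oplus> w)"
  using add2_assoc add2_comm by metis

lemmas add2_ac = add2_assoc add2_comm add2_left_comm

lemma add2_inverse: "x \<in> G \<Longrightarrow> \<exists>y\<in>G. x \<oplus> y = zero2"
proof (rule induct_G[of "\<lambda>x. \<exists>y\<in>G. x \<oplus> y = zero2"])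
  show "dfn (\<lambda>e. \<exists>y\<in>G. [e 0, e 1] \<oplus> y = zero2)" by (intro G_intros)
  fix x assume x: "x \<in> G" "\<exists>y\<in>G. x \<oplus> y = zero2"
  then obtain y where y: "y \<in> G" "x \<oplus> y = zero2" by blast
  obtain w where w: "w \<in> G" "y = sc2 w" using sc2_surj y by blast
  have "sc2 x \<oplus> w = x \<oplus> sc2 w" using x w by (simp add: add2_sc2_left add2_sc2_right)
  then show "\<exists>y\<in>G. sc2 x \<oplus> y = zero2" using y w by metis
next
  show "\<exists>y\<in>G. zero2 \<oplus> y = zero2" by (rule bexI[of _ zero2]) simp_all
qed

lemma add2_cancel: assumes "x \<in> G" "y \<in> G" "w \<in> G" shows "x \<oplus> w = y \<oplus> w \<longleftrightarrow> x = y"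
proof
  assume a: "x \<oplus> w = y \<oplus> w"
  obtain v where "v \<in> G" "w \<oplus> v = zero2" using add2_inverse assms by blast
  then show "x = y" using a assms add2_assoc[of x w v] add2_assoc[of y w v] by (metis add2_zero2)
qed simp

lemma sc2_eq: "x \<in> G \<Longrightarrow> sc2 x = x \<oplus> one2"
  using add2_sc2_right[of x zero2] by (simp add: sc2_def)

text \<open>
  Partial sums in \<open>M\<close> are equations in the group of pairs, because a carry would show in the
  higher digit.
\<close>

lemma emb_Add: "x \<in> D \<Longrightarrow> y \<in> D \<Longrightarrow> z \<in> D \<Longrightarrow> Add M x y z \<longleftrightarrow> emb x \<oplus> emb y = emb z"
  using Add_iff sc_nz[of Z] by (auto simp: add2_def)

lemma emb_sc: "x \<in> D \<Longrightarrow> x \<noteq> N \<Longrightarrow> emb (sc x) = emb x \<oplus> one2"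
  using sc2_eq[of "emb x"] by (simp add: sc2_def)

text \<open>
  Multiplication by the base \<open>N + 1\<close> modulo its square.
\<close>

definition raise :: "'a list \<Rightarrow> 'a list" where "raise x = [last x, Z]"

lemma raise_in [simp]: "x \<in> G \<Longrightarrow> raise x \<in> G" by (simp add: raise_def)
lemma dtm2_raise: "dtm2 t \<Longrightarrow> dtm2 (\<lambda>e. raise (t e))"
  unfolding raise_def by (intro G_intros)
lemma raise_add2: "x \<in> G \<Longrightarrow> y \<in> G \<Longrightarrow> raise (x \<oplus> y) = raise x \<oplus> raise y"
  by (auto elim!: G_cases simp: add2_def raise_def)
lemma raise_pair: "raise [a, b] = [b, Z]" by (simp add: raise_def)
lemma digits: "a \<in> D \<Longrightarrow> b \<in> D \<Longrightarrow> [a, Z] \<oplus> emb b = [a, b]"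
  by (simp add: add2_def)

section \<open>Partial arithmetic\<close>

lemma le_trans: "x \<in> D \<Longrightarrow> y \<in> D \<Longrightarrow> z \<in> D \<Longrightarrow> le x y \<Longrightarrow> le y z \<Longrightarrow> le x z"
  using lt_trans by blast

lemma Add_comm: "x \<in> D \<Longrightarrow> y \<in> D \<Longrightarrow> z \<in> D \<Longrightarrow> Add M x y z \<longleftrightarrow> Add M y x z"
  using emb_Add add2_comm by simp

lemma Add_assoc:
  assumes "x \<in> D" "y \<in> D" "w \<in> D" "u \<in> D" "z \<in> D" "Add M x y u" "Add M u w z"
  obtains v where "v \<in> D" "Add M y w v" "Add M x v z"
proof -
  have "\<forall>z\<in>D. Add M u w z \<longrightarrow> (\<exists>v\<in>D. Add M y w v \<and> Add M x v z)"
  proof (rule induct_D[of "\<lambda>w. \<forall>z\<in>D. Add M u w z \<longrightarrow> (\<exists>v\<in>D. Add M y w v \<and> Add M x v z)"])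
    show "dfn (\<lambda>e. \<forall>z\<in>D. Add M u (e 0) z \<longrightarrow> (\<exists>v\<in>D. Add M y (e 0) v \<and> Add M x v z))"
      by (intro dfn_intros dtm_const assms)
    show "\<forall>z\<in>D. Add M u Z z \<longrightarrow> (\<exists>v\<in>D. Add M y Z v \<and> Add M x v z)"
      using Add_Z assms by blast
    fix n assume n: "n \<in> D" "n \<noteq> N" "\<forall>z\<in>D. Add M u n z \<longrightarrow> (\<exists>v\<in>D. Add M y n v \<and> Add M x v z)"
    show "\<forall>z\<in>D. Add M u (sc n) z \<longrightarrow> (\<exists>v\<in>D. Add M y (sc n) v \<and> Add M x v z)"
    proof (intro ballI impI)
      fix z assume z: "z \<in> D" "Add M u (sc n) z"
      then obtain t where t: "t \<in> D" "t \<noteq> N" "Add M u n t" "z = sc t"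
        using Add_sc' assms n by blast
      then obtain v where v: "v \<in> D" "Add M y n v" "Add M x v t" using n by blast
      have "v \<noteq> N" using Add_le[OF assms(1) v(1) t(1) v(3)] t not_N_lt by auto
      then show "\<exists>v\<in>D. Add M y (sc n) v \<and> Add M x v z"
        using v t n assms by (intro bexI[of _ "sc v"]) (simp_all add: Add_sc_sc)
    qed
  qed (rule assms)
  then show ?thesis using assms that by blast
qed

lemma Add_assoc':
  assumes "x \<in> D" "y \<in> D" "w \<in> D" "v \<in> D" "z \<in> D" "Add M y w v" "Add M x v z"
  obtains u where "u \<in> D" "Add M x y u" "Add M u w z"
proof -
  have "Add M w y v" "Add M v x z" using assms Add_comm by blast+
  then obtain u where "u \<in> D" "Add M y x u" "Add M w u z" using Add_assoc assms by metis
  then show ?thesis using that assms Add_comm by blast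
qed

lemma le_ex_Add:
  assumes "x \<in> D" "y \<in> D" "le x y" obtains w where "w \<in> D" "Add M x w y"
proof -
  have "le x y \<longrightarrow> (\<exists>w\<in>D. Add M x w y)"
  proof (rule induct_D[of "\<lambda>y. le x y \<longrightarrow> (\<exists>w\<in>D. Add M x w y)"])
    show "dfn (\<lambda>e. le x (e 0) \<longrightarrow> (\<exists>w\<in>D. Add M x w (e 0)))"
      by (intro dfn_intros dtm_const assms)
    show "le x Z \<longrightarrow> (\<exists>w\<in>D. Add M x w Z)" using not_lt_Z Add_Z assms by (metis consts_in(1))
    fix n assume n: "n \<in> D" "n \<noteq> N" "le x n \<longrightarrow> (\<exists>w\<in>D. Add M x w n)"
    show "le x (sc n) \<longrightarrow> (\<exists>w\<in>D. Add M x w (sc n))"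
    proof (cases "le x n")
      case True
      then obtain w where w: "w \<in> D" "Add M x w n" using n by blast
      have "w \<noteq> N" using Add_le[OF assms(1) w(1) n(1) w(2)] n not_N_lt by auto
      then show ?thesis using w n assms Add_sc_sc[of x w n] by (metis sc_in)
    next
      case False
      then show ?thesis using lt_sc_iff[of n x] n assms Add_Z[of x x] by (metis consts_in(1))
    qed
  qed (rule assms)
  then show ?thesis using that assms by blast
qed

lemma Add_le_right: "p \<in> D \<Longrightarrow> x \<in> D \<Longrightarrow> y \<in> D \<Longrightarrow> Add M p x y \<Longrightarrow> le x y"
  using Add_le by blast
lemma Add_le_left: "p \<in> D \<Longrightarrow> x \<in> D \<Longrightarrow> y \<in> D \<Longrightarrow> Add M p x y \<Longrightarrow> le p y"
  using Add_le Add_comm by blast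

lemma Add_strict:
  assumes "x \<in> D" "y \<in> D" "y' \<in> D" "z \<in> D" "z' \<in> D" "Add M x y z" "Add M x y' z'" "lt y y'"
  shows "lt z z'"
proof -
  obtain w where w: "w \<in> D" "Add M y w y'" using le_ex_Add assms by blast
  have "w \<noteq> Z" using w Add_Z[of y y'] assms lt_irrefl by auto
  obtain u where u: "u \<in> D" "Add M x y u" "Add M u w z'"
    using Add_assoc'[OF assms(1,2) w(1) assms(3,5) w(2) assms(7)] .
  then have "u = z" using Add_fun assms by blast
  then have "Add M w z z'" using u Add_comm w assms by blast
  then show ?thesis using Add_le \<open>w \<noteq> Z\<close> w assms by blast
qed

lemma Mul_mono_right:
  assumes "a \<in> D" "b \<in> D" "b' \<in> D" "z' \<in> D" "le b b'" "Mul M a b' z'"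
  obtains z where "z \<in> D" "le z z'" "Mul M a b z"
proof -
  have "\<forall>z'\<in>D. Mul M a b' z' \<longrightarrow> le b b' \<longrightarrow> (\<exists>z\<in>D. le z z' \<and> Mul M a b z)"
  proof (rule induct_D[of "\<lambda>b'. \<forall>z'\<in>D. Mul M a b' z' \<longrightarrow> le b b' \<longrightarrow> (\<exists>z\<in>D. le z z' \<and> Mul M a b z)"])
    show "dfn (\<lambda>e. \<forall>z'\<in>D. Mul M a (e 0) z' \<longrightarrow> le b (e 0) \<longrightarrow> (\<exists>z\<in>D. le z z' \<and> Mul M a b z))"
      by (intro dfn_intros dtm_const assms)
    show "\<forall>z'\<in>D. Mul M a Z z' \<longrightarrow> le b Z \<longrightarrow> (\<exists>z\<in>D. le z z' \<and> Mul M a b z)"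
      using not_lt_Z assms by blast
    fix n assume n: "n \<in> D" "n \<noteq> N"
      "\<forall>z'\<in>D. Mul M a n z' \<longrightarrow> le b n \<longrightarrow> (\<exists>z\<in>D. le z z' \<and> Mul M a b z)"
    show "\<forall>z'\<in>D. Mul M a (sc n) z' \<longrightarrow> le b (sc n) \<longrightarrow> (\<exists>z\<in>D. le z z' \<and> Mul M a b z)"
    proof (intro ballI impI)
      fix z' assume z: "z' \<in> D" "Mul M a (sc n) z'" "le b (sc n)"
      show "\<exists>z\<in>D. le z z' \<and> Mul M a b z"
      proof (cases "b = sc n")
        case False
        then have "le b n" using z lt_sc_iff n assms by blast
        obtain t where t: "t \<in> D" "Mul M a n t" "Add M t a z'" using z Mul_sc assms n by blast
        then obtain w where "w \<in> D" "le w t" "Mul M a b w" using n \<open>le b n\<close> by blast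
        then show ?thesis using le_trans[of w t z'] Add_le_left t z assms by blast
      qed (use z in auto)
    qed
  qed (rule assms)
  then show ?thesis using assms that by blast
qed

lemma Z_Mul: "m \<in> D \<Longrightarrow> z \<in> D \<Longrightarrow> Mul M Z m z \<longleftrightarrow> z = Z"
proof -
  assume m: "m \<in> D" "z \<in> D"
  have "Mul M Z m Z"
  proof (rule induct_D[of "\<lambda>m. Mul M Z m Z"])
    show "dfn (\<lambda>e. Mul M Z (e 0) Z)" by (intro dfn_intros dtm_const')
  qed (use m Mul_Z Mul_sc Add_Z in auto)
  then show ?thesis using Mul_fun m by (metis consts_in(1))
qed

lemma Mul_sc_left_dir:
  assumes n: "n \<in> D" "n \<noteq> N" and "m \<in> D" "t \<in> D" "z \<in> D" "Mul M n m t" "Add M t m z"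
  shows "Mul M (sc n) m z"
proof -
  have "\<forall>t\<in>D. \<forall>z\<in>D. Mul M n m t \<longrightarrow> Add M t m z \<longrightarrow> Mul M (sc n) m z"
  proof (rule induct_D[of "\<lambda>m. \<forall>t\<in>D. \<forall>z\<in>D. Mul M n m t \<longrightarrow> Add M t m z \<longrightarrow> Mul M (sc n) m z"])
    show "dfn (\<lambda>e. \<forall>t\<in>D. \<forall>z\<in>D. Mul M n (e 0) t \<longrightarrow> Add M t (e 0) z \<longrightarrow> Mul M (sc n) (e 0) z)"
      by (intro dfn_intros dtm_const n sc_in)
    show "\<forall>t\<in>D. \<forall>z\<in>D. Mul M n Z t \<longrightarrow> Add M t Z z \<longrightarrow> Mul M (sc n) Z z"
      using Mul_Z Add_Z n by auto
    fix m assume m: "m \<in> D" "m \<noteq> N"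
      "\<forall>t\<in>D. \<forall>z\<in>D. Mul M n m t \<longrightarrow> Add M t m z \<longrightarrow> Mul M (sc n) m z"
    show "\<forall>t\<in>D. \<forall>z\<in>D. Mul M n (sc m) t \<longrightarrow> Add M t (sc m) z \<longrightarrow> Mul M (sc n) (sc m) z"
    proof (intro ballI impI)
      fix t z assume t: "t \<in> D" "z \<in> D" "Mul M n (sc m) t" "Add M t (sc m) z"
      obtain u where u: "u \<in> D" "Mul M n m u" "Add M u n t" using t Mul_sc n m by blast
      obtain y where y: "y \<in> D" "y \<noteq> N" "Add M t m y" "z = sc y" using t Add_sc' m by blast
      obtain v where v: "v \<in> D" "Add M n m v" "Add M u v y"
        using Add_assoc[OF u(1) n(1) m(1) t(1) y(1) u(3) y(3)] .
      obtain w where w: "w \<in> D" "Add M u m w" "Add M w n y"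
        using Add_assoc'[of u m n v y] u v n m y Add_comm by metis
      have "Mul M (sc n) m w" using m(3) u w by blast
      moreover have "Add M w (sc n) z" using w y n by (simp add: Add_sc_sc)
      ultimately show "Mul M (sc n) (sc m) z" using Mul_sc n m t w sc_in by blast
    qed
  qed (rule assms)
  then show ?thesis using assms by blast
qed

lemma Mul_comm_dir: assumes "n \<in> D" "m \<in> D" "z \<in> D" "Mul M n m z" shows "Mul M m n z"
proof -
  have "\<forall>z\<in>D. Mul M n m z \<longrightarrow> Mul M m n z"
  proof (rule induct_D[of "\<lambda>m. \<forall>z\<in>D. Mul M n m z \<longrightarrow> Mul M m n z"])
    show "dfn (\<lambda>e. \<forall>z\<in>D. Mul M n (e 0) z \<longrightarrow> Mul M (e 0) n z)"
      by (intro dfn_intros dtm_const assms)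
  next
    fix m assume "m \<in> D" "m \<noteq> N" "\<forall>z\<in>D. Mul M n m z \<longrightarrow> Mul M m n z"
    then show "\<forall>z\<in>D. Mul M n (sc m) z \<longrightarrow> Mul M (sc m) n z"
      using Mul_sc_left_dir Mul_sc assms by blast
  qed (use assms Mul_Z Z_Mul in auto)
  then show ?thesis using assms by blast
qed

lemma Mul_comm: "n \<in> D \<Longrightarrow> m \<in> D \<Longrightarrow> z \<in> D \<Longrightarrow> Mul M n m z \<longleftrightarrow> Mul M m n z"
  using Mul_comm_dir by blast

lemma Mul_mono:
  assumes "x \<in> D" "y \<in> D" "x' \<in> D" "y' \<in> D" "z' \<in> D" "le x x'" "le y y'" "Mul M x' y' z'"
  obtains z where "z \<in> D" "le z z'" "Mul M x y z"
proof -
  obtain u where u: "u \<in> D" "le u z'" "Mul M x' y u" using Mul_mono_right assms by metis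
  then have "Mul M y x' u" using Mul_comm assms by blast
  then obtain z where "z \<in> D" "le z u" "Mul M y x z" using Mul_mono_right assms u by metis
  then show ?thesis using that Mul_comm le_trans[of z u z'] u assms by blast
qed

text \<open>
  Division with remainder; the arguments are divisor \<open>a\<close>, dividend \<open>x\<close>, quotient \<open>q\<close> and
  remainder \<open>r\<close>.
\<close>

definition divides_with :: "'a \<Rightarrow> 'a \<Rightarrow> 'a \<Rightarrow> 'a \<Rightarrow> bool" where
  "divides_with a x q r \<longleftrightarrow> lt r a \<and> (\<exists>t\<in>D. Mul M a q t \<and> Add M t r x)"

lemma le_Mul:
  assumes "a \<in> D" "a \<noteq> Z" "q \<in> D" "t \<in> D" "Mul M a q t" shows "le q t"
proof -
  obtain a' where a: "a' \<in> D" "a' \<noteq> N" "a = sc a'" using sc_surj assms by blast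
  have "Mul M q a t" using assms Mul_comm by blast
  then show ?thesis using Mul_sc[of q a' t] a assms Add_le_right by blast
qed

lemma dfn_divides:
  assumes "dtm a" "dtm x" "dtm q" "dtm r" shows "dfn (\<lambda>e. divides_with (a e) (x e) (q e) (r e))"
  by (rule dfn_app4[of divides_with, OF _ assms], unfold divides_with_def) (intro dfn_intros)

lemma divides_step:
  assumes "a \<in> D" "a \<noteq> Z" "n \<in> D" "n \<noteq> N" "q \<in> D" "r \<in> D" "divides_with a n q r"
  shows "sc r \<noteq> a \<Longrightarrow> divides_with a (sc n) q (sc r)"
    and "sc r = a \<Longrightarrow> divides_with a (sc n) (sc q) Z"
proof -
  obtain t where h: "lt r a" "t \<in> D" "Mul M a q t" "Add M t r n"
    using assms by (auto simp: divides_with_def)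
  have rN: "r \<noteq> N" using h assms lt_neq_N by blast
  have s: "Add M t (sc r) (sc n)" using h assms rN by (simp add: Add_sc_sc)
  {
    assume "sc r \<noteq> a"
    then have "lt (sc r) a" using le_sc[of r a] h assms by blast
    then show "divides_with a (sc n) q (sc r)" using h s by (auto simp: divides_with_def)
  }
  {
    assume r: "sc r = a"
    have "le q t" using le_Mul h assms by blast
    moreover have "le t n" using Add_le_left h assms by blast
    ultimately have "q \<noteq> N" using assms h not_N_lt le_trans[of q t n] by auto
    then have "Mul M a (sc q) (sc n)" using Mul_sc[of a q "sc n"] s r h assms by auto
    then show "divides_with a (sc n) (sc q) Z" unfolding divides_with_def
      using assms h Z_le Add_Z by (intro conjI bexI[of _ "sc n"]) auto
  }
qed

lemma division_ex:
  assumes "a \<in> D" "a \<noteq> Z" "x \<in> D" obtains q r where "q \<in> D" "r \<in> D" "divides_with a x q r"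
proof -
  have "\<exists>q\<in>D. \<exists>r\<in>D. divides_with a x q r"
  proof (rule induct_D[of "\<lambda>x. \<exists>q\<in>D. \<exists>r\<in>D. divides_with a x q r"])
    show "dfn (\<lambda>e. \<exists>q\<in>D. \<exists>r\<in>D. divides_with a (e 0) q r)"
      by (intro dfn_intros dfn_divides dtm_const assms)
    have "divides_with a Z Z Z" unfolding divides_with_def using Z_le assms Mul_Z Add_Z by auto
    then show "\<exists>q\<in>D. \<exists>r\<in>D. divides_with a Z q r" using consts_in(1) by blast
    fix n assume n: "n \<in> D" "n \<noteq> N" "\<exists>q\<in>D. \<exists>r\<in>D. divides_with a n q r"
    then obtain q r where qr: "q \<in> D" "r \<in> D" "divides_with a n q r" by blast
    then show "\<exists>q\<in>D. \<exists>r\<in>D. divides_with a (sc n) q r"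
      using divides_step[OF assms(1,2) n(1,2) qr] sc_in consts_in(1) by blast
  qed (rule assms)
  then show ?thesis using that by blast
qed

lemma division_less:
  assumes "a \<in> D" "x \<in> D" "x' \<in> D" "q \<in> D" "r \<in> D" "q' \<in> D" "r' \<in> D"
    and "divides_with a x q r" "divides_with a x' q' r'" "lt q q'"
  shows "lt x x'"
proof -
  obtain t where t: "t \<in> D" "Mul M a q t" "Add M t r x" "lt r a"
    using assms by (auto simp: divides_with_def)
  obtain t' where t': "t' \<in> D" "Mul M a q' t'" "Add M t' r' x'"
    using assms by (auto simp: divides_with_def)
  have q: "q \<noteq> N" "le (sc q) q'" using le_sc lt_neq_N assms by blast+
  obtain w where w: "w \<in> D" "le w t'" "Mul M a (sc q) w"
    using Mul_mono_right[of a "sc q" q' t'] q assms t' by auto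
  then have "Add M t a w" using Mul_sc[of a q w] assms q t Mul_fun by blast
  then have "lt x w" using Add_strict[of t r a x w] t w assms by blast
  moreover have "le t' x'" using Add_le_left t' assms by blast
  ultimately show ?thesis using w t' assms lt_trans by blast
qed

lemma division_unique:
  assumes "a \<in> D" "x \<in> D" "q \<in> D" "r \<in> D" "q' \<in> D" "r' \<in> D"
    and "divides_with a x q r" "divides_with a x q' r'"
  shows "q = q' \<and> r = r'"
proof -
  have q: "q = q'" using division_less[of a x x] assms lt_linear lt_irrefl by metis
  obtain t where t: "t \<in> D" "Add M t r x" "Add M t r' x"
    using assms q Mul_fun unfolding divides_with_def by metis
  have "r = r'" using lt_linear[of r r'] Add_strict[of t r r' x x] Add_strict[of t r' r x x] t assms
      lt_irrefl by blast
  with q show ?thesis by simp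
qed

section \<open>Digit products\<close>

text \<open>
  \<open>f\<close> is multiplication by the two-digit number \<open>x\<close>, restricted to digits and modulo
  \<open>(N + 1) * (N + 1)\<close>.  The last condition prolongs the recursion to the step from \<open>N\<close> to \<open>N + 1\<close>,
  where the value has to be \<open>x * (N + 1)\<close>; it makes the extension to pairs additive.
\<close>

definition line :: "'a list \<Rightarrow> ('a \<Rightarrow> 'a list) \<Rightarrow> bool" where
  "line x f \<longleftrightarrow> (\<forall>b\<in>D. f b \<in> G) \<and> (\<forall>t. dtm t \<longrightarrow> dtm2 (\<lambda>e. f (t e))) \<and> f Z = zero2 \<and>
     (\<forall>b\<in>D. b \<noteq> N \<longrightarrow> f (sc b) = f b \<oplus> x) \<and> f N \<oplus> x = raise x"

lemma line_in: "line x f \<Longrightarrow> b \<in> D \<Longrightarrow> f b \<in> G" by (simp add: line_def)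
lemma line_dtm: "line x f \<Longrightarrow> dtm t \<Longrightarrow> dtm2 (\<lambda>e. f (t e))" by (simp add: line_def)
lemma line_Z: "line x f \<Longrightarrow> f Z = zero2" by (simp add: line_def)
lemma line_sc: "line x f \<Longrightarrow> b \<in> D \<Longrightarrow> b \<noteq> N \<Longrightarrow> f (sc b) = f b \<oplus> x" by (simp add: line_def)
lemma line_N: "line x f \<Longrightarrow> f N \<oplus> x = raise x" by (simp add: line_def)

lemma line_unique:
  assumes "line x f" "line x g" "b \<in> D" shows "f b = g b"
proof (rule induct_D[of "\<lambda>b. f b = g b"])
  show "dfn (\<lambda>e. f (e 0) = g (e 0))" by (intro G_intros line_dtm[OF assms(1)] line_dtm[OF assms(2)])
qed (use assms in \<open>auto simp: line_Z line_sc\<close>)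

lemma line_add2:
  assumes "line x f" "line y g" "x \<in> G" "y \<in> G" shows "line (x \<oplus> y) (\<lambda>b. f b \<oplus> g b)"
proof -
  note i = line_in[OF assms(1)] line_in[OF assms(2)] assms(3,4)
  have "f N \<oplus> g N \<oplus> (x \<oplus> y) = (f N \<oplus> x) \<oplus> (g N \<oplus> y)" by (simp add: add2_ac i)
  also have "\<dots> = raise x \<oplus> raise y" using line_N assms by simp
  finally show ?thesis unfolding line_def
    using assms i
    by (auto simp: line_Z line_sc raise_add2 add2_ac
        intro!: dtm2_add2 line_dtm[OF assms(1)] line_dtm[OF assms(2)])
qed

text \<open>
  A digit function as a function of pairs \<open>[h, l]\<close>: \<open>f h * (N + 1) + f l\<close>.
\<close>

definition extend :: "('a \<Rightarrow> 'a list) \<Rightarrow> 'a list \<Rightarrow> 'a list" where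
  "extend f x = raise (f (hd x)) \<oplus> f (last x)"

lemma extend_in: "line x f \<Longrightarrow> y \<in> G \<Longrightarrow> extend f y \<in> G"
  by (simp add: extend_def line_in)

lemma dtm2_extend: "line x f \<Longrightarrow> dtm2 t \<Longrightarrow> dtm2 (\<lambda>e. extend f (t e))"
  unfolding extend_def by (intro dtm2_add2 dtm2_raise line_dtm dtm_hd dtm_last)

lemma extend_emb: "line x f \<Longrightarrow> b \<in> D \<Longrightarrow> extend f (emb b) = f b"
  by (simp add: extend_def line_Z line_in raise_pair)

lemma raise_raise: "raise (raise x) = zero2" by (simp add: raise_def)

lemma extend_sc2:
  assumes f: "line x f" and x: "x \<in> G" and y: "y \<in> G" shows "extend f (sc2 y) = extend f y \<oplus> x"
proof (rule G_cases[OF y])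
  note i = line_in[OF f] x
  fix a b assume y: "a \<in> D" "b \<in> D" "y = [a, b]"
  show ?thesis
  proof (cases "b = N")
    case False
    then show ?thesis using y i by (simp add: sc2_def extend_def line_sc[OF f] add2_assoc)
  next
    case True
    have "extend f y \<oplus> x = raise (f a) \<oplus> (f N \<oplus> x)" using y True i by (simp add: extend_def add2_assoc)
    also have "\<dots> = raise (f a \<oplus> x)" using y i by (simp add: line_N[OF f] raise_add2)
    also have "\<dots> = raise (f (sc a))"
      using y f by (cases "a = N") (simp_all add: line_N line_sc raise_raise line_Z raise_pair)
    also have "\<dots> = extend f (sc2 y)" using y True i by (simp add: extend_def sc2_def line_Z[OF f])
    finally show ?thesis by simp
  qed
qed

lemma extend_add2:
  assumes f: "line x f" and x: "x \<in> G" and y: "y \<in> G" "w \<in> G"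
  shows "extend f (y \<oplus> w) = extend f y \<oplus> extend f w"
proof (rule induct_G[of "\<lambda>w. extend f (y \<oplus> w) = extend f y \<oplus> extend f w"])
  show "dfn (\<lambda>e. extend f (y \<oplus> [e 0, e 1]) = extend f y \<oplus> extend f [e 0, e 1])"
    by (intro G_intros dtm2_extend[OF f] dtm2_const y extend_in[OF f])
next
  show "extend f (y \<oplus> zero2) = extend f y \<oplus> extend f zero2"
    using y extend_in[OF f] extend_emb[OF f, of Z] line_Z[OF f] by simp
qed (use y extend_in[OF f] x in \<open>auto simp: add2_sc2_right extend_sc2[OF f] add2_assoc\<close>)

lemma line_extend:
  assumes f: "line x f" and g: "line y g" and xy: "x \<in> G" "y \<in> G"
  shows "line (extend f y) (\<lambda>b. extend f (g b))"
proof -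
  note i = line_in[OF f] line_in[OF g] xy
  have "extend f (g N) \<oplus> extend f y = extend f (raise y)"
    using extend_add2[OF f] i by (simp add: line_N[OF g, symmetric])
  also have "\<dots> = raise (extend f y)"
    using i by (simp add: extend_def raise_add2 raise_raise line_Z[OF f])
      (simp add: raise_def line_Z[OF f])
  finally show ?thesis unfolding line_def
    using i extend_add2[OF f] extend_in[OF f] extend_emb[OF f, of Z] line_Z[OF f] line_Z[OF g]
    by (auto simp: line_sc[OF g] intro!: dtm2_extend[OF f] line_dtm[OF g])
qed

lemma line_Mul:
  assumes f: "line (emb a) f" and "a \<in> D" "b \<in> D" "w \<in> D" "Mul M a b w" shows "f b = emb w"
proof -
  have "\<forall>w\<in>D. Mul M a b w \<longrightarrow> f b = emb w"
  proof (rule induct_D[of "\<lambda>b. \<forall>w\<in>D. Mul M a b w \<longrightarrow> f b = emb w"])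
    show "dfn (\<lambda>e. \<forall>w\<in>D. Mul M a (e 0) w \<longrightarrow> f (e 0) = emb w)"
      by (intro G_intros line_dtm[OF f] dtm_const assms)
    show "\<forall>w\<in>D. Mul M a Z w \<longrightarrow> f Z = emb w" using assms Mul_Z line_Z by simp
    fix n assume n: "n \<in> D" "n \<noteq> N" "\<forall>w\<in>D. Mul M a n w \<longrightarrow> f n = emb w"
    then show "\<forall>w\<in>D. Mul M a (sc n) w \<longrightarrow> f (sc n) = emb w"
      using Mul_sc[of a n] assms emb_Add line_sc[OF f] by (metis (full_types))
  qed (rule assms)
  then show ?thesis using assms by blast
qed

subsection \<open>Small slopes\<close>

text \<open>
  Every number with a square in \<open>M\<close> is at most about the square root of \<open>N\<close>.
\<close>

definition small :: "'a \<Rightarrow> bool" where "small a \<longleftrightarrow> (\<exists>z\<in>D. Mul M a a z)"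

lemma dfn_small: assumes "dtm t" shows "dfn (\<lambda>e. small (t e))"
  by (rule dfn_app1[of small, OF _ assms], unfold small_def) (intro dfn_intros)

text \<open>
  With \<open>N + 1 = a * c + (d + 1)\<close> and \<open>b = c * q + r\<close> one has
  \<open>a * b + q * (d + 1) = q * (N + 1) + a * r\<close>.  The equation \<open>y \<oplus> emb u = [q, v]\<close> says just this,
  avoiding a subtraction.
\<close>

definition mu_graph :: "'a \<Rightarrow> 'a \<Rightarrow> 'a list \<Rightarrow> bool" where
  "mu_graph a b y \<longleftrightarrow> a = Z \<and> y = zero2 \<or> a \<noteq> Z \<and>
     (\<exists>c\<in>D. \<exists>d\<in>D. \<exists>q\<in>D. \<exists>r\<in>D. \<exists>u\<in>D. \<exists>v\<in>D. divides_with a N c d \<and> divides_with c b q r \<and>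
        Mul M q (sc d) u \<and> Mul M a r v \<and> y \<oplus> emb u = [q, v])"

lemma dfn_mu_graph: assumes "dtm a" "dtm b" "dtm2 y" shows "dfn (\<lambda>e. mu_graph (a e) (b e) (y e))"
  by (rule dfn_app_MMG[of mu_graph, OF _ assms], unfold mu_graph_def) (intro G_intros dfn_divides)

definition mu :: "'a \<Rightarrow> 'a \<Rightarrow> 'a list" where "mu a b = (THE y. y \<in> G \<and> mu_graph a b y)"

context
  fixes a c d t
  assumes a: "a \<in> D" "a \<noteq> Z" "small a" and c: "c \<in> D" and d: "d \<in> D" "lt d a"
    and t: "t \<in> D" "Mul M a c t" "Add M t d N"
begin

text \<open>
  Otherwise \<open>a * (c + 1)\<close> would be at most \<open>a * a\<close>, hence exist, and exceed \<open>a * c + d = N\<close>.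
\<close>

lemma le_a_c: "le a c"
proof (rule ccontr)
  assume "\<not> le a c"
  then have l: "lt c a" using lt_linear a c by blast
  then have cN: "c \<noteq> N" using lt_neq_N a c by blast
  obtain z where "z \<in> D" "Mul M a a z" using a by (auto simp: small_def)
  then obtain w where w: "w \<in> D" "Mul M a (sc c) w"
    using Mul_mono_right[of a "sc c" a z] le_sc[OF c a(1) l] a c by (metis sc_in)
  then have "Add M t a w" using Mul_sc[of a c w] a c cN t Mul_fun by blast
  then have "lt N w" using Add_strict[of t d a N w] t d a w by simp
  then show False using not_N_lt w by blast
qed

lemma c_nz: "c \<noteq> Z" using le_a_c a not_lt_Z by auto

lemma div_aN: "divides_with a N c d" unfolding divides_with_def using d t by blast

lemma div_cN: "divides_with c N a d" unfolding divides_with_def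
  using d t Mul_comm[of a c t] a c le_a_c lt_trans[of d a c] by blast

lemma mu_graph_iff:
  assumes "b \<in> D" "q \<in> D" "r \<in> D" "divides_with c b q r" "u \<in> D" "v \<in> D"
    "Mul M q (sc d) u" "Mul M a r v" "y \<in> G"
  shows "mu_graph a b y \<longleftrightarrow> y \<oplus> emb u = [q, v]"
proof
  assume "mu_graph a b y"
  then obtain c' d' q' r' u' v' where h: "c' \<in> D" "d' \<in> D" "q' \<in> D" "r' \<in> D" "u' \<in> D" "v' \<in> D"
    "divides_with a N c' d'" "divides_with c' b q' r'" "Mul M q' (sc d') u'" "Mul M a r' v'"
    "y \<oplus> emb u' = [q', v']" unfolding mu_graph_def using a(2) by blast
  have e1: "c' = c \<and> d' = d"
    by (rule division_unique[OF a(1) consts_in(3) h(1,2) c d(1) h(7) div_aN])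
  have e2: "q' = q \<and> r' = r"
    by (rule division_unique[OF c assms(1) h(3,4) assms(2,3) _ assms(4)]) (use h e1 in simp)
  have "u' = u" by (rule Mul_fun[OF _ assms(7)]) (use h e1 e2 assms d in auto)
  moreover have "v' = v" by (rule Mul_fun[OF _ assms(8)]) (use h e1 e2 assms a in auto)
  ultimately show "y \<oplus> emb u = [q, v]" using h e2 by simp
next
  assume "y \<oplus> emb u = [q, v]"
  then show "mu_graph a b y" unfolding mu_graph_def using assms a c d div_aN
    by - (rule disjI2, rule conjI, assumption, rule bexI[of _ c], rule bexI[of _ d],
        rule bexI[of _ q], rule bexI[of _ r], rule bexI[of _ u], rule bexI[of _ v], intro conjI)
qed

text \<open>
  Here smallness enters: \<open>q \<le> a\<close> and \<open>d + 1 \<le> a\<close>, so \<open>q * (d + 1)\<close> is bounded by \<open>a * a\<close>.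
\<close>

lemma mu_graph_witnesses:
  assumes "b \<in> D" "q \<in> D" "r \<in> D" "divides_with c b q r"
  obtains u v where "u \<in> D" "v \<in> D" "Mul M q (sc d) u" "Mul M a r v"
proof -
  have "le q a" using division_less[of c N b a d q r] div_cN assms a c d lt_linear[of q a] not_N_lt
    by auto
  moreover have "le (sc d) a" using le_sc d a by blast
  moreover obtain z where "z \<in> D" "Mul M a a z" using a by (auto simp: small_def)
  ultimately obtain u where u: "u \<in> D" "Mul M q (sc d) u"
    using Mul_mono[of q "sc d" a a z] assms a d sc_in by metis
  have "lt r c" using assms by (simp add: divides_with_def)
  then obtain v where "v \<in> D" "Mul M a r v"
    using Mul_mono_right[of a r c t] assms a c t by metis
  then show ?thesis using that u by blast
qed

lemma mu_props:
  assumes "b \<in> D" shows "mu a b \<in> G" "y \<in> G \<Longrightarrow> mu_graph a b y \<longleftrightarrow> mu a b = y"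
proof -
  obtain q r where qr: "q \<in> D" "r \<in> D" "divides_with c b q r"
    using division_ex[OF c c_nz assms] .
  obtain u v where uv: "u \<in> D" "v \<in> D" "Mul M q (sc d) u" "Mul M a r v"
    using mu_graph_witnesses[OF assms qr] .
  note iff = mu_graph_iff[OF assms qr uv]
  obtain i where i: "i \<in> G" "emb u \<oplus> i = zero2" using add2_inverse[of "emb u"] uv by auto
  define y0 where "y0 = [q, v] \<oplus> i"
  have "i \<oplus> emb u = zero2" using i uv add2_comm[of i "emb u"] by simp
  then have y0: "y0 \<in> G" "y0 \<oplus> emb u = [q, v]"
    using i qr uv by (simp_all add: y0_def add2_assoc)
  have e: "y \<oplus> emb u = [q, v] \<longleftrightarrow> y0 = y" if "y \<in> G" for y
    using add2_cancel[of y0 y "emb u"] that y0 uv by auto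
  have "mu a b = y0" unfolding mu_def
  proof (rule the_equality)
    show "y0 \<in> G \<and> mu_graph a b y0" using y0 iff by blast
    fix y assume "y \<in> G \<and> mu_graph a b y"
    then show "y = y0" using iff e by blast
  qed
  then show "mu a b \<in> G" "y \<in> G \<Longrightarrow> mu_graph a b y \<longleftrightarrow> mu a b = y"
    using y0(1) iff e by blast+
qed

lemma mu_eqI:
  assumes "b \<in> D" "q \<in> D" "r \<in> D" "divides_with c b q r" "u \<in> D" "v \<in> D"
    "Mul M q (sc d) u" "Mul M a r v" "y \<in> G" "y \<oplus> emb u = [q, v]"
  shows "mu a b = y"
  using mu_props(2) mu_graph_iff assms by blast

lemma mu_eqD:
  assumes "b \<in> D" "q \<in> D" "r \<in> D" "divides_with c b q r" "u \<in> D" "v \<in> D"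
    "Mul M q (sc d) u" "Mul M a r v"
  shows "mu a b \<oplus> emb u = [q, v]"
  using mu_props mu_graph_iff assms by blast

text \<open>
  Passing from \<open>b\<close> to \<open>b + 1\<close> either increases the remainder \<open>r\<close> or, if \<open>r + 1 = c\<close>, resets it and
  increases \<open>q\<close>; in the second case \<open>a * c + d + 1 = N + 1\<close> pays for the new higher digit.
\<close>

lemma mu_line: "line (emb a) (mu a)"
  unfolding line_def
proof (intro conjI ballI allI impI)
  fix b assume "b \<in> D" then show "mu a b \<in> G" by (rule mu_props)
next
  fix s assume s: "dtm s"
  show "dtm2 (\<lambda>e. mu a (s e))"
  proof (rule dtm2_app1[of "mu a", OF _ _ s])
    fix s t assume st: "dtm s" "dtm2 t"
    have "dfn (\<lambda>e. mu_graph a (s e) (t e))" by (intro dfn_mu_graph st dtm_const a)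
    then show "dfn (\<lambda>e. mu a (s e) = t e)"
      by (rule dfn_cong[THEN iffD1, rotated]) (simp add: mu_props dtm_in[OF st(1)] dtm2_in[OF st(2)])
  qed (rule mu_props)
next
  have "divides_with c Z Z Z" unfolding divides_with_def
    using c_nz Z_le c Mul_Z Add_Z by auto
  then show "mu a Z = zero2"
    using Z_Mul Mul_Z a d by (intro mu_eqI[of Z Z Z Z Z]) auto
next
  fix b assume b: "b \<in> D" "b \<noteq> N"
  obtain q r where qr: "q \<in> D" "r \<in> D" "divides_with c b q r"
    using division_ex[OF c c_nz b(1)] .
  obtain u v where uv: "u \<in> D" "v \<in> D" "Mul M q (sc d) u" "Mul M a r v"
    using mu_graph_witnesses[OF b(1) qr] .
  note y = mu_props(1)[OF b(1)]
  have eq: "mu a b \<oplus> emb u = [q, v]" using mu_eqD[OF b(1) qr uv] .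
  have rN: "r \<noteq> N" using qr c lt_neq_N by (auto simp: divides_with_def)
  have sb: "sc b \<in> D" using b by simp
  show "mu a (sc b) = mu a b \<oplus> emb a"
  proof (cases "sc r = c")
    case False
    then have dv: "divides_with c (sc b) q (sc r)" using divides_step(1)[OF c c_nz b qr] by simp
    obtain v' where v': "v' \<in> D" "Mul M a (sc r) v'"
      using mu_graph_witnesses[OF sb qr(1) _ dv] qr by auto
    then have "Add M v a v'" using Mul_sc[of a r v'] a qr rN uv Mul_fun by blast
    then have v2: "emb v' = emb v \<oplus> emb a" using emb_Add uv a v' by simp
    have "mu a b \<oplus> emb a \<oplus> emb u = [q, v] \<oplus> emb a" using y a uv by (simp add: add2_ac flip: eq)
    also have "\<dots> = [q, Z] \<oplus> (emb v \<oplus> emb a)"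
      using digits[of q v, symmetric] qr uv a by (simp add: add2_assoc)
    also have "\<dots> = [q, v']" using digits[of q v'] v2 qr v' by simp
    finally show ?thesis
      using mu_eqI[OF sb qr(1) _ dv uv(1) v'(1) uv(3) v'(2)] qr y a by simp
  next
    case True
    then have dv: "divides_with c (sc b) (sc q) Z" using divides_step(2)[OF c c_nz b qr] by simp
    have "q \<noteq> N"
    proof
      assume "q = N"
      then obtain w where w: "w \<in> D" "Mul M c N w" "Add M w r b"
        using qr by (auto simp: divides_with_def)
      then have "le N w" "le w b" using le_Mul[of c N w] c c_nz Add_le_left qr b by auto
      then show False using b w not_N_lt le_trans[of N w b] by auto
    qed
    obtain u' where u': "u' \<in> D" "Mul M (sc q) (sc d) u'"
      using mu_graph_witnesses[OF sb _ _ dv] qr by auto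
    have "Mul M (sc d) (sc q) u'" "Mul M (sc d) q u"
      using Mul_comm u' uv qr d by simp_all
    then have "Add M u (sc d) u'"
      using Mul_sc[of "sc d" q u'] \<open>q \<noteq> N\<close> Mul_fun qr d u' uv by (metis sc_in)
    moreover have "d \<noteq> N" using d lt_neq_N a by blast
    ultimately have u2: "emb u' = emb u \<oplus> (emb d \<oplus> one2)"
      using emb_Add[of u "sc d" u'] uv u' d emb_sc[of d] by simp
    have "Add M v a t" using Mul_sc[of a r t] True t a qr rN uv Mul_fun by blast
    then have t2: "emb v \<oplus> emb a = emb t" using emb_Add uv a t by simp
    have t3: "emb t \<oplus> emb d = emb N" using emb_Add t d by simp
    have "mu a b \<oplus> emb a \<oplus> emb u' = (mu a b \<oplus> emb u) \<oplus> (emb a \<oplus> (emb d \<oplus> one2))"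
      using y a uv d by (simp add: u2 add2_ac)
    also have "\<dots> = [q, Z] \<oplus> emb v \<oplus> (emb a \<oplus> (emb d \<oplus> one2))"
      using eq digits qr uv by simp
    also have "\<dots> = [q, Z] \<oplus> ((emb v \<oplus> emb a) \<oplus> emb d) \<oplus> one2"
      using qr uv a d by (simp add: add2_assoc)
    also have "\<dots> = sc2 [q, N]" using t2 t3 digits[of q N] qr sc2_eq[of "[q, N]"] by simp
    also have "\<dots> = [sc q, Z]" by (simp add: sc2_def)
    finally show ?thesis
      using mu_eqI[OF sb _ _ dv u'(1) _ u'(2)] qr y a Mul_Z by simp
  qed
next
  obtain u v where uv: "u \<in> D" "v \<in> D" "Mul M a (sc d) u" "Mul M a d v"
    using mu_graph_witnesses[OF consts_in(3) a(1) d(1) div_cN] .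
  have eq: "mu a N \<oplus> emb u = [a, v]" using mu_eqD[OF _ a(1) d(1) div_cN uv] by simp
  have y: "mu a N \<in> G" using mu_props by simp
  have "d \<noteq> N" using d lt_neq_N a by blast
  then have "Add M v a u" using Mul_sc[of a d u] uv a d Mul_fun by blast
  then have u2: "emb u = emb a \<oplus> emb v" using emb_Add uv a add2_comm by simp
  have "mu a N \<oplus> emb a \<oplus> emb v = [a, Z] \<oplus> emb v"
    using eq u2 y a uv digits[of a v] by (simp add: add2_assoc)
  then show "mu a N \<oplus> emb a = raise (emb a)"
    using add2_cancel[of "mu a N \<oplus> emb a" "[a, Z]" "emb v"] y a uv by (simp add: raise_pair)
qed

end

lemma small_mu:
  assumes "a \<in> D" "small a"
  shows "line (emb a) (mu a)" "b \<in> D \<Longrightarrow> y \<in> G \<Longrightarrow> mu_graph a b y \<longleftrightarrow> mu a b = y"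
proof -
  have "line (emb a) (mu a) \<and> (b \<in> D \<longrightarrow> y \<in> G \<longrightarrow> (mu_graph a b y \<longleftrightarrow> mu a b = y))"
  proof (cases "a = Z")
    case True
    have "mu Z b = zero2" for b
      unfolding mu_def mu_graph_def by (rule the_equality) auto
    then show ?thesis using True by (simp add: mu_graph_def line_def raise_pair dtm2_const eq_commute)
  next
    case False
    obtain c d where "c \<in> D" "d \<in> D" "divides_with a N c d" 
      using division_ex[OF assms(1) False, of N] by auto
    then show ?thesis
      using mu_line[of a c d] mu_props(2)[of a c d _ b y] assms False
      by (auto simp: divides_with_def)
  qed
  then show "line (emb a) (mu a)" "b \<in> D \<Longrightarrow> y \<in> G \<Longrightarrow> mu_graph a b y \<longleftrightarrow> mu a b = y" by auto
qed

subsection \<open>All slopes\<close>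

definition rep :: "'a \<Rightarrow> 'a \<Rightarrow> 'a \<Rightarrow> 'a \<Rightarrow> 'a \<Rightarrow> bool" where
  "rep a s p r1 r2 \<longleftrightarrow> (\<exists>w\<in>D. \<exists>t\<in>D. Mul M s p w \<and> Add M w r1 t \<and> Add M t r2 a)"

lemma small_le: "a \<in> D \<Longrightarrow> b \<in> D \<Longrightarrow> small b \<Longrightarrow> le a b \<Longrightarrow> small a"
  unfolding small_def using Mul_mono[of a a b b] by metis

lemma max_small:
  obtains s where "s \<in> D" "small s" "s \<noteq> Z" "s \<noteq> N \<Longrightarrow> \<not> small (sc s)"
proof -
  have "\<exists>s\<in>D. small s \<and> (s \<noteq> N \<longrightarrow> \<not> small (sc s))"
  proof (rule ccontr)
    assume *: "\<not> ?thesis"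
    have "small N"
    proof (rule induct_D[of small])
      show "dfn (\<lambda>e. small (e 0))" by (intro dfn_small dtm_var)
      show "small Z" unfolding small_def using Mul_Z by auto
    qed (use * in auto)
    then show False using * by auto
  qed
  then obtain s where s: "s \<in> D" "small s" "s \<noteq> N \<Longrightarrow> \<not> small (sc s)" by blast
  have "Mul M (sc Z) (sc Z) (sc Z)"
    using Mul_sc[of "sc Z" Z "sc Z"] Mul_Z[of "sc Z" Z] Z_Add[of "sc Z"] by auto
  then have "small (sc Z)" unfolding small_def by auto
  then have "s \<noteq> Z" using s by auto
  then show ?thesis using that s by blast
qed

text \<open>
  Induction on \<open>a\<close>, for the largest small number \<open>s\<close>: increase \<open>r2\<close>, or else \<open>r1\<close>, or else \<open>p\<close>.
  If all three equal \<open>s\<close>, then \<open>a + 1 = s * s + s + s + 1\<close> is the square of \<open>s + 1\<close>, which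
  contradicts the choice of \<open>s\<close>.
\<close>

lemma rep_ex:
  assumes "a \<in> D"
  obtains s p r1 r2 where "s \<in> D" "p \<in> D" "r1 \<in> D" "r2 \<in> D" "small s" "small p" "small r1" "small r2"
    "rep a s p r1 r2"
proof -
  obtain s where s: "s \<in> D" "small s" "s \<noteq> Z" "s \<noteq> N \<Longrightarrow> \<not> small (sc s)" by (rule max_small) blast
  have sZ: "le (sc Z) s" using le_sc[of Z s] Z_le s by simp
  have "\<exists>p\<in>D. \<exists>r1\<in>D. \<exists>r2\<in>D. le p s \<and> le r1 s \<and> le r2 s \<and> rep a s p r1 r2"
    unfolding rep_def
  proof (rule induct_D[of "\<lambda>a. \<exists>p\<in>D. \<exists>r1\<in>D. \<exists>r2\<in>D. le p s \<and> le r1 s \<and> le r2 s \<and>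
      (\<exists>w\<in>D. \<exists>t\<in>D. Mul M s p w \<and> Add M w r1 t \<and> Add M t r2 a)"])
    show "dfn (\<lambda>e. \<exists>p\<in>D. \<exists>r1\<in>D. \<exists>r2\<in>D. le p s \<and> le r1 s \<and> le r2 s \<and>
      (\<exists>w\<in>D. \<exists>t\<in>D. Mul M s p w \<and> Add M w r1 t \<and> Add M t r2 (e 0)))"
      by (intro dfn_intros dtm_const s)
    show "\<exists>p\<in>D. \<exists>r1\<in>D. \<exists>r2\<in>D. le p s \<and> le r1 s \<and> le r2 s \<and>
      (\<exists>w\<in>D. \<exists>t\<in>D. Mul M s p w \<and> Add M w r1 t \<and> Add M t r2 Z)"
      using Z_le s Mul_Z Add_Z by (intro bexI[of _ Z] conjI) auto
    fix n assume n: "n \<in> D" "n \<noteq> N"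
    assume "\<exists>p\<in>D. \<exists>r1\<in>D. \<exists>r2\<in>D. le p s \<and> le r1 s \<and> le r2 s \<and>
      (\<exists>w\<in>D. \<exists>t\<in>D. Mul M s p w \<and> Add M w r1 t \<and> Add M t r2 n)"
    then show "\<exists>p\<in>D. \<exists>r1\<in>D. \<exists>r2\<in>D. le p s \<and> le r1 s \<and> le r2 s \<and>
      (\<exists>w\<in>D. \<exists>t\<in>D. Mul M s p w \<and> Add M w r1 t \<and> Add M t r2 (sc n))"
    proof (elim bexE conjE)
    fix p r1 r2 w t assume h: "p \<in> D" "r1 \<in> D" "r2 \<in> D" "le p s" "le r1 s" "le r2 s"
      "w \<in> D" "t \<in> D" "Mul M s p w" "Add M w r1 t" "Add M t r2 n"
    have tN: "t \<noteq> N" using Add_le_left[of t r2 n] h n not_N_lt by auto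
    have goal: "\<exists>p\<in>D. \<exists>r1\<in>D. \<exists>r2\<in>D. le p s \<and> le r1 s \<and> le r2 s \<and>
      (\<exists>w\<in>D. \<exists>t\<in>D. Mul M s p w \<and> Add M w r1 t \<and> Add M t r2 (sc n))" if "p' \<in> D" "r1' \<in> D" "r2' \<in> D" "le p' s" "le r1' s" "le r2' s"
      "w' \<in> D" "t' \<in> D" "Mul M s p' w'" "Add M w' r1' t'" "Add M t' r2' (sc n)"
      for p' r1' r2' w' t'
      by (rule bexI[of _ p'], rule bexI[of _ r1'], rule bexI[of _ r2'], intro conjI that,
          rule bexI[of _ w'], rule bexI[of _ t'], intro conjI that) (rule that)+
    consider "r2 \<noteq> s" | "r2 = s" "r1 \<noteq> s" | "r2 = s" "r1 = s" "p \<noteq> s"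
      | "r2 = s" "r1 = s" "p = s" by blast
    then show ?thesis
    proof cases
      case 1
      then have "r2 \<noteq> N" "le (sc r2) s" using h lt_neq_N s le_sc by auto
      then show ?thesis using h n Add_sc_sc by (intro goal[of p r1 "sc r2" w t]) auto
    next
      case 2
      then have "r1 \<noteq> N" "le (sc r1) s" using h lt_neq_N s le_sc by auto
      moreover have "Add M (sc t) s (sc n)"
        using Add_comm[of "sc t" s "sc n"] Add_comm[of t s n] h s n tN 2 by (simp add: Add_sc_sc)
      ultimately show ?thesis using h n Add_sc_sc tN 2
        by (intro goal[of p "sc r1" s w "sc t"]) auto
    next
      case 3
      then have "p \<noteq> N" "le (sc p) s" using h lt_neq_N s le_sc by auto
      moreover have "Mul M s (sc p) t" using Mul_sc[of s p t] h s 3 \<open>p \<noteq> N\<close> by auto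
      moreover have "Add M n (sc Z) (sc n)" using n Add_sc_sc[of n Z n] Add_Z by auto
      ultimately show ?thesis using h n 3 s sZ by (intro goal[of "sc p" s "sc Z" t n]) auto
    next
      case 4
      have "s \<noteq> N" using Add_le_right[of t s n] h 4 n not_N_lt by auto
      have "Mul M (sc s) s t" using Mul_sc_left_dir[of s s w t] h 4 s \<open>s \<noteq> N\<close> by auto
      moreover have "Add M t (sc s) (sc n)" using h 4 n s \<open>s \<noteq> N\<close> by (simp add: Add_sc_sc)
      ultimately have "Mul M (sc s) (sc s) (sc n)"
        using Mul_sc[of "sc s" s "sc n"] h s n \<open>s \<noteq> N\<close> by auto
      then have "small (sc s)" using n by (auto simp: small_def)
      then show ?thesis using s \<open>s \<noteq> N\<close> by blast
    qed
    qed
  qed (rule assms)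
  then show ?thesis
  proof (elim bexE conjE)
    fix p r1 r2 assume h: "p \<in> D" "r1 \<in> D" "r2 \<in> D" "le p s" "le r1 s" "le r2 s" "rep a s p r1 r2"
    then have "small p" "small r1" "small r2" using small_le s by blast+
    then show ?thesis using that s h by blast
  qed
qed

text \<open>
  The product \<open>p * (s * b) + r1 * b + r2 * b\<close> for some decomposition of \<open>a\<close>, where \<open>x = s * b\<close> has
  two digits and is multiplied by \<open>p\<close> digitwise.
\<close>

definition dp_graph :: "'a \<Rightarrow> 'a \<Rightarrow> 'a list \<Rightarrow> bool" where
  "dp_graph a b y \<longleftrightarrow> (\<exists>s\<in>D. \<exists>p\<in>D. \<exists>r1\<in>D. \<exists>r2\<in>D. \<exists>x\<in>G. \<exists>y1\<in>G. \<exists>y2\<in>G. \<exists>y3\<in>G. \<exists>y4\<in>G.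
     small s \<and> small p \<and> small r1 \<and> small r2 \<and> rep a s p r1 r2 \<and> mu_graph s b x \<and>
     mu_graph p (hd x) y1 \<and> mu_graph p (last x) y2 \<and> mu_graph r1 b y3 \<and> mu_graph r2 b y4 \<and>
     y = raise y1 \<oplus> y2 \<oplus> y3 \<oplus> y4)"

lemma dfn_dp_graph:
  assumes "dtm a" "dtm b" "dtm2 y" shows "dfn (\<lambda>e. dp_graph (a e) (b e) (y e))"
  by (rule dfn_app_MMG[of dp_graph, OF _ assms], unfold dp_graph_def rep_def)
    (intro G_intros dfn_small dfn_mu_graph dtm2_raise)

definition dp :: "'a \<Rightarrow> 'a \<Rightarrow> 'a list" where "dp a b = (THE y. y \<in> G \<and> dp_graph a b y)"

lemma code_line:
  assumes "a \<in> D" "s \<in> D" "p \<in> D" "r1 \<in> D" "r2 \<in> D" "small s" "small p" "small r1" "small r2"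
    "rep a s p r1 r2"
  shows "line (emb a) (\<lambda>b. extend (mu p) (mu s b) \<oplus> mu r1 b \<oplus> mu r2 b)"
proof -
  note l = small_mu(1)
  obtain w t where wt: "w \<in> D" "t \<in> D" "Mul M s p w" "Add M w r1 t" "Add M t r2 a"
    using assms by (auto simp: rep_def)
  have "Mul M p s w" using Mul_comm[of s p w] wt assms by simp
  then have "extend (mu p) (emb s) = emb w"
    using extend_emb[OF l[of p] assms(2)] line_Mul[OF l[of p], of s w] wt assms by simp
  then have "extend (mu p) (emb s) \<oplus> emb r1 \<oplus> emb r2 = emb a"
    using emb_Add[of w r1 t] emb_Add[of t r2 a] wt assms by simp
  moreover have "line (extend (mu p) (emb s) \<oplus> emb r1 \<oplus> emb r2)
      (\<lambda>b. extend (mu p) (mu s b) \<oplus> mu r1 b \<oplus> mu r2 b)"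
    by (intro line_add2 line_extend[OF l[of p] l[of s]] l extend_in[OF l[of p]] add2_in)
      (simp_all add: assms)
  ultimately show ?thesis by simp
qed

text \<open>
  Different decompositions of \<open>a\<close> give lines with the same slope, which agree by \<open>line_unique\<close>.
\<close>

lemma dp_graph_iff:
  assumes "a \<in> D" obtains f where "line (emb a) f"
    "\<And>b y. b \<in> D \<Longrightarrow> y \<in> G \<Longrightarrow> dp_graph a b y \<longleftrightarrow> f b = y"
proof -
  obtain s p r1 r2 where c: "s \<in> D" "p \<in> D" "r1 \<in> D" "r2 \<in> D" "small s" "small p" "small r1"
    "small r2" "rep a s p r1 r2" using rep_ex[OF assms] .
  let ?f = "\<lambda>s p r1 r2 b. extend (mu p) (mu s b) \<oplus> mu r1 b \<oplus> mu r2 b"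
  have "dp_graph a b y \<longleftrightarrow> ?f s p r1 r2 b = y" if b: "b \<in> D" and y: "y \<in> G" for b y
  proof
    assume "dp_graph a b y"
    then show "?f s p r1 r2 b = y" unfolding dp_graph_def
    proof (elim bexE conjE)
    fix s' p' r1' r2' x y1 y2 y3 y4
    assume c': "s' \<in> D" "p' \<in> D" "r1' \<in> D" "r2' \<in> D"
      "small s'" "small p'" "small r1'" "small r2'" "rep a s' p' r1' r2'"
      and h: "x \<in> G" "y1 \<in> G" "y2 \<in> G" "y3 \<in> G" "y4 \<in> G" "mu_graph s' b x"
      "mu_graph p' (hd x) y1" "mu_graph p' (last x) y2" "mu_graph r1' b y3" "mu_graph r2' b y4"
      "y = raise y1 \<oplus> y2 \<oplus> y3 \<oplus> y4"
    have "y = ?f s' p' r1' r2' b"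
    proof -
      have "hd x \<in> D" "last x \<in> D" using h(1) by (rule hd_in, rule last_in)
      then have "mu s' b = x" "mu p' (hd x) = y1" "mu p' (last x) = y2" "mu r1' b = y3" "mu r2' b = y4"
        using small_mu(2)[OF c'(1,5) b h(1)] small_mu(2)[OF c'(2,6) _ h(2)] small_mu(2)[OF c'(2,6) _ h(3)]
          small_mu(2)[OF c'(3,7) b h(4)] small_mu(2)[OF c'(4,8) b h(5)] h(6-10) by simp_all
      with h(11) show ?thesis by (simp only: extend_def)
    qed
    moreover have "?f s p r1 r2 b = ?f s' p' r1' r2' b"
      by (rule line_unique[OF code_line[OF assms c] code_line[OF assms c'] b])
    ultimately show "?f s p r1 r2 b = y" by (simp only:)
    qed
  next
    assume e: "?f s p r1 r2 b = y"
    have x: "mu s b \<in> G" "mu r1 b \<in> G" "mu r2 b \<in> G"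
      by (rule line_in[OF small_mu(1)], fact+)+
    have x': "hd (mu s b) \<in> D" "last (mu s b) \<in> D" using x(1) by (rule hd_in, rule last_in)
    have y': "mu p (hd (mu s b)) \<in> G" "mu p (last (mu s b)) \<in> G"
      by (rule line_in[OF small_mu(1)], fact+)+
    have "mu_graph s b (mu s b)" "mu_graph r1 b (mu r1 b)" "mu_graph r2 b (mu r2 b)"
      "mu_graph p (hd (mu s b)) (mu p (hd (mu s b)))" "mu_graph p (last (mu s b)) (mu p (last (mu s b)))"
      by (rule small_mu(2)[THEN iffD2, OF _ _ _ _ refl], fact+)+
    moreover have "y = raise (mu p (hd (mu s b))) \<oplus> mu p (last (mu s b)) \<oplus> mu r1 b \<oplus> mu r2 b"
      using e by (simp only: extend_def)
    ultimately show "dp_graph a b y" unfolding dp_graph_def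
      using c x y'
      by - (rule bexI[of _ s], rule bexI[of _ p], rule bexI[of _ r1], rule bexI[of _ r2],
          rule bexI[of _ "mu s b"], rule bexI[of _ "mu p (hd (mu s b))"],
          rule bexI[of _ "mu p (last (mu s b))"], rule bexI[of _ "mu r1 b"],
          rule bexI[of _ "mu r2 b"], intro conjI, assumption+)
  qed
  then show ?thesis by (intro that[OF code_line[OF assms c]])
qed

lemma dp_props:
  assumes "a \<in> D"
  shows "line (emb a) (dp a)" "b \<in> D \<Longrightarrow> y \<in> G \<Longrightarrow> dp_graph a b y \<longleftrightarrow> dp a b = y"
proof -
  obtain f where f: "line (emb a) f"
    "\<And>b y. b \<in> D \<Longrightarrow> y \<in> G \<Longrightarrow> dp_graph a b y \<longleftrightarrow> f b = y" using dp_graph_iff[OF assms] by blast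
  have e: "dp a b = f b" if "b \<in> D" for b
    unfolding dp_def using f line_in[OF f(1) that] that by (intro the_equality) auto
  have d: "dtm2 (\<lambda>e. dp a (t e))" if "dtm t" for t
  proof (rule dtm2_app1[of "dp a", OF _ _ that])
    fix s t assume st: "dtm s" "dtm2 t"
    have "dfn (\<lambda>e. f (s e) = t e)" by (intro G_intros line_dtm[OF f(1)] st)
    then show "dfn (\<lambda>e. dp a (s e) = t e)"
      by (rule dfn_cong[THEN iffD1, rotated]) (simp add: e dtm_in[OF st(1)])
  qed (simp add: e line_in[OF f(1)])
  show "line (emb a) (dp a)" using f(1) d unfolding line_def by (simp add: e)
  show "b \<in> D \<Longrightarrow> y \<in> G \<Longrightarrow> dp_graph a b y \<longleftrightarrow> dp a b = y" using f e by simp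
qed

lemma dp_in [simp]: "a \<in> D \<Longrightarrow> b \<in> D \<Longrightarrow> dp a b \<in> G"
  using line_in dp_props(1) by blast

lemma dtm2_dp: assumes "dtm s" "dtm t" shows "dtm2 (\<lambda>e. dp (s e) (t e))"
proof (rule dtm2_app2[of dp, OF _ _ assms])
  fix r s t assume st: "dtm r" "dtm s" "dtm2 t"
  have "dfn (\<lambda>e. dp_graph (r e) (s e) (t e))" by (intro dfn_dp_graph st)
  then show "dfn (\<lambda>e. dp (r e) (s e) = t e)"
    by (rule dfn_cong[THEN iffD1, rotated])
      (simp add: dp_props(2) dtm_in[OF st(1)] dtm_in[OF st(2)] dtm2_in[OF st(3)])
qed simp

text \<open>
  Schoolbook multiplication of two-digit numbers; the product of the two higher digits vanishes
  modulo \<open>(N + 1) * (N + 1)\<close>.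
\<close>

definition mul2 :: "'a list \<Rightarrow> 'a list \<Rightarrow> 'a list" (infixl "\<otimes>" 70) where
  "x \<otimes> y = raise (dp (hd x) (last y)) \<oplus> raise (dp (last x) (hd y)) \<oplus> dp (last x) (last y)"

lemma mul2_in [simp]: "x \<in> G \<Longrightarrow> y \<in> G \<Longrightarrow> x \<otimes> y \<in> G"
  by (simp add: mul2_def)

lemma dtm2_mul2: "dtm2 s \<Longrightarrow> dtm2 t \<Longrightarrow> dtm2 (\<lambda>e. s e \<otimes> t e)"
  unfolding mul2_def by (intro dtm2_add2 dtm2_raise dtm2_dp dtm_hd dtm_last)

lemma mul2_zero2: "x \<in> G \<Longrightarrow> x \<otimes> zero2 = zero2"
  using line_Z[OF dp_props(1)] by (simp add: mul2_def raise_pair)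

lemma mul2_sc2: assumes "x \<in> G" "y \<in> G" "y \<noteq> top2" shows "x \<otimes> sc2 y = x \<otimes> y \<oplus> x"
proof (rule G_cases[OF assms(1)], rule G_cases[OF assms(2)])
  fix a b h l assume i: "a \<in> D" "b \<in> D" "x = [a, b]" "h \<in> D" "l \<in> D" "y = [h, l]"
  note L = line_Z[OF dp_props(1)] line_sc[OF dp_props(1)]
  show "x \<otimes> sc2 y = x \<otimes> y \<oplus> x"
  proof (cases "l = N")
    case False
    have "x = raise (emb a) \<oplus> emb b" using digits[of a b] i by (simp add: raise_pair)
    then have "x \<otimes> y \<oplus> x = x \<otimes> y \<oplus> (raise (emb a) \<oplus> emb b)" by simp
    moreover have "x \<otimes> sc2 y = x \<otimes> y \<oplus> (raise (emb a) \<oplus> emb b)"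
      using i False by (simp add: mul2_def sc2_def L raise_add2 add2_ac)
    ultimately show ?thesis by simp
  next
    case True
    then have h: "h \<noteq> N" using i assms by simp
    have n: "dp a N \<oplus> emb a = [a, Z]" "dp b N \<oplus> emb b = [b, Z]"
      using line_N[OF dp_props(1)] i by (simp_all add: raise_pair)
    have "x \<otimes> y \<oplus> x = raise (dp a N) \<oplus> raise (dp b h) \<oplus> dp b N \<oplus> (raise (emb a) \<oplus> emb b)"
      using digits[of a b] i True by (simp add: raise_pair mul2_def)
    also have "\<dots> = raise (dp a N \<oplus> emb a) \<oplus> (raise (dp b h) \<oplus> (dp b N \<oplus> emb b))"
      using i by (simp add: raise_add2 add2_ac)
    also have "\<dots> = raise (dp b h) \<oplus> [b, Z]" using i by (simp add: n raise_pair)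
    also have "\<dots> = x \<otimes> sc2 y"
      using i True h by (simp add: mul2_def sc2_def L raise_add2 raise_pair)
    finally show ?thesis by simp
  qed
qed

section \<open>The taller model\<close>

definition lt2 :: "'a list \<Rightarrow> 'a list \<Rightarrow> bool" where
  "lt2 x y \<longleftrightarrow> lt (hd x) (hd y) \<or> hd x = hd y \<and> lt (last x) (last y)"

text \<open>
  The partial operations of the taller model.  A sum is defined if no step of the recursion that
  computes it leaves \<open>top2\<close>; likewise for a product with sums as steps.
\<close>

definition padd :: "'a list \<Rightarrow> 'a list \<Rightarrow> 'a list \<Rightarrow> bool" where
  "padd x y z \<longleftrightarrow> x \<oplus> y = z \<and> (\<forall>y'\<in>G. lt2 y' y \<longrightarrow> x \<oplus> y' \<noteq> top2)"

definition pmul :: "'a list \<Rightarrow> 'a list \<Rightarrow> 'a list \<Rightarrow> bool" where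
  "pmul x y z \<longleftrightarrow> x \<otimes> y = z \<and> (\<forall>y'\<in>G. lt2 y' y \<longrightarrow> (\<exists>w\<in>G. padd (x \<otimes> y') x w))"

definition tall :: "'a list fa_struct" where
  "tall = \<lparr>Dom = G, Zero = zero2, One = one2, Top = top2, Less = lt2, Add = padd, Mul = pmul\<rparr>"

lemma tall_sel [simp]: "Dom tall = G" "Zero tall = zero2" "One tall = one2" "Top tall = top2"
  "Less tall = lt2" "Add tall = padd" "Mul tall = pmul"
  by (simp_all add: tall_def)

lemma dfn_lt2: "dtm2 s \<Longrightarrow> dtm2 t \<Longrightarrow> dfn (\<lambda>e. lt2 (s e) (t e))"
  unfolding lt2_def by (intro G_intros)

lemma dfn_padd:
  assumes "dtm2 s" "dtm2 t" "dtm2 u" shows "dfn (\<lambda>e. padd (s e) (t e) (u e))"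
  unfolding padd_def
  by (intro G_intros dfn_lt2 assms dtm2_shift[OF dtm2_shift[OF assms(1)]]
      dtm2_shift[OF dtm2_shift[OF assms(2)]])

lemma dfn_pmul:
  assumes "dtm2 s" "dtm2 t" "dtm2 u" shows "dfn (\<lambda>e. pmul (s e) (t e) (u e))"
  unfolding pmul_def
  by (intro G_intros dfn_lt2 dfn_padd dtm2_mul2 assms dtm2_shift[OF dtm2_shift[OF assms(1)]]
      dtm2_shift[OF dtm2_shift[OF assms(2)]]
      dtm2_shift[OF dtm2_shift[OF dtm2_shift[OF dtm2_shift[OF assms(1)]]]])

lemma lt2_pair [simp]: "lt2 [a, b] [c, d] \<longleftrightarrow> lt a c \<or> a = c \<and> lt b d"
  by (simp add: lt2_def)

lemma lt2_irrefl: "x \<in> G \<Longrightarrow> \<not> lt2 x x"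
  by (auto elim!: G_cases simp: lt_irrefl)

lemma lt2_trans: "x \<in> G \<Longrightarrow> y \<in> G \<Longrightarrow> z \<in> G \<Longrightarrow> lt2 x y \<Longrightarrow> lt2 y z \<Longrightarrow> lt2 x z"
  by (auto elim!: G_cases intro: lt_trans)

lemma lt2_linear: "x \<in> G \<Longrightarrow> y \<in> G \<Longrightarrow> lt2 x y \<or> x = y \<or> lt2 y x"
  using lt_linear by (elim G_cases) (simp, metis)

lemma zero2_le: "x \<in> G \<Longrightarrow> zero2 = x \<or> lt2 zero2 x"
  using Z_le by (elim G_cases) auto

lemma le_top2: "x \<in> G \<Longrightarrow> x = top2 \<or> lt2 x top2"
  using le_N by (elim G_cases) auto

lemma lt2_sc2:
  assumes "x \<in> G" "y \<in> G" "x \<noteq> top2" shows "lt2 y (sc2 x) \<longleftrightarrow> y = x \<or> lt2 y x"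
proof (rule G_cases[OF assms(1)], rule G_cases[OF assms(2)])
  fix a b c d assume h: "a \<in> D" "b \<in> D" "x = [a, b]" "c \<in> D" "d \<in> D" "y = [c, d]"
  show ?thesis
  proof (cases "b = N")
    case True
    then have "a \<noteq> N" using h assms by simp
    then show ?thesis using True h lt_sc_iff[of a c] not_lt_Z[of d] le_N[of d] lt_irrefl
      by (auto simp: sc2_def)
  next
    case False
    then show ?thesis using h lt_sc_iff[of b d] by (auto simp: sc2_def)
  qed
qed

lemma imm_succ_sc2: "x \<in> G \<Longrightarrow> x \<noteq> top2 \<Longrightarrow> imm_succ tall x (sc2 x)"
  unfolding imm_succ_def tall_sel using lt2_sc2[of x] lt2_irrefl[of x] lt2_trans[of x _ x]
  by (metis sc2_in)

lemma is_struct_tall: "is_fa_struct tall"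
  by (auto simp: is_fa_struct_def padd_def pmul_def)

lemma order_tall: "fa_order tall"
proof -
  have "\<exists>x\<in>G. imm_succ tall x y" if y: "y \<in> G" "y \<noteq> zero2" for y
  proof -
    obtain x where x: "x \<in> G" "y = sc2 x" using sc2_surj y by blast
    then have "x \<noteq> top2" using y by auto
    then show ?thesis using imm_succ_sc2 x by blast
  qed
  moreover have "\<exists>y\<in>G. imm_succ tall x y" if "x \<in> G" "x \<noteq> top2" for x
    using imm_succ_sc2 that sc2_in by blast
  ultimately show ?thesis unfolding fa_order_def tall_sel
    using lt2_irrefl lt2_trans lt2_linear zero2_le le_top2 by (intro conjI ballI impI) blast+
qed

lemma padd_zero2: "x \<in> G \<Longrightarrow> padd x zero2 x"
  using not_lt_Z by (auto simp: padd_def elim!: G_cases)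

lemma padd_sc2:
  assumes "x \<in> G" "y \<in> G" "y \<noteq> top2"
  shows "padd x (sc2 y) z \<longleftrightarrow> (\<exists>t\<in>G. padd x y t \<and> t \<noteq> top2 \<and> z = sc2 t)"
  using assms lt2_sc2[of y] by (auto simp: padd_def add2_sc2_right)

lemma one2_eq: "one2 = sc2 zero2" by (simp add: sc2_def)

lemma padd_one2: "x \<in> G \<Longrightarrow> padd x one2 z \<longleftrightarrow> x \<noteq> top2 \<and> z = sc2 x"
  unfolding one2_eq using padd_sc2[of x zero2 z] padd_zero2[of x] by (auto simp: padd_def)

lemma pmul_zero2: "x \<in> G \<Longrightarrow> pmul x zero2 zero2"
  using not_lt_Z by (auto simp: pmul_def mul2_zero2 elim!: G_cases)

lemma pmul_sc2:
  assumes "x \<in> G" "y \<in> G" "y \<noteq> top2" "z \<in> G"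
  shows "pmul x (sc2 y) z \<longleftrightarrow> (\<exists>t\<in>G. pmul x y t \<and> padd t x z)"
proof -
  have "(\<exists>w\<in>G. padd (x \<otimes> y) x w) \<and> x \<otimes> y \<oplus> x = z \<longleftrightarrow> padd (x \<otimes> y) x z"
    using assms by (auto simp: padd_def)
  then show ?thesis using assms lt2_sc2[of y] mul2_sc2[of x y] unfolding pmul_def by auto
qed

lemma successor_tall: "fa_successor tall"
  unfolding fa_successor_def tall_sel
  using padd_one2 imm_succ_sc2 lt2_irrefl by (metis sc2_in pair_in_G consts_in(3))

lemma arith_tall: "fa_arithmetic tall"
proof -
  have "(\<exists>s\<in>G. padd m one2 s \<and> padd n s z) \<longleftrightarrow> (\<exists>t\<in>G. padd n m t \<and> padd t one2 z)"
    "(\<exists>s\<in>G. padd m one2 s \<and> pmul n s z) \<longleftrightarrow> (\<exists>t\<in>G. pmul n m t \<and> padd t n z)"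
    if "n \<in> G" "m \<in> G" "lt2 m top2" "z \<in> G" for n m z
  proof -
    have m: "m \<noteq> top2" using that lt2_irrefl by blast
    then have "(\<exists>s\<in>G. padd m one2 s \<and> R s) \<longleftrightarrow> R (sc2 m)" for R
      using that by (auto simp: padd_one2)
    then show "(\<exists>s\<in>G. padd m one2 s \<and> padd n s z) \<longleftrightarrow> (\<exists>t\<in>G. padd n m t \<and> padd t one2 z)"
      "(\<exists>s\<in>G. padd m one2 s \<and> pmul n s z) \<longleftrightarrow> (\<exists>t\<in>G. pmul n m t \<and> padd t n z)"
      using padd_sc2[OF that(1,2) m, of z] pmul_sc2[OF that(1,2) m that(4)] padd_one2 by auto
  qed
  then show ?thesis unfolding fa_arithmetic_def tall_sel
    using padd_zero2 pmul_zero2 by auto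
qed

text \<open>
  A variable of the taller model becomes two variables of \<open>M\<close>, one for each digit.
\<close>

lemma dfn_sat_tall: "dfn (\<lambda>e. sat tall (\<lambda>i. [e (2 * i), e (2 * i + 1)]) p)"
proof (induction p)
  case (FAll v p)
  define r where "r i = (if i = 2 * v then 1 else if i = 2 * v + 1 then 0 else i + 2)" for i
  have "inj r" by (auto simp: inj_def r_def)
  from dfn_rename[OF FAll this]
  have *: "dfn (\<lambda>e. sat tall (\<lambda>i. [e (r (2 * i)), e (r (2 * i + 1))]) p)" .
  have "(\<lambda>i. [e (r (2 * i)), e (r (2 * i + 1))])
      = (\<lambda>i. [e (Suc (Suc (2 * i))), e (Suc (Suc (2 * i + 1)))])(v := [e 1, e 0])" for e :: "nat \<Rightarrow> 'a"
  proof
    fix i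
    have "2 * i \<noteq> 2 * v + 1" "2 * i + 1 \<noteq> 2 * v" by presburger+
    then show "[e (r (2 * i)), e (r (2 * i + 1))] =
        ((\<lambda>i. [e (Suc (Suc (2 * i))), e (Suc (Suc (2 * i + 1)))])(v := [e 1, e 0])) i"
      by (simp add: r_def)
  qed
  with * have **: "dfn (\<lambda>e. sat tall
      ((\<lambda>i. [e (Suc (Suc (2 * i))), e (Suc (Suc (2 * i + 1)))])(v := [e 1, e 0])) p)" by simp
  show ?case unfolding sat.simps tall_sel by (rule dfn_all2) (rule **)
next
  have t: "dtm2 (\<lambda>e. tval tall (\<lambda>i. [e (2 * i), e (2 * i + 1)]) t)" for t
    by (cases t) (simp_all add: dtm2_pair dtm_var dtm2_const)
  { case (FEq s t) show ?case unfolding sat.simps by (intro dfn_eq2 t) }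
  { case (FLess s t) show ?case unfolding sat.simps tall_sel by (intro dfn_lt2 t) }
  { case (FAdd s t u) show ?case unfolding sat.simps tall_sel by (intro dfn_padd t) }
  { case (FMul s t u) show ?case unfolding sat.simps tall_sel by (intro dfn_pmul t) }
qed (auto intro: dfn_not dfn_conj)

lemma induction_tall: "fa_induction tall"
  unfolding fa_induction_def tall_sel
proof (intro allI impI)
  fix p v and e :: "nat \<Rightarrow> 'a list"
  assume e: "range e \<subseteq> G" and base: "sat tall (e(v := zero2)) p"
    and step: "\<forall>n\<in>G. \<forall>m\<in>G. lt2 n top2 \<longrightarrow> padd n one2 m \<longrightarrow>
      sat tall (e(v := n)) p \<longrightarrow> sat tall (e(v := m)) p"
  define e0 where "e0 i = (if even i then hd (e (i div 2)) else last (e (i div 2)))" for i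
  have eG: "e i \<in> G" for i using e by auto
  have "env e0" using eG by (auto simp: env_def e0_def)
  define r where "r i = (if i = 2 * v then 0 else if i = 2 * v + 1 then 2 else 2 * i + 1)" for i
  have "inj r" unfolding inj_def r_def by presburger
  have 1: "dfn (\<lambda>f. sat tall (\<lambda>i. [merge f e0 (r (2 * i)), merge f e0 (r (2 * i + 1))]) p)"
    by (rule dfn_params[OF dfn_rename[OF dfn_sat_tall \<open>inj r\<close>] \<open>env e0\<close>])
  have 2: "(\<lambda>i. [merge f e0 (r (2 * i)), merge f e0 (r (2 * i + 1))]) = e(v := [f 0, f 1])" for f
  proof
    fix i
    have "2 * i \<noteq> 2 * v + 1" "2 * i + 1 \<noteq> 2 * v" by presburger+
    then show "[merge f e0 (r (2 * i)), merge f e0 (r (2 * i + 1))] = (e(v := [f 0, f 1])) i"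
      using pair_eta[OF eG[of i]] by (simp add: r_def merge_def e0_def)
  qed
  have "\<forall>n\<in>G. sat tall (e(v := n)) p"
  proof
    fix n assume "n \<in> G"
    then show "sat tall (e(v := n)) p"
    proof (rule induct_G[of "\<lambda>n. sat tall (e(v := n)) p", rotated -1])
      show "dfn (\<lambda>f. sat tall (e(v := [f 0, f 1])) p)" using 1 unfolding 2 .
      fix x assume x: "x \<in> G" "x \<noteq> top2" "sat tall (e(v := x)) p"
      then have "lt2 x top2" "padd x one2 (sc2 x)" using le_top2 padd_one2 by auto
      then show "sat tall (e(v := sc2 x)) p" using step x sc2_in by blast
    qed (rule base)
  qed
  then show "\<forall>n\<in>G. sat tall (e(v := n)) p" .
qed

lemma FA_tall: "FA_model tall"
  unfolding FA_model_def
  using is_struct_tall order_tall successor_tall arith_tall induction_tall by simp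

subsection \<open>Initial segment\<close>

lemma sc2_emb: "b \<in> D \<Longrightarrow> b \<noteq> N \<Longrightarrow> sc2 (emb b) = emb (sc b)"
  by (simp add: sc2_def)

lemma below_emb: "y \<in> G \<Longrightarrow> lt2 y (emb b) \<Longrightarrow> \<exists>a\<in>D. y = emb a \<and> lt a b"
  using not_lt_Z by (auto elim!: G_cases)

lemma padd_emb:
  assumes "h \<in> D" "h \<noteq> N" "l \<in> D" "b \<in> D" shows "padd [h, l] (emb b) z \<longleftrightarrow> [h, l] \<oplus> emb b = z"
proof -
  have "[h, l] \<oplus> y \<noteq> top2" if "y \<in> G" "lt2 y (emb b)" for y
    using below_emb[OF that] ov_neq_N assms by (auto simp: add2_def)
  then show ?thesis by (auto simp: padd_def)
qed

text \<open>
  The higher digit of \<open>x * y\<close> grows by at most one when \<open>y\<close> grows by one.  As it stays below \<open>N\<close>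
  while \<open>y\<close> does, no step of the computation of \<open>x * y\<close> wraps around.
\<close>

lemma hd_mul_emb:
  assumes "x \<in> D" "y \<in> D" shows "le (hd (emb x \<otimes> emb y)) y"
proof (rule induct_D[of "\<lambda>y. le (hd (emb x \<otimes> emb y)) y"])
  show "dfn (\<lambda>e. le (hd (emb x \<otimes> emb (e 0))) (e 0))"
    by (intro G_intros dtm2_mul2 dtm2_const) (use assms in auto)
  show "le (hd (emb x \<otimes> emb Z)) Z" using mul2_zero2[of "emb x"] assms by simp
  fix n assume n: "n \<in> D" "n \<noteq> N" "le (hd (emb x \<otimes> emb n)) n"
  have i: "emb x \<otimes> emb n \<in> G" using n assms by simp
  obtain h l where hl: "h \<in> D" "l \<in> D" "emb x \<otimes> emb n = [h, l]" using i by (rule G_cases)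
  have "emb x \<otimes> emb (sc n) = [h, l] \<oplus> emb x"
    using mul2_sc2[of "emb x" "emb n"] sc2_emb n assms hl by simp
  moreover have "h \<noteq> N" using n hl not_N_lt by auto
  moreover have "le h (sc n)" "le (sc h) (sc n)"
    using n hl \<open>h \<noteq> N\<close> lt_sc_iff[of n h] sc_lt_iff[of h n] by auto
  ultimately show "le (hd (emb x \<otimes> emb (sc n))) (sc n)"
    using hl assms by (simp add: add2_def)
qed (rule assms)

lemma pmul_emb:
  assumes "x \<in> D" "y \<in> D" shows "pmul (emb x) (emb y) z \<longleftrightarrow> emb x \<otimes> emb y = z"
proof -
  have "\<exists>w\<in>G. padd (emb x \<otimes> y') (emb x) w" if y': "y' \<in> G" "lt2 y' (emb y)" for y'
  proof -
    obtain b where b: "b \<in> D" "y' = emb b" "lt b y" using below_emb[OF y'] by blast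
    have i: "emb x \<otimes> emb b \<in> G" using b assms by simp
    obtain h l where hl: "h \<in> D" "l \<in> D" "emb x \<otimes> emb b = [h, l]" using i by (rule G_cases)
    have "h \<noteq> N" using hd_mul_emb[of x b] hl b assms lt_neq_N not_N_lt by auto
    then show ?thesis using padd_emb[of h l x "[h, l] \<oplus> emb x"] hl b assms by auto
  qed
  then show ?thesis by (auto simp: pmul_def)
qed

lemma Mul_iff:
  assumes "x \<in> D" "y \<in> D" "z \<in> D" shows "Mul M x y z \<longleftrightarrow> emb x \<otimes> emb y = emb z"
proof -
  have "\<forall>z\<in>D. Mul M x y z \<longleftrightarrow> emb x \<otimes> emb y = emb z"
  proof (rule induct_D[of "\<lambda>y. \<forall>z\<in>D. Mul M x y z \<longleftrightarrow> emb x \<otimes> emb y = emb z"])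
    show "dfn (\<lambda>e. \<forall>z\<in>D. Mul M x (e 0) z \<longleftrightarrow> emb x \<otimes> emb (e 0) = emb z)"
      by (intro G_intros dtm2_mul2 dtm_const assms)
    show "\<forall>z\<in>D. Mul M x Z z \<longleftrightarrow> emb x \<otimes> emb Z = emb z"
      using mul2_zero2[of "emb x"] assms Mul_Z by auto
    fix n assume n: "n \<in> D" "n \<noteq> N" "\<forall>z\<in>D. Mul M x n z \<longleftrightarrow> emb x \<otimes> emb n = emb z"
    have i: "emb x \<otimes> emb n \<in> G" using n assms by simp
    obtain h l where hl: "h \<in> D" "l \<in> D" "emb x \<otimes> emb n = [h, l]" using i by (rule G_cases)
    have hN: "h \<noteq> N" using hd_mul_emb[of x n] hl n assms not_N_lt by auto
    have eq: "emb x \<otimes> emb (sc n) = [h, l] \<oplus> emb x"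
      using mul2_sc2[of "emb x" "emb n"] sc2_emb n assms hl by simp
    show "\<forall>z\<in>D. Mul M x (sc n) z \<longleftrightarrow> emb x \<otimes> emb (sc n) = emb z"
    proof
      fix z assume z: "z \<in> D"
      have "Mul M x (sc n) z \<longleftrightarrow> (\<exists>t\<in>D. [h, l] = emb t \<and> emb t \<oplus> emb x = emb z)"
        using Mul_sc[of x n z] n hl z assms emb_Add by auto
      also have "\<dots> \<longleftrightarrow> h = Z \<and> [h, l] \<oplus> emb x = emb z" using hl by auto
      also have "\<dots> \<longleftrightarrow> [h, l] \<oplus> emb x = emb z" using hN sc_nz[of h] hl by (auto simp: add2_def)
      finally show "Mul M x (sc n) z \<longleftrightarrow> emb x \<otimes> emb (sc n) = emb z" using eq by simp
    qed
  qed (rule assms)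
  then show ?thesis using assms by blast
qed

lemma taller: "strictly_taller_via emb M tall"
proof -
  have "[sc Z, Z] \<in> G - emb ` D" using sc_nz[of Z] by auto
  then have "emb ` D \<subset> G" by auto
  moreover have "y \<in> emb ` D" if "x \<in> emb ` D" "y \<in> G" "lt2 y x" for x y
    using that below_emb by blast
  ultimately show ?thesis unfolding strictly_taller_via_def tall_sel
    using One_eq lt_irrefl emb_Add padd_emb[of Z] pmul_emb Mul_iff
    by (auto simp: inj_on_def)
qed

lemma padd_defined: "x \<in> D \<Longrightarrow> y \<in> D \<Longrightarrow> \<exists>z\<in>G. padd (emb x) (emb y) z"
  using padd_emb[of Z x y] by simp

lemma pmul_defined: "x \<in> D \<Longrightarrow> y \<in> D \<Longrightarrow> \<exists>z\<in>G. pmul (emb x) (emb y) z"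
  using pmul_emb by simp

section \<open>Bi-interpretation\<close>

lemma interpretation_tall: "interpretation_in M tall 2 (\<lambda>x. {x})"
proof (rule interpretation_inI[of tall "\<lambda>x. x"])
  show "is_fa_struct tall" by (rule is_struct_tall)
  have "dfn (\<lambda>e. True)" by (rule dfn_True)
  then show "definable M 2 ((\<lambda>x. x) ` Dom tall)" by (rule definableI) auto
  have 2: "definable M (2 * 2) {x @ y |x y. x \<in> G \<and> y \<in> G \<and> R x y}"
    if "dfn (\<lambda>e. R [e 0, e 1] [e 2, e 3])" for R
    using that
  proof (rule definableI)
    fix xs and e :: "nat \<Rightarrow> 'a"
    assume "xs \<in> tuples M (2 * 2)" and e: "\<And>i. i < 2 * 2 \<Longrightarrow> e i = xs ! i"
    then obtain a b c d where h: "a \<in> D" "b \<in> D" "c \<in> D" "d \<in> D" "xs = [a, b, c, d]"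
      by (auto simp: tuples_4)
    have "xs = x @ y \<longleftrightarrow> x = [a, b] \<and> y = [c, d]" if "x \<in> G" "y \<in> G" for x y
      using that h by (auto elim!: G_cases)
    moreover have "xs = [a, b] @ [c, d]" "[a, b] \<in> G" "[c, d] \<in> G" using h by simp_all
    ultimately have "xs \<in> {x @ y |x y. x \<in> G \<and> y \<in> G \<and> R x y} \<longleftrightarrow> R [a, b] [c, d]"
      by blast
    then show "xs \<in> {x @ y |x y. x \<in> G \<and> y \<in> G \<and> R x y} \<longleftrightarrow>
      R [e 0, e 1] [e 2, e 3]"
      using h e by simp
  qed (auto simp: tuples_4 elim!: G_cases)
  have "{x @ x |x. x \<in> Dom tall} = {x @ y |x y. x \<in> G \<and> y \<in> G \<and> x = y}" by auto
  then show "definable M (2 * 2) {x @ x |x. x \<in> Dom tall}"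
    using 2[of "(=)"] dfn_eq2[OF dtm2_pair dtm2_pair] dtm_var by simp
  show "definable M (2 * 2) {x @ y |x y. x \<in> Dom tall \<and> y \<in> Dom tall \<and> Less tall x y}"
    unfolding tall_sel by (intro 2 dfn_lt2 G_intros)
  have *: "definable M (3 * 2) {x @ y @ z |x y z. x \<in> G \<and> y \<in> G \<and> z \<in> G \<and> R x y z}"
    if "dfn (\<lambda>e. R [e 0, e 1] [e 2, e 3] [e 4, e 5])" for R
    using that
  proof (rule definableI)
    fix xs and e :: "nat \<Rightarrow> 'a"
    assume "xs \<in> tuples M (3 * 2)" and e: "\<And>i. i < 3 * 2 \<Longrightarrow> e i = xs ! i"
    then obtain a b c d f g where h: "a \<in> D" "b \<in> D" "c \<in> D" "d \<in> D" "f \<in> D" "g \<in> D"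
      "xs = [a, b, c, d, f, g]" by (auto simp: tuples_6)
    have "xs = x @ y @ z \<longleftrightarrow> x = [a, b] \<and> y = [c, d] \<and> z = [f, g]"
      if "x \<in> G" "y \<in> G" "z \<in> G" for x y z
      using that h by (auto elim!: G_cases)
    moreover have "xs = [a, b] @ [c, d] @ [f, g]" "[a, b] \<in> G" "[c, d] \<in> G" "[f, g] \<in> G"
      using h by simp_all
    ultimately have "xs \<in> {x @ y @ z |x y z. x \<in> G \<and> y \<in> G \<and> z \<in> G \<and> R x y z} \<longleftrightarrow> R [a, b] [c, d] [f, g]"
      by blast
    then show "xs \<in> {x @ y @ z |x y z. x \<in> G \<and> y \<in> G \<and> z \<in> G \<and> R x y z} \<longleftrightarrow>
      R [e 0, e 1] [e 2, e 3] [e 4, e 5]"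
      using h e by simp
  qed (auto simp: tuples_6 elim!: G_cases)
  show "definable M (3 * 2) {x @ y @ z |x y z. x \<in> Dom tall \<and> y \<in> Dom tall \<and> z \<in> Dom tall \<and>
      Add tall x y z}"
    unfolding tall_sel by (intro * dfn_padd G_intros)
  show "definable M (3 * 2) {x @ y @ z |x y z. x \<in> Dom tall \<and> y \<in> Dom tall \<and> z \<in> Dom tall \<and>
      Mul tall x y z}"
    unfolding tall_sel by (intro * dfn_pmul G_intros)
qed (auto intro: definable_singleton_2)

lemma struct_tall: "struct tall"
  by (rule struct.intro[OF is_struct_tall])

text \<open>
  Membership in the copy of \<open>M\<close>, expressed by a formula with the parameter \<open>[0, N]\<close>.
\<close>

definition low :: "'a list \<Rightarrow> bool" where
  "low y \<longleftrightarrow> Less tall y (emb N) \<or> y = emb N"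

lemma low: "y \<in> G \<Longrightarrow> low y \<longleftrightarrow> y \<in> emb ` D"
proof (elim G_cases)
  fix a b assume "a \<in> D" "b \<in> D" "y = [a, b]"
  then show ?thesis using not_lt_Z[of a] le_N[of b] by (auto simp: low_def)
qed

lemma interpretation_short: "interpretation_in tall M 1 (\<lambda>a. {[emb a]})"
proof -
  interpret T: struct tall by (rule struct_tall)
  note T_intros = T.dfn_intros T.dtm_const
  have dlow: "T.dfn (\<lambda>e. low (e n))" for n
    unfolding low_def by (intro T_intros) simp_all
  have t2: "xs \<in> tuples tall 2 \<longleftrightarrow> (\<exists>x\<in>G. \<exists>y\<in>G. xs = [x, y])" for xs using T.G_iff by simp
  have t3: "xs \<in> tuples tall 3 \<longleftrightarrow> (\<exists>x\<in>G. \<exists>y\<in>G. \<exists>z\<in>G. xs = [x, y, z])" for xs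
    using T.tuples_3 by simp
  have t1: "xs \<in> tuples tall 1 \<longleftrightarrow> (\<exists>x\<in>G. xs = [x])" "xs \<in> tuples tall (Suc 0) \<longleftrightarrow> (\<exists>x\<in>G. xs = [x])" for xs
    using T.tuples_1 by simp_all
  note rel = emb_Add padd_emb[of Z] Mul_iff pmul_emb
  show ?thesis
  proof (rule interpretation_inI[of M "\<lambda>a. [emb a]"])
    show "is_fa_struct M" by (rule is_struct)
    show "inj_on (\<lambda>a. [emb a]) D" by (auto simp: inj_on_def)
    have "T.dfn (\<lambda>e. low (e 0))" by (rule dlow)
    then show "definable tall 1 ((\<lambda>a. [emb a]) ` D)"
      by (rule T.definableI) (auto simp: t1 low)
    have "T.dfn (\<lambda>e. low (e 0) \<and> e 0 = e 1)" by (intro T_intros dlow)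
    then show "definable tall (2 * 1) {[emb x] @ [emb x] |x. x \<in> D}"
      by (rule T.definableI) (auto simp: t2 low)
    show "definable tall 1 {[emb Z]}" "definable tall 1 {[emb (One M)]}" "definable tall 1 {[emb N]}"
      by (rule T.definable_singleton_1; simp)+
    have "T.dfn (\<lambda>e. low (e 0) \<and> low (e 1) \<and> Less tall (e 0) (e 1))" by (intro T_intros dlow)
    then show "definable tall (2 * 1) {[emb x] @ [emb y] |x y. x \<in> D \<and> y \<in> D \<and> lt x y}"
      by (rule T.definableI) (auto simp: t2 low lt_irrefl)
    have "T.dfn (\<lambda>e. low (e 0) \<and> low (e 1) \<and> low (e 2) \<and> Add tall (e 0) (e 1) (e 2))"
      by (intro T_intros dlow)
    then show "definable tall (3 * 1)
        {[emb x] @ [emb y] @ [emb z] |x y z. x \<in> D \<and> y \<in> D \<and> z \<in> D \<and> Add M x y z}"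
      by (rule T.definableI) (auto simp: t3 low rel)
    have "T.dfn (\<lambda>e. low (e 0) \<and> low (e 1) \<and> low (e 2) \<and> Mul tall (e 0) (e 1) (e 2))"
      by (intro T_intros dlow)
    then show "definable tall (3 * 1)
        {[emb x] @ [emb y] @ [emb z] |x y z. x \<in> D \<and> y \<in> D \<and> z \<in> D \<and> Mul M x y z}"
      by (rule T.definableI) (auto simp: t3 low rel)
  qed
qed

lemma iterated_copy_short: "iterated_copy (\<lambda>x. {x}) (\<lambda>a. {[emb a]}) a = {emb a}"
  by (auto simp: iterated_copy_def list_all2_Cons2)

lemma iterated_copy_tall:
  assumes "b \<in> G"
  shows "iterated_copy (\<lambda>a. {[emb a]}) (\<lambda>x. {x}) b = {[emb (hd b), emb (last b)]}"
  using assms by (auto simp: iterated_copy_def list_all2_Cons2 elim!: G_cases)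

text \<open>
  The pair \<open>[1, 0]\<close> is the base \<open>N + 1\<close>.
\<close>

lemma raise_mul_emb: "a \<in> D \<Longrightarrow> [sc Z, Z] \<otimes> emb a = [a, Z]"
proof (rule induct_D[of "\<lambda>a. [sc Z, Z] \<otimes> emb a = [a, Z]"])
  show "dfn (\<lambda>e. [sc Z, Z] \<otimes> emb (e 0) = [e 0, Z])"
    by (intro G_intros dtm2_mul2)
  show "[sc Z, Z] \<otimes> emb Z = [Z, Z]" using mul2_zero2[of "[sc Z, Z]"] by simp
  fix n assume n: "n \<in> D" "n \<noteq> N" "[sc Z, Z] \<otimes> emb n = [n, Z]"
  then have "[sc Z, Z] \<otimes> emb (sc n) = [n, Z] \<oplus> [sc Z, Z]"
    using mul2_sc2[of "[sc Z, Z]" "emb n"] sc2_emb[of n] by simp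
  also have "\<dots> = [sc n, Z]" using n wadd_sc[of n Z] by (simp add: add2_def)
  finally show "[sc Z, Z] \<otimes> emb (sc n) = [sc n, Z]" .
qed

text \<open>
  The base is the left factor: its multiples are then reached in single steps of size \<open>[1, 0]\<close>, and
  checking that none wraps around needs only the higher digit.
\<close>

lemma pmul_raise: assumes "a \<in> D" shows "pmul [sc Z, Z] (emb a) t \<longleftrightarrow> t = [a, Z]"
proof -
  have "\<exists>w\<in>G. padd ([sc Z, Z] \<otimes> y') [sc Z, Z] w" if y': "y' \<in> G" "lt2 y' (emb a)" for y'
  proof -
    obtain b where b: "b \<in> D" "y' = emb b" "lt b a" using below_emb[OF y'] by blast
    have bN: "b \<noteq> N" using b lt_neq_N assms by blast
    have "[b, Z] \<oplus> u \<noteq> top2" if u: "u \<in> G" "lt2 u [sc Z, Z]" for u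
    proof (rule G_cases[OF u(1)])
      fix c d assume c: "c \<in> D" "d \<in> D" "u = [c, d]"
      then have "c = Z" using u lt_sc_iff[of Z c] not_lt_Z by auto
      then show ?thesis using c b bN by (simp add: add2_def)
    qed
    then show ?thesis using b raise_mul_emb[of b]
      by (intro bexI[of _ "[b, Z] \<oplus> [sc Z, Z]"]) (auto simp: padd_def)
  qed
  then show ?thesis using raise_mul_emb[OF assms] by (auto simp: pmul_def)
qed

lemma padd_digits: 
  assumes "a \<in> D" "b \<in> D" shows "padd [a, Z] (emb b) x \<longleftrightarrow> x = [a, b]"
proof -
  have "[a, Z] \<oplus> y \<noteq> top2" if y: "y \<in> G" "lt2 y (emb b)" for y
    using below_emb[OF y] assms lt_neq_N[of _ b] by (auto simp: digits)
  then show ?thesis using digits assms by (auto simp: padd_def)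
qed

text \<open>
  The copy of \<open>a\<close> in the copy of the taller model is \<open>[0, a]\<close>, and a pair \<open>[a, b]\<close> corresponds to
  the pair of its digits \<open>[0, a]\<close> and \<open>[0, b]\<close>.  The second correspondence is defined by
  \<open>[1, 0] * [0, a] + [0, b] = [a, b]\<close>.
\<close>

lemma bi_interpretable_tall: "bi_interpretable M tall"
  unfolding bi_interpretable_def
proof (intro exI conjI)
  show "interpretation_in M tall 2 (\<lambda>x. {x})" by (rule interpretation_tall)
  show "interpretation_in tall M 1 (\<lambda>a. {[emb a]})" by (rule interpretation_short)
  have "dfn (\<lambda>e. e 1 = Z \<and> e 2 = e 0)" by (intro dfn_intros dtm_const')
  then show "definable M (1 + 2 * 1)
      {a # w |a w. a \<in> D \<and> w \<in> iterated_copy (\<lambda>x. {x}) (\<lambda>a. {[emb a]}) a}"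
    unfolding iterated_copy_short by (rule definableI) (auto simp: tuples_Suc_3)
  interpret T: struct tall by (rule struct_tall)
  have "T.dfn (\<lambda>e. low (e 1) \<and> low (e 2) \<and>
      (\<exists>t\<in>Dom tall. Mul tall [sc Z, Z] (e 1) t \<and> Add tall t (e 2) (e 0)))"
    unfolding low_def by (intro T.dfn_intros T.dtm_const) simp_all
  then show "definable tall (1 + 2 * 1)
      {b # w |b w. b \<in> Dom tall \<and> w \<in> iterated_copy (\<lambda>a. {[emb a]}) (\<lambda>x. {x}) b}"
  proof (rule T.definableI)
    fix xs assume "xs \<in> {b # w |b w. b \<in> Dom tall \<and> w \<in> iterated_copy (\<lambda>a. {[emb a]}) (\<lambda>x. {x}) b}"
    then show "xs \<in> tuples tall (1 + 2 * 1)"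
      by (auto simp: iterated_copy_tall T.tuples_Suc_3)
  next
    fix xs and e :: "nat \<Rightarrow> 'a list"
    assume "xs \<in> tuples tall (1 + 2 * 1)" and e: "\<And>i. i < 1 + 2 * 1 \<Longrightarrow> e i = xs ! i"
    then obtain b x y where h: "b \<in> G" "x \<in> G" "y \<in> G" "xs = [b, x, y]"
      using T.tuples_Suc_3[of xs] by auto
    have "xs \<in> {b # w |b w. b \<in> Dom tall \<and> w \<in> iterated_copy (\<lambda>a. {[emb a]}) (\<lambda>x. {x}) b}
        \<longleftrightarrow> x = emb (hd b) \<and> y = emb (last b)"
      using h by (auto simp: iterated_copy_tall)
    also have "\<dots> \<longleftrightarrow> low x \<and> low y \<and> (\<exists>t\<in>G. pmul [sc Z, Z] x t \<and> padd t y b)"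
    proof
      assume "x = emb (hd b) \<and> y = emb (last b)"
      then show "low x \<and> low y \<and> (\<exists>t\<in>G. pmul [sc Z, Z] x t \<and> padd t y b)"
        using h low pmul_raise padd_digits pair_eta by auto
    next
      assume *: "low x \<and> low y \<and> (\<exists>t\<in>G. pmul [sc Z, Z] x t \<and> padd t y b)"
      then obtain p q where "p \<in> D" "q \<in> D" "x = emb p" "y = emb q" using low h by blast
      then show "x = emb (hd b) \<and> y = emb (last b)" using * pmul_raise padd_digits by auto
    qed
    finally show "xs \<in> {b # w |b w. b \<in> Dom tall \<and> w \<in> iterated_copy (\<lambda>a. {[emb a]}) (\<lambda>x. {x}) b}
      \<longleftrightarrow> low (e 1) \<and> low (e 2) \<and>
        (\<exists>t\<in>Dom tall. Mul tall [sc Z, Z] (e 1) t \<and> Add tall t (e 2) (e 0))"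
      using h e by simp
  qed
qed

end

theorem mainTheorem1:
  fixes M :: "'a fa_struct"
  assumes "FA_model M"
    and "Less M (Zero M) (Top M)"
  shows "\<exists>(M' :: 'a list fa_struct) f.
           FA_model M' \<and>
           strictly_taller_via f M M' \<and>
           (\<forall>x\<in>Dom M. \<forall>y\<in>Dom M.
              (\<exists>z\<in>Dom M'. Add M' (f x) (f y) z) \<and> (\<exists>z\<in>Dom M'. Mul M' (f x) (f y) z)) \<and>
           bi_interpretable M M'"
proof -
  interpret fa M
    using assms by unfold_locales (auto simp: FA_model_def)
  show ?thesis
    using FA_tall taller padd_defined pmul_defined bi_interpretable_tall
    by (intro exI[of _ tall] exI[of _ emb] conjI) simp_all
qed

end
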